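(* Let $\alpha\in\mathbb{R}$. For every integer $m\geq1$ and every ambient homogeneous tensor space $\boldsymbol{\mathcal{T}}^\Phi(m-n/2)$, $$\boldsymbol{\Delta}_\alpha^m:\boldsymbol{\mathcal{T}}^\Phi(m-n/2)\to\boldsymbol{\mathcal{T}}^\Phi(-m-n/2)$$ is tangential and so determines a conformally invariant operator $$\Box^\alpha_m:\mathcal{T}^\Phi[m-n/2]\to\mathcal{T}^\Phi[-m-n/2].$$
   Context: $M$ is a smooth oriented $n$-manifold, $n\geq3$, with conformal structure of signature $(p,q)$ given by the ray bundle $\pi:\mathcal{Q}\to M$ of metrics in the class. An ambient manifold is an $(n+2)$-manifold $\tilde M$ with free $\mathbb{R}_+$-action $\rho$ and $\mathbb{R}_+$-equivariant embedding $i:\mathcal{Q}\to\tilde M$ ($\rho(s)(x,g_x)=(x,s^2g_x)$ on $\mathcal{Q}$), with generating vector field $\boldsymbol{X}$. An ambient metric $\boldsymbol{h}$ has signature $(p+1,q+1)$ and satisfies (i) $\mathcal{L}_{\boldsymbol{X}}\boldsymbol{h}=2\boldsymbol{h}$; (ii) $\boldsymbol{h}(i_*\xi,i_*\eta)=g_x(\pi_*\xi,\pi_*\eta)$ for $\xi,\eta\in T_{(x,g_x)}\mathcal{Q}$; (iii) $\mathrm{Ric}(\boldsymbol{h})=O(Q^{n/2-1})$ for $n$ even, and vanishes to all orders along $\mathcal{Q}$ for $n$ odd; (iv) $\boldsymbol{h}(\boldsymbol{X},\cdot)=\frac12dQ$ with $Q=\boldsymbol{h}(\boldsymbol{X},\boldsymbol{X})$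 a defining function for $\mathcal{Q}$. (If $M$ is conformally flat, $\boldsymbol{h}$ is taken flat.) $\boldsymbol{\nabla}$ and $\boldsymbol{R}_{ABCD}$ are the Levi-Civita connection and curvature of $\boldsymbol{h}$; $\boldsymbol{X}^A\boldsymbol{R}_{ABCD}=0$. For an endomorphism $A$ of $T\tilde M$, $A\sharp$ is the natural tensorial action, e.g. $A\sharp T_{AB}=-A^C{}_AT_{CB}-A^C{}_BT_{AC}$, and $\boldsymbol{R}\sharp\sharp$ is the induced double action of $\boldsymbol{R}$ viewed as a section of the tensor square of the bundle of $\boldsymbol{h}$-skew endomorphisms. $\boldsymbol{\Delta}=\boldsymbol{\nabla}^A\boldsymbol{\nabla}_A$, $\boldsymbol{\Delta}_\alpha=\boldsymbol{\Delta}+\alpha\boldsymbol{R}\sharp\sharp$. For an arbitrary ambient tensor bundle (labelled by $\Phi$), $\boldsymbol{\mathcal{T}}^\Phi(w)$ is the space of its sections $S$ with $\boldsymbol{\nabla}_{\boldsymbol{X}}S=wS$. The restrictions to $\mathcal{Q}$ of elements of $\boldsymbol{\mathcal{T}}^\Phi(w)$ are equivalent to sections of a bundle on $M$, the weighted tractor bundle, with section space $\mathcal{T}^\Phi[w]$ (the standard tractor bundle is $T\tilde M|_{\mathcal{Q}}$ modulo an $\mathbb{R}_+$-action). A differential operator $P$ on some domain space is tangential along $\mathcal{Q}$ if, viewing $Q$ as a multiplication operator, $PQ=QP'$ for some operator $P'$; then $P$ is well-defined on restrictions to $\mathcal{Q}$, and hence, if homogeneous, on the corresponding sections $\mathcal{T}^\Phi[w]$.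 "Conformally invariant" means determined by the ambient construction from the conformal structure, without a choice of metric in the class. *)

theory Defs
  imports "HOL-Analysis.Analysis" "HOL-Library.FuncSet"
begin

section \<open>Smooth functions on open subsets of Euclidean spaces\<close>

text \<open>Both notions are meant for open \<open>S\<close> in a finite-dimensional space, where \<open>f\<close> is of class
  \<open>C\<^sup>k\<^sup>+\<^sup>1\<close> iff it is differentiable and all its directional derivatives are of class \<open>C\<^sup>k\<close>.\<close>

primrec Ck_on :: "nat \<Rightarrow> 'a::real_normed_vector set \<Rightarrow> ('a \<Rightarrow> 'b::real_normed_vector) \<Rightarrow> bool" where
  "Ck_on 0 S f = continuous_on S f"
| "Ck_on (Suc k) S f =
     ((\<forall>x\<in>S. f differentiable (at x)) \<and>
      (\<forall>v. Ck_on k S (\<lambda>x. frechet_derivative f (at x) v)))"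

definition smooth_on :: "'a::real_normed_vector set \<Rightarrow> ('a \<Rightarrow> 'b::real_normed_vector) \<Rightarrow> bool" where
  "smooth_on S f \<longleftrightarrow> (\<forall>k. Ck_on k S f)"


section \<open>Manifolds\<close>

text \<open>A chart is a pair of its domain and its coordinate map; values of the coordinate map outside
  the domain are irrelevant. The underlying set of a manifold is the whole type.\<close>

type_synonym ('m, 'n) chart = "'m set \<times> ('m \<Rightarrow> real ^ 'n)"

definition chart_inv :: "('m, 'n) chart \<Rightarrow> real ^ 'n \<Rightarrow> 'm" where
  "chart_inv c = inv_into (fst c) (snd c)"

definition smooth_atlas :: "('m::topological_space, 'n::finite) chart set \<Rightarrow> bool" where
  "smooth_atlas A \<longleftrightarrow>
     \<Union>(fst ` A) = UNIV \<and>
     (\<forall>c\<in>A. open (fst c) \<and> open (snd c ` fst c) \<and>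
            homeomorphism (fst c) (snd c ` fst c) (snd c) (chart_inv c)) \<and>
     (\<forall>c\<in>A. \<forall>d\<in>A. smooth_on (snd c ` (fst c \<inter> fst d)) (\<lambda>y. snd d (chart_inv c y)))"

text \<open>Jacobian at \<open>p\<close> of the change of coordinates from \<open>c\<close> to \<open>d\<close>.\<close>

definition jac :: "('m, 'n::finite) chart \<Rightarrow> ('m, 'n) chart \<Rightarrow> 'm \<Rightarrow> real ^ 'n ^ 'n" where
  "jac c d p = matrix (frechet_derivative (\<lambda>y. snd d (chart_inv c y)) (at (snd c p)))"

text \<open>An orientation is encoded by an atlas with orientation-preserving coordinate changes.\<close>

definition oriented_atlas :: "('m::topological_space, 'n::finite) chart set \<Rightarrow> bool" where
  "oriented_atlas A \<longleftrightarrow>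
     smooth_atlas A \<and> (\<forall>c\<in>A. \<forall>d\<in>A. \<forall>p\<in>fst c \<inter> fst d. det (jac c d p) > 0)"

definition smooth_fun :: "('m, 'n::finite) chart set \<Rightarrow> ('m \<Rightarrow> real) \<Rightarrow> bool" where
  "smooth_fun A f \<longleftrightarrow> (\<forall>c\<in>A. smooth_on (snd c ` fst c) (\<lambda>y. f (chart_inv c y)))"

text \<open>Coordinate partial derivative \<open>\<partial>\<^sub>a f\<close> at \<open>p\<close> in the chart \<open>c\<close>.\<close>

definition pd :: "('m, 'n::finite) chart \<Rightarrow> 'n \<Rightarrow> ('m \<Rightarrow> real) \<Rightarrow> 'm \<Rightarrow> real" where
  "pd c a f p = frechet_derivative (\<lambda>y. f (chart_inv c y)) (at (snd c p)) (axis a 1)"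

text \<open>Maps \<open>F : M \<times> \<real>\<^sub>+ \<rightarrow> N\<close>, in product charts.\<close>

definition cyl_rep ::
  "('m, 'n::finite) chart \<Rightarrow> ('a, 'k::finite) chart \<Rightarrow> ('m \<Rightarrow> real \<Rightarrow> 'a) \<Rightarrow>
    (real ^ 'n) \<times> real \<Rightarrow> real ^ 'k" where
  "cyl_rep c d F = (\<lambda>(y, t). snd d (F (chart_inv c y) t))"

definition smooth_cyl ::
  "('m::topological_space, 'n::finite) chart set \<Rightarrow> ('a::topological_space, 'k::finite) chart set \<Rightarrow>
    ('m \<Rightarrow> real \<Rightarrow> 'a) \<Rightarrow> bool" where
  "smooth_cyl A B F \<longleftrightarrow>
     continuous_on (UNIV \<times> {0<..}) (\<lambda>(x, t). F x t) \<and>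
     (\<forall>c\<in>A. \<forall>d\<in>B.
        smooth_on {(y, t). y \<in> snd c ` fst c \<and> 0 < t \<and> F (chart_inv c y) t \<in> fst d} (cyl_rep c d F))"

definition embedding_cyl ::
  "('m::topological_space, 'n::finite) chart set \<Rightarrow> ('a::topological_space, 'k::finite) chart set \<Rightarrow>
    ('m \<Rightarrow> real \<Rightarrow> 'a) \<Rightarrow> bool" where
  "embedding_cyl A B F \<longleftrightarrow>
     smooth_cyl A B F \<and>
     (\<forall>c\<in>A. \<forall>d\<in>B. \<forall>x t. x \<in> fst c \<and> 0 < t \<and> F x t \<in> fst d \<longrightarrow>
        inj (frechet_derivative (cyl_rep c d F) (at (snd c x, t)))) \<and>
     (\<exists>G. homeomorphism (UNIV \<times> {0<..}) ((\<lambda>(x, t). F x t) ` (UNIV \<times> {0<..})) (\<lambda>(x, t). F x t) G)"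


section \<open>Tensors\<close>

text \<open>A tensor type \<open>\<Phi>\<close> lists the positions (up, down) of the indices. A tensor at a point is the
  family of its components in all charts around that point, subject to the transformation law; it is
  \<open>0\<close> at charts not around the point and at multi-indices of the wrong length, so that equality of
  tensors is equality in HOL.\<close>

datatype index_pos = Up | Dn

type_synonym ('m, 'n) tensor = "('m, 'n) chart \<Rightarrow> 'n list \<Rightarrow> real"
type_synonym ('m, 'n) tfield = "'m \<Rightarrow> ('m, 'n) tensor"

definition tensor_act ::
  "index_pos list \<Rightarrow> real ^ 'n ^ 'n \<Rightarrow> ('n::finite list \<Rightarrow> real) \<Rightarrow> 'n list \<Rightarrow> real" where
  "tensor_act \<Phi> A t js =
     (if length js = length \<Phi>
      then \<Sum>is | length is = length \<Phi>.
             (\<Prod>l<length \<Phi>. case \<Phi> ! l of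
                 Up \<Rightarrow> A $ (js ! l) $ (is ! l)
               | Dn \<Rightarrow> matrix_inv A $ (is ! l) $ (js ! l)) * t is
      else 0)"

definition tensor_space ::
  "('m, 'n::finite) chart set \<Rightarrow> index_pos list \<Rightarrow> 'm \<Rightarrow> ('m, 'n) tensor set" where
  "tensor_space A \<Phi> p =
     {t. (\<forall>c. \<not> (c \<in> A \<and> p \<in> fst c) \<longrightarrow> t c = (\<lambda>_. 0)) \<and>
         (\<forall>c is. length is \<noteq> length \<Phi> \<longrightarrow> t c is = 0) \<and>
         (\<forall>c\<in>A. \<forall>d\<in>A. p \<in> fst c \<and> p \<in> fst d \<longrightarrow> t d = tensor_act \<Phi> (jac c d p) (t c))}"

definition tensor_field ::
  "('m, 'n::finite) chart set \<Rightarrow> index_pos list \<Rightarrow> ('m, 'n) tfield set" where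
  "tensor_field A \<Phi> =
     {S. (\<forall>p. S p \<in> tensor_space A \<Phi> p) \<and>
         (\<forall>c\<in>A. \<forall>is. smooth_on (snd c ` fst c) (\<lambda>y. S (chart_inv c y) c is))}"

definition on_charts ::
  "('m, 'n) chart set \<Rightarrow> index_pos list \<Rightarrow> ('m, 'n) tfield \<Rightarrow> ('m, 'n) tfield" where
  "on_charts A \<Phi> F =
     (\<lambda>p c is. if c \<in> A \<and> p \<in> fst c \<and> length is = length \<Phi> then F p c is else 0)"

definition tscale :: "real \<Rightarrow> ('c \<Rightarrow> 'l \<Rightarrow> real) \<Rightarrow> 'c \<Rightarrow> 'l \<Rightarrow> real" where
  "tscale r t = (\<lambda>c is. r * t c is)"

definition fmult :: "('m \<Rightarrow> real) \<Rightarrow> ('m, 'n) tfield \<Rightarrow> ('m, 'n) tfield" where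
  "fmult f S = (\<lambda>p. tscale (f p) (S p))"

text \<open>The natural action \<open>M\<sharp>\<close> of an endomorphism \<open>M\<^sup>i\<^sub>e = M $ i $ e\<close>.\<close>

definition sharp ::
  "index_pos list \<Rightarrow> real ^ 'n ^ 'n \<Rightarrow> ('n::finite list \<Rightarrow> real) \<Rightarrow> 'n list \<Rightarrow> real" where
  "sharp \<Phi> M t is =
     (\<Sum>l<length \<Phi>. case \<Phi> ! l of
         Up \<Rightarrow> (\<Sum>e\<in>UNIV. M $ (is ! l) $ e * t (is[l := e]))
       | Dn \<Rightarrow> - (\<Sum>e\<in>UNIV. M $ e $ (is ! l) * t (is[l := e])))"


section \<open>Pseudo-Riemannian geometry\<close>

text \<open>The definition forces \<open>p\<close> and \<open>q\<close> to add up to the dimension.\<close>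

definition has_signature :: "real ^ 'n ^ 'n \<Rightarrow> nat \<Rightarrow> nat \<Rightarrow> bool" where
  "has_signature G p q \<longleftrightarrow>
     transpose G = G \<and>
     (\<exists>V W. subspace V \<and> subspace W \<and> dim V = p \<and> dim W = q \<and>
            (\<forall>x. \<exists>v\<in>V. \<exists>w\<in>W. x = v + w) \<and>
            (\<forall>v\<in>V - {0}. v \<bullet> (G *v v) > 0) \<and> (\<forall>w\<in>W - {0}. w \<bullet> (G *v w) < 0))"

definition gmat :: "('m, 'n::finite) tfield \<Rightarrow> 'm \<Rightarrow> ('m, 'n) chart \<Rightarrow> real ^ 'n ^ 'n" where
  "gmat g p c = (\<chi> a b. g p c [a, b])"

definition ginv :: "('m, 'n::finite) tfield \<Rightarrow> 'm \<Rightarrow> ('m, 'n) chart \<Rightarrow> 'n \<Rightarrow> 'n \<Rightarrow> real" where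
  "ginv g p c a b = matrix_inv (gmat g p c) $ a $ b"

definition pseudo_metric ::
  "('m, 'n::finite) chart set \<Rightarrow> nat \<Rightarrow> nat \<Rightarrow> ('m, 'n) tfield \<Rightarrow> bool" where
  "pseudo_metric A p q g \<longleftrightarrow>
     g \<in> tensor_field A [Dn, Dn] \<and> (\<forall>c\<in>A. \<forall>x\<in>fst c. has_signature (gmat g x c) p q)"

text \<open>\<open>christoffel g p c a b d\<close> is \<open>\<Gamma>\<^sup>a\<^sub>b\<^sub>d\<close>.\<close>

definition christoffel ::
  "('m, 'n::finite) tfield \<Rightarrow> 'm \<Rightarrow> ('m, 'n) chart \<Rightarrow> 'n \<Rightarrow> 'n \<Rightarrow> 'n \<Rightarrow> real" where
  "christoffel g p c a b d =
     (\<Sum>e\<in>UNIV. ginv g p c a e *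
        (pd c b (\<lambda>x. g x c [e, d]) p + pd c d (\<lambda>x. g x c [e, b]) p - pd c e (\<lambda>x. g x c [b, d]) p)) / 2"

text \<open>The Levi-Civita connection on tensors of type \<open>\<Phi>\<close>; the index of differentiation comes first.\<close>

definition cov_deriv ::
  "('m, 'n::finite) chart set \<Rightarrow> ('m, 'n) tfield \<Rightarrow> index_pos list \<Rightarrow> ('m, 'n) tfield \<Rightarrow>
    ('m, 'n) tfield" where
  "cov_deriv A g \<Phi> S = on_charts A (Dn # \<Phi>)
     (\<lambda>p c is. pd c (hd is) (\<lambda>x. S x c (tl is)) p +
               sharp \<Phi> (\<chi> i j. christoffel g p c i (hd is) j) (S p c) (tl is))"

definition cov_along ::
  "('m, 'n::finite) chart set \<Rightarrow> ('m, 'n) tfield \<Rightarrow> index_pos list \<Rightarrow> ('m, 'n) tfield \<Rightarrow>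
    ('m, 'n) tfield \<Rightarrow> ('m, 'n) tfield" where
  "cov_along A g \<Phi> X S =
     on_charts A \<Phi> (\<lambda>p c is. \<Sum>a\<in>UNIV. X p c [a] * cov_deriv A g \<Phi> S p c (a # is))"

definition laplacian ::
  "('m, 'n::finite) chart set \<Rightarrow> ('m, 'n) tfield \<Rightarrow> index_pos list \<Rightarrow> ('m, 'n) tfield \<Rightarrow>
    ('m, 'n) tfield" where
  "laplacian A g \<Phi> S = on_charts A \<Phi>
     (\<lambda>p c is. \<Sum>a\<in>UNIV. \<Sum>b\<in>UNIV.
        ginv g p c a b * cov_deriv A g (Dn # \<Phi>) (cov_deriv A g \<Phi> S) p c (a # b # is))"

text \<open>\<open>riemann g p c a b e d\<close> is \<open>R\<^sub>a\<^sub>b\<^sup>e\<^sub>d\<close>, where \<open>[\<nabla>\<^sub>a, \<nabla>\<^sub>b] V\<^sup>e = R\<^sub>a\<^sub>b\<^sup>e\<^sub>d V\<^sup>d\<close>.\<close>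

definition riemann ::
  "('m, 'n::finite) tfield \<Rightarrow> 'm \<Rightarrow> ('m, 'n) chart \<Rightarrow> 'n \<Rightarrow> 'n \<Rightarrow> 'n \<Rightarrow> 'n \<Rightarrow> real" where
  "riemann g p c a b e d =
     pd c a (\<lambda>x. christoffel g x c e b d) p - pd c b (\<lambda>x. christoffel g x c e a d) p +
     (\<Sum>f\<in>UNIV. christoffel g p c e a f * christoffel g p c f b d -
                 christoffel g p c e b f * christoffel g p c f a d)"

definition ricci ::
  "('m, 'n::finite) tfield \<Rightarrow> 'm \<Rightarrow> ('m, 'n) chart \<Rightarrow> 'n \<Rightarrow> 'n \<Rightarrow> real" where
  "ricci g p c b d = (\<Sum>a\<in>UNIV. riemann g p c a b a d)"

definition flat_on ::
  "('m, 'n::finite) chart set \<Rightarrow> ('m, 'n) tfield \<Rightarrow> 'm set \<Rightarrow> bool" where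
  "flat_on A g U \<longleftrightarrow> (\<forall>p\<in>U. \<forall>c\<in>A. p \<in> fst c \<longrightarrow> (\<forall>a b e d. riemann g p c a b e d = 0))"

text \<open>\<open>matrix_unit a b\<close> is the endomorphism \<open>V \<mapsto> V\<^sup>b \<partial>\<^sub>a\<close>. The curvature, with indices
  \<open>R\<^sup>a\<^sub>b\<^sup>e\<^sub>d\<close>, is the section \<open>\<Sum> R\<^sup>a\<^sub>b\<^sup>e\<^sub>d (matrix_unit a b \<otimes> matrix_unit e d)\<close> of \<open>End \<otimes> End\<close>; it
  lies in the tensor square of the skew endomorphisms, and \<open>M \<otimes> N\<close> acts by \<open>T \<mapsto> M\<sharp>(N\<sharp>T)\<close>.\<close>

definition matrix_unit :: "'n \<Rightarrow> 'n \<Rightarrow> real ^ 'n ^ 'n" where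
  "matrix_unit a b = (\<chi> i j. if i = a \<and> j = b then 1 else 0)"

definition curv_sharp_sharp ::
  "('m, 'n::finite) chart set \<Rightarrow> ('m, 'n) tfield \<Rightarrow> index_pos list \<Rightarrow> ('m, 'n) tfield \<Rightarrow>
    ('m, 'n) tfield" where
  "curv_sharp_sharp A g \<Phi> S = on_charts A \<Phi>
     (\<lambda>p c is. \<Sum>a\<in>UNIV. \<Sum>b\<in>UNIV. \<Sum>e\<in>UNIV. \<Sum>d\<in>UNIV.
        (\<Sum>f\<in>UNIV. ginv g p c a f * riemann g p c f b e d) *
        sharp \<Phi> (matrix_unit a b) (sharp \<Phi> (matrix_unit e d) (S p c)) is)"

definition laplacian_alpha ::
  "('m, 'n::finite) chart set \<Rightarrow> ('m, 'n) tfield \<Rightarrow> index_pos list \<Rightarrow> real \<Rightarrow> ('m, 'n) tfield \<Rightarrow>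
    ('m, 'n) tfield" where
  "laplacian_alpha A g \<Phi> \<alpha> S =
     (\<lambda>p c is. laplacian A g \<Phi> S p c is + \<alpha> * curv_sharp_sharp A g \<Phi> S p c is)"

definition lie_deriv2 ::
  "('m, 'n::finite) tfield \<Rightarrow> ('m, 'n) tfield \<Rightarrow> 'm \<Rightarrow> ('m, 'n) chart \<Rightarrow> 'n \<Rightarrow> 'n \<Rightarrow> real" where
  "lie_deriv2 X g p c a b =
     (\<Sum>e\<in>UNIV. X p c [e] * pd c e (\<lambda>x. g x c [a, b]) p +
                 pd c a (\<lambda>x. X x c [e]) p * g p c [e, b] +
                 pd c b (\<lambda>x. X x c [e]) p * g p c [a, e])"

text \<open>\<open>g(X, X)\<close>, computed in an arbitrary chart of the atlas around the point.\<close>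

definition norm_sq ::
  "('m, 'n::finite) chart set \<Rightarrow> ('m, 'n) tfield \<Rightarrow> ('m, 'n) tfield \<Rightarrow> 'm \<Rightarrow> real" where
  "norm_sq A g X p =
     (let c = (SOME c. c \<in> A \<and> p \<in> fst c)
      in \<Sum>a\<in>UNIV. \<Sum>b\<in>UNIV. g p c [a, b] * X p c [a] * X p c [b])"


section \<open>Conformal structures and ambient metrics\<close>

text \<open>The conformal class \<open>C\<close> and the ray bundle \<open>\<Q>\<close>, whose points are pairs \<open>(x, g\<^sub>x)\<close>.\<close>

locale conformal_manifold =
  fixes A :: "('m::{t2_space, second_countable_topology}, 'n::finite) chart set"
    and C :: "('m, 'n) tfield set"
    and p q :: nat
  assumes oriented: "oriented_atlas A"
    and nonempty: "C \<noteq> {}"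
    and metric: "g \<in> C \<Longrightarrow> pseudo_metric A p q g"
    and conformal_class: "g \<in> C \<Longrightarrow>
      C = {fmult (\<lambda>x. (\<omega> x)\<^sup>2) g | \<omega>. smooth_fun A \<omega> \<and> (\<forall>x. 0 < \<omega> x)}"

definition ray_bundle :: "('m, 'n) tfield set \<Rightarrow> ('m \<times> ('m, 'n) tensor) set" where
  "ray_bundle C = {(x, g x) | x g. g \<in> C}"

definition conformally_flat ::
  "('m::topological_space, 'n::finite) chart set \<Rightarrow> ('m, 'n) tfield set \<Rightarrow> bool" where
  "conformally_flat A C \<longleftrightarrow> (\<forall>x. \<exists>U g. open U \<and> x \<in> U \<and> g \<in> C \<and> flat_on A g U)"

text \<open>A metric \<open>g\<close> in the class trivialises the ray bundle by \<open>(x, t) \<mapsto> (x, t\<^sup>2 g\<^sub>x)\<close>, and this is how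
  its smooth structure is accessed. \<open>ray_map i g\<close> is \<open>i\<close> in this trivialisation.\<close>

definition ray_map ::
  "('m \<times> ('m, 'n) tensor \<Rightarrow> 'a) \<Rightarrow> ('m, 'n) tfield \<Rightarrow> 'm \<Rightarrow> real \<Rightarrow> 'a" where
  "ray_map i g x t = i (x, tscale (t\<^sup>2) (g x))"

locale ambient_manifold = conformal_manifold A C p q
  for A :: "('m::{t2_space, second_countable_topology}, 'n::finite) chart set"
    and C :: "('m, 'n) tfield set" and p q :: nat +
  fixes B :: "('a::{t2_space, second_countable_topology}, 'k::finite) chart set"
    and \<rho> :: "real \<Rightarrow> 'a \<Rightarrow> 'a"
    and i :: "'m \<times> ('m, 'n) tensor \<Rightarrow> 'a"
  assumes dimension: "CARD('k) = CARD('n) + 2"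
    and atlas: "smooth_atlas B"
    and action_one: "\<rho> 1 u = u"
    and action_mult: "0 < s \<Longrightarrow> 0 < t \<Longrightarrow> \<rho> (s * t) u = \<rho> s (\<rho> t u)"
    and action_smooth: "smooth_cyl B B (\<lambda>u s. \<rho> s u)"
    and action_free: "0 < s \<Longrightarrow> \<rho> s u = u \<Longrightarrow> s = 1"
    and embedding: "g \<in> C \<Longrightarrow> embedding_cyl A B (ray_map i g)"
    and equivariant: "(x, \<gamma>) \<in> ray_bundle C \<Longrightarrow> 0 < s \<Longrightarrow> i (x, tscale (s\<^sup>2) \<gamma>) = \<rho> s (i (x, \<gamma>))"

definition generator ::
  "('a, 'k::finite) chart set \<Rightarrow> (real \<Rightarrow> 'a \<Rightarrow> 'a) \<Rightarrow> ('a, 'k) tfield" where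
  "generator B \<rho> = on_charts B [Up]
     (\<lambda>u c is. vector_derivative (\<lambda>t. snd c (\<rho> (exp t) u)) (at 0) $ hd is)"

text \<open>\<open>Ric(h) = O(Q\<^sup>k)\<close> along \<open>Z\<close>: near each point of \<open>Z\<close>, \<open>Ric(h)\<close> is \<open>Q\<^sup>k\<close> times a smooth tensor.\<close>

definition ricci_bigO ::
  "('a::topological_space, 'k::finite) chart set \<Rightarrow> ('a, 'k) tfield \<Rightarrow> ('a \<Rightarrow> real) \<Rightarrow> 'a set \<Rightarrow>
    nat \<Rightarrow> bool" where
  "ricci_bigO B h Q Z k \<longleftrightarrow>
     (\<forall>c\<in>B. \<forall>u\<in>Z \<inter> fst c. \<exists>U r. open U \<and> u \<in> U \<and> U \<subseteq> fst c \<and>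
        (\<forall>a b. smooth_on (snd c ` U) (\<lambda>y. r a b (chart_inv c y))) \<and>
        (\<forall>v\<in>U. \<forall>a b. ricci h v c a b = Q v ^ k * r a b v))"

definition defining_function ::
  "('a, 'k::finite) chart set \<Rightarrow> ('a \<Rightarrow> real) \<Rightarrow> 'a set \<Rightarrow> bool" where
  "defining_function B Q Z \<longleftrightarrow>
     smooth_fun B Q \<and> {u. Q u = 0} = Z \<and>
     (\<forall>u\<in>Z. \<forall>c\<in>B. u \<in> fst c \<longrightarrow> (\<exists>a. pd c a Q u \<noteq> 0))"

text \<open>In \<open>restriction\<close>, a tangent vector of the ray bundle at \<open>(x, g\<^sub>x)\<close> has coordinates
  \<open>(\<xi>, \<tau>)\<close> in the trivialisation by \<open>g\<close> (at \<open>t = 1\<close>), and its image under \<open>\<pi>\<^sub>*\<close> is \<open>\<xi>\<close>.\<close>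

locale ambient_metric = ambient_manifold A C p q B \<rho> i
  for A :: "('m::{t2_space, second_countable_topology}, 'n::finite) chart set"
    and C :: "('m, 'n) tfield set" and p q :: nat
    and B :: "('a::{t2_space, second_countable_topology}, 'k::finite) chart set"
    and \<rho> :: "real \<Rightarrow> 'a \<Rightarrow> 'a"
    and i :: "'m \<times> ('m, 'n) tensor \<Rightarrow> 'a" +
  fixes h :: "('a, 'k) tfield"
  assumes signature: "pseudo_metric B (p + 1) (q + 1) h"
    and homogeneous: "c \<in> B \<Longrightarrow> u \<in> fst c \<Longrightarrow>
      lie_deriv2 (generator B \<rho>) h u c a b = 2 * h u c [a, b]"
    and restriction: "g \<in> C \<Longrightarrow> c\<^sub>0 \<in> A \<Longrightarrow> x \<in> fst c\<^sub>0 \<Longrightarrow> d \<in> B \<Longrightarrow> i (x, g x) \<in> fst d \<Longrightarrow>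
      D = frechet_derivative (cyl_rep c\<^sub>0 d (ray_map i g)) (at (snd c\<^sub>0 x, 1)) \<Longrightarrow>
      D (\<xi>, \<sigma>) \<bullet> (gmat h (i (x, g x)) d *v D (\<eta>, \<tau>)) = \<xi> \<bullet> (gmat g x c\<^sub>0 *v \<eta>)"
    and ricci_even: "even CARD('n) \<Longrightarrow>
      ricci_bigO B h (norm_sq B h (generator B \<rho>)) (i ` ray_bundle C) (CARD('n) div 2 - 1)"
    and ricci_odd: "odd CARD('n) \<Longrightarrow>
      ricci_bigO B h (norm_sq B h (generator B \<rho>)) (i ` ray_bundle C) k"
    and euler: "c \<in> B \<Longrightarrow> u \<in> fst c \<Longrightarrow>
      (\<Sum>a\<in>UNIV. h u c [a, b] * generator B \<rho> u c [a]) =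
      pd c b (norm_sq B h (generator B \<rho>)) u / 2"
    and defining: "defining_function B (norm_sq B h (generator B \<rho>)) (i ` ray_bundle C)"
    and flat: "conformally_flat A C \<Longrightarrow> flat_on B h UNIV"


section \<open>Tensor bundles, homogeneous sections and tractors\<close>

definition lincomb ::
  "real \<Rightarrow> ('u \<Rightarrow> 'c \<Rightarrow> 'l \<Rightarrow> real) \<Rightarrow> real \<Rightarrow> ('u \<Rightarrow> 'c \<Rightarrow> 'l \<Rightarrow> real) \<Rightarrow> 'u \<Rightarrow> 'c \<Rightarrow> 'l \<Rightarrow> real" where
  "lincomb a S b T = (\<lambda>u c is. a * S u c is + b * T u c is)"

text \<open>A tensor bundle is a subbundle \<open>V\<close> of some full mixed tensor bundle (possibly all of it) that
  is preserved by all linear isometries between tangent spaces: that is, the bundle associated to an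
  \<open>O(p+1,q+1)\<close>-invariant subspace of tensors, such as forms or trace-free symmetric tensors.
  In the charts \<open>c\<close>, \<open>d\<close> the matrix \<open>L\<close> represents an isometry from the tangent space at \<open>u\<close> to that
  at \<open>v\<close>.\<close>

definition tensor_bundle ::
  "('a, 'k::finite) chart set \<Rightarrow> ('a, 'k) tfield \<Rightarrow> index_pos list \<Rightarrow> ('a \<Rightarrow> ('a, 'k) tensor set) \<Rightarrow>
    bool" where
  "tensor_bundle B h \<Phi> V \<longleftrightarrow>
     (\<forall>u. V u \<subseteq> tensor_space B \<Phi> u \<and> (\<lambda>_ _. 0) \<in> V u \<and>
          (\<forall>s\<in>V u. \<forall>t\<in>V u. \<forall>a b. (\<lambda>c is. a * s c is + b * t c is) \<in> V u)) \<and>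
     (\<forall>u v. \<forall>c\<in>B. \<forall>d\<in>B. \<forall>L. u \<in> fst c \<longrightarrow> v \<in> fst d \<longrightarrow>
        transpose L ** gmat h v d ** L = gmat h u c \<longrightarrow>
        (\<forall>s\<in>V u. \<forall>t\<in>tensor_space B \<Phi> v. t d = tensor_act \<Phi> L (s c) \<longrightarrow> t \<in> V v))"

definition sections ::
  "('a, 'k::finite) chart set \<Rightarrow> index_pos list \<Rightarrow> ('a \<Rightarrow> ('a, 'k) tensor set) \<Rightarrow> ('a, 'k) tfield set"
  where
  "sections B \<Phi> V = {S \<in> tensor_field B \<Phi>. \<forall>u. S u \<in> V u}"

text \<open>The space of ambient sections of homogeneity \<open>w\<close>: \<open>\<nabla>\<^sub>X S = w S\<close>.\<close>

definition hom_sections ::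
  "('a, 'k::finite) chart set \<Rightarrow> ('a, 'k) tfield \<Rightarrow> (real \<Rightarrow> 'a \<Rightarrow> 'a) \<Rightarrow> index_pos list \<Rightarrow>
    ('a \<Rightarrow> ('a, 'k) tensor set) \<Rightarrow> real \<Rightarrow> ('a, 'k) tfield set" where
  "hom_sections B h \<rho> \<Phi> V w =
     {S \<in> sections B \<Phi> V. cov_along B h \<Phi> (generator B \<rho>) S = (\<lambda>u. tscale w (S u))}"

text \<open>Restriction of an ambient field to the ray bundle, viewed as a section over \<open>M\<close>: to \<open>x\<close> it
  assigns a homogeneous section over the ray \<open>\<Q>\<^sub>x\<close>, which is an element of the fibre over \<open>x\<close> of the
  weighted tractor bundle (it is determined by its value at any one point of \<open>\<Q>\<^sub>x\<close>).\<close>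

type_synonym ('m, 'n, 'a, 'k) tractor_field = "'m \<Rightarrow> ('m, 'n) tensor \<Rightarrow> ('a, 'k) tensor"

definition to_tractor ::
  "('m, 'n) tfield set \<Rightarrow> ('m \<times> ('m, 'n) tensor \<Rightarrow> 'a) \<Rightarrow> ('a, 'k) tfield \<Rightarrow>
    ('m, 'n, 'a, 'k) tractor_field" where
  "to_tractor C i S = (\<lambda>x \<gamma>. if (x, \<gamma>) \<in> ray_bundle C then S (i (x, \<gamma>)) else (\<lambda>_ _. 0))"

definition tractor_sections ::
  "('m, 'n) tfield set \<Rightarrow> ('m \<times> ('m, 'n) tensor \<Rightarrow> 'a) \<Rightarrow> ('a, 'k::finite) chart set \<Rightarrow>
    ('a, 'k) tfield \<Rightarrow> (real \<Rightarrow> 'a \<Rightarrow> 'a) \<Rightarrow> index_pos list \<Rightarrow> ('a \<Rightarrow> ('a, 'k) tensor set) \<Rightarrow> real \<Rightarrow>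
    ('m, 'n, 'a, 'k) tractor_field set" where
  "tractor_sections C i B h \<rho> \<Phi> V w = to_tractor C i ` hom_sections B h \<rho> \<Phi> V w"

definition tractor_lincomb ::
  "real \<Rightarrow> ('m, 'n, 'a, 'k) tractor_field \<Rightarrow> real \<Rightarrow> ('m, 'n, 'a, 'k) tractor_field \<Rightarrow>
    ('m, 'n, 'a, 'k) tractor_field" where
  "tractor_lincomb a S b T = (\<lambda>x. lincomb a (S x) b (T x))"

definition linear_operator ::
  "(real \<Rightarrow> 's \<Rightarrow> real \<Rightarrow> 's \<Rightarrow> 's) \<Rightarrow> 's set \<Rightarrow> ('s \<Rightarrow> 's) \<Rightarrow> bool" where
  "linear_operator comb D P \<longleftrightarrow> (\<forall>S\<in>D. \<forall>T\<in>D. \<forall>a b. P (comb a S b T) = comb a (P S) b (P T))"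

text \<open>Tangentiality of an operator \<open>P\<close> with domain space \<open>D\<close>: \<open>PQ = QP'\<close>. Both sides are
  defined on the sections \<open>S\<close> in the space \<open>\<Gamma>\<close> of all sections with \<open>Q S\<close> in \<open>D\<close>, and \<open>P'\<close> must
  again yield sections, smooth also across the zero set of \<open>Q\<close>.\<close>

definition tangential ::
  "('a \<Rightarrow> real) \<Rightarrow> ('a, 'k) tfield set \<Rightarrow> ('a, 'k) tfield set \<Rightarrow>
    (('a, 'k) tfield \<Rightarrow> ('a, 'k) tfield) \<Rightarrow> bool" where
  "tangential Q \<Gamma> D P \<longleftrightarrow>
     (\<exists>P'. linear_operator lincomb {S \<in> \<Gamma>. fmult Q S \<in> D} P' \<and>
           (\<forall>S\<in>\<Gamma>. fmult Q S \<in> D \<longrightarrow> P' S \<in> \<Gamma> \<and> P (fmult Q S) = fmult Q (P' S)))"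

end

theory Submission
  imports Defs
begin

text \<open>
  Write \<open>Q = h(X, X)\<close>. Homogeneity of \<open>h\<close> and \<open>2 h(X, \<cdot>) = dQ\<close> give \<open>\<nabla>X = id\<close>, whence \<open>X\<close> annihilates the
  curvature and \<open>\<nabla>\<^sub>X R = - 2 R\<close> by the Bianchi identities. Consequently \<open>[\<nabla>\<^sub>X, \<Delta>\<^sub>\<alpha>] = - 2 \<Delta>\<^sub>\<alpha>\<close>, which is the
  statement about weights, and \<open>[\<Delta>\<^sub>\<alpha>, Q] = 4 \<nabla>\<^sub>X + 2 (n + 2)\<close>. If \<open>Q S\<close> has weight \<open>m - n/2\<close> then \<open>S\<close> has
  weight \<open>m - n/2 - 2\<close>, and the \<open>m\<close> commutators in \<open>[\<Delta>\<^sub>\<alpha>\<^sup>m, Q] S\<close> cancel, so that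
  \<open>\<Delta>\<^sub>\<alpha>\<^sup>m (Q S) = Q \<Delta>\<^sub>\<alpha>\<^sup>m S\<close>: the operator \<open>P'\<close> is \<open>\<Delta>\<^sub>\<alpha>\<^sup>m\<close> itself. A field vanishing on the zero set of
  \<open>Q\<close> is \<open>Q\<close> times a smooth field, so the operator descends to tractors. That \<open>\<Delta>\<^sub>\<alpha>\<close> preserves an
  isometry-invariant subbundle holds because along any curve there is a differentiable family of
  isometries whose derivative matches the Levi-Civita connection.
\<close>

section \<open>Smooth functions\<close>

text \<open>The commutators cancel as an arithmetic series. For S of weight v the j-th one meets a
  field of weight v - 2 j and contributes 4 (v - 2 j) + 2 (n + 2); the sum over j < m is m (4 v + 2
  (n + 2) - 4 (m - 1)), which is zero exactly for v = m - n/2 - 2. That S has this weight is clear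
  where Q is nonzero; on the zero set it follows by continuity, since dQ does not vanish there.
  Tensors are families of components in charts, so identities are computed in one chart. That the
  operator is the same in all charts rests on the uniqueness of the Levi-Civita connection. Neither
  X nor V is given with any smoothness: X is smooth as half the gradient of Q, and V is only a
  family of subspaces stable under isometries, which is why isometries between different tangent
  spaces have to be differentiated in place of local frames. Division by Q enters because two
  homogeneous sections with the same restriction are not given as differing by a multiple of Q. The
  quotient is used only as a tensor field, for which the commutation with Q already holds.\<close>

lemma Ck_on_cong:
  assumes "open S" "\<And>x. x \<in> S \<Longrightarrow> f x = g x"
  shows "Ck_on k S f \<longleftrightarrow> Ck_on k S g"
proof -
  have "Ck_on k S f \<Longrightarrow> (\<And>x. x \<in> S \<Longrightarrow> f x = g x) \<Longrightarrow> Ck_on k S g" for f g :: "'a \<Rightarrow> 'b"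
  proof (induction k arbitrary: f g)
    case 0
    then show ?case by (simp cong: continuous_on_cong)
  next
    case (Suc k)
    have d: "(g has_derivative frechet_derivative f (at x)) (at x)" if "x \<in> S" for x
    proof (rule has_derivative_transform_within_open[of f _ x _ S])
      show "(f has_derivative frechet_derivative f (at x)) (at x)"
        using Suc.prems(1) that by (simp add: frechet_derivative_works)
    qed (use Suc.prems(2) assms(1) that in auto)
    then have e: "frechet_derivative f (at x) v = frechet_derivative g (at x) v" if "x \<in> S" for x v
      using frechet_derivative_at that by metis
    have "Ck_on k S (\<lambda>x. frechet_derivative g (at x) v)" for v
    proof (rule Suc.IH)
      show "Ck_on k S (\<lambda>x. frechet_derivative f (at x) v)" using Suc.prems(1) by simp
    qed (rule e)
    then show ?case using d by (auto simp: differentiable_def)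
  qed
  from this[of f g] this[of g f] show ?thesis using assms(2) by auto
qed

text \<open>\<open>frechet_derivative\<close> is a choice operator, hence awkward to compute with.
  Here any explicit derivative \<open>f'\<close> may be supplied, and the inductions on
  \<open>k\<close> below run on the usual differentiation formulas.\<close>

lemma Ck_on_SucI:
  assumes "open S" "\<And>x. x \<in> S \<Longrightarrow> (f has_derivative f' x) (at x)" "\<And>v. Ck_on k S (\<lambda>x. f' x v)"
  shows "Ck_on (Suc k) S f"
proof -
  have e: "frechet_derivative f (at x) = f' x" if "x \<in> S" for x
    using assms(2)[OF that] frechet_derivative_at by metis
  have "Ck_on k S (\<lambda>x. frechet_derivative f (at x) v)" for v
    using assms(3)[of v] by (subst Ck_on_cong[OF assms(1), of _ "\<lambda>x. f' x v"]) (auto simp: e)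
  then show ?thesis using assms(2) by (auto simp: differentiable_def)
qed

lemma Ck_on_has_derivative:
  "Ck_on (Suc k) S f \<Longrightarrow> x \<in> S \<Longrightarrow> (f has_derivative frechet_derivative f (at x)) (at x)"
  by (simp add: frechet_derivative_works)

lemma Ck_on_deriv: "Ck_on (Suc k) S f \<Longrightarrow> Ck_on k S (\<lambda>x. frechet_derivative f (at x) v)"
  by simp

lemma Ck_on_SucD: "Ck_on (Suc k) S f \<Longrightarrow> Ck_on k S f"
proof (induction k arbitrary: f)
  case 0
  then show ?case
    by (auto intro!: continuous_at_imp_continuous_on differentiable_imp_continuous_within)
qed auto

declare Ck_on.simps(2) [simp del]

lemma Ck_on_subset: "Ck_on k S f \<Longrightarrow> T \<subseteq> S \<Longrightarrow> Ck_on k T f"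
  by (induction k arbitrary: f) (auto intro: continuous_on_subset simp: Ck_on.simps(2))

lemma Ck_on_const: "Ck_on k S (\<lambda>x. c)"
  by (induction k arbitrary: c) (auto simp: Ck_on.simps(2))

lemma Ck_on_bounded_linear:
  assumes "open S" "bounded_linear L" "Ck_on k S f"
  shows "Ck_on k S (\<lambda>x. L (f x))"
  using assms(3)
proof (induction k arbitrary: f)
  case 0
  then show ?case using assms(2) by (simp add: bounded_linear.continuous_on)
next
  case (Suc k)
  show ?case
  proof (rule Ck_on_SucI[OF assms(1)])
    show "((\<lambda>x. L (f x)) has_derivative (\<lambda>v. L (frechet_derivative f (at x) v))) (at x)" if "x \<in> S" for x
      using Ck_on_has_derivative[OF Suc.prems that] assms(2) bounded_linear.has_derivative by blast
  qed (intro Suc.IH Ck_on_deriv Suc.prems)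
qed

lemma Ck_on_add:
  assumes "open S" "Ck_on k S f" "Ck_on k S g"
  shows "Ck_on k S (\<lambda>x. f x + g x)"
  using assms(2,3)
proof (induction k arbitrary: f g)
  case 0
  then show ?case by (auto intro: continuous_intros)
next
  case (Suc k)
  show ?case
  proof (rule Ck_on_SucI[OF assms(1) has_derivative_add])
    show "Ck_on k S (\<lambda>x. frechet_derivative f (at x) v + frechet_derivative g (at x) v)" for v
      by (intro Suc.IH Ck_on_deriv Suc.prems)
  qed (erule Ck_on_has_derivative[OF Suc.prems(1)] Ck_on_has_derivative[OF Suc.prems(2)])+
qed

lemma Ck_on_mult:
  fixes f g :: "_ \<Rightarrow> real"
  assumes "open S" "Ck_on k S f" "Ck_on k S g"
  shows "Ck_on k S (\<lambda>x. f x * g x)"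
  using assms(2,3)
proof (induction k arbitrary: f g)
  case 0
  then show ?case by (auto intro: continuous_intros)
next
  case (Suc k)
  show ?case
  proof (rule Ck_on_SucI[OF assms(1) has_derivative_mult])
    show "Ck_on k S (\<lambda>x. f x * frechet_derivative g (at x) v + frechet_derivative f (at x) v * g x)" for v
      by (intro Ck_on_add assms(1) Suc.IH Ck_on_deriv Suc.prems Ck_on_SucD[OF Suc.prems(1)] Ck_on_SucD[OF Suc.prems(2)])
  qed (erule Ck_on_has_derivative[OF Suc.prems(1)] Ck_on_has_derivative[OF Suc.prems(2)])+
qed

lemma Ck_on_inverse:
  fixes f :: "_ \<Rightarrow> real"
  assumes "open S" "Ck_on k S f" "\<And>x. x \<in> S \<Longrightarrow> f x \<noteq> 0"
  shows "Ck_on k S (\<lambda>x. inverse (f x))"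
  using assms(2)
proof (induction k)
  case 0
  then show ?case using assms(3) by (auto intro: continuous_intros)
next
  case (Suc k)
  have i: "Ck_on k S (\<lambda>x. inverse (f x))" using Suc by (simp add: Ck_on_SucD)
  show ?case
  proof (rule Ck_on_SucI[OF assms(1)])
    show "((\<lambda>x. inverse (f x)) has_derivative
        (\<lambda>v. - (inverse (f x) * frechet_derivative f (at x) v * inverse (f x)))) (at x)" if "x \<in> S" for x
      using Ck_on_has_derivative[OF Suc.prems that] assms(3)[OF that] by (intro Deriv.has_derivative_inverse)
    show "Ck_on k S (\<lambda>x. - (inverse (f x) * frechet_derivative f (at x) v * inverse (f x)))" for v
      by (rule Ck_on_bounded_linear[OF assms(1) bounded_linear_minus[OF bounded_linear_ident]])
        (intro Ck_on_mult assms(1) i Ck_on_deriv Suc.prems)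
  qed
qed

lemma Ck_on_sum:
  assumes "open S" "\<And>i. i \<in> I \<Longrightarrow> Ck_on k S (f i)"
  shows "Ck_on k S (\<lambda>x. \<Sum>i\<in>I. f i x)"
  using assms(2)
proof (induction I rule: infinite_finite_induct)
  case (insert i I)
  then have "Ck_on k S (\<lambda>x. f i x + (\<Sum>i\<in>I. f i x))" by (intro Ck_on_add assms(1)) auto
  then show ?case using insert by simp
qed (simp_all add: Ck_on_const)

lemma Ck_on_nth:
  fixes f :: "_ \<Rightarrow> real ^ 'n"
  shows "open S \<Longrightarrow> Ck_on k S f \<Longrightarrow> Ck_on k S (\<lambda>x. f x $ i)"
  by (rule Ck_on_bounded_linear[OF _ bounded_linear_vec_nth])

lemma linear_vec_expand:
  fixes L :: "real ^ 'n \<Rightarrow> real"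
  assumes "linear L"
  shows "L v = (\<Sum>i\<in>UNIV. v $ i * L (axis i 1))"
proof -
  have "v = (\<Sum>i\<in>UNIV. (v $ i) *\<^sub>R axis i 1)"
    using basis_expansion[of v] by (simp add: scalar_mult_eq_scaleR)
  then have "L v = L (\<Sum>i\<in>UNIV. (v $ i) *\<^sub>R axis i 1)" by simp
  also have "\<dots> = (\<Sum>i\<in>UNIV. v $ i * L (axis i 1))"
    by (simp add: linear_sum[OF assms] linear_cmul[OF assms])
  finally show ?thesis .
qed

text \<open>Expanding the chain rule over the axis vectors turns the derivative of the composite
  into a finite sum of products, to which the closure lemmas apply. The induction varies
  \<open>f\<close>, replacing it by its partial derivatives, and keeps \<open>g\<close>
  fixed.\<close>

lemma Ck_on_compose:
  fixes f :: "real ^ 'n \<Rightarrow> real" and g :: "'a::real_normed_vector \<Rightarrow> real ^ 'n"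
  assumes "open S" "Ck_on k T f" "Ck_on k S g" "g ` S \<subseteq> T"
  shows "Ck_on k S (\<lambda>x. f (g x))"
  using assms(2,3)
proof (induction k arbitrary: f)
  case 0
  then show ?case using assms(4) by (auto intro: continuous_on_compose2)
next
  case (Suc k)
  show ?case
  proof (rule Ck_on_SucI[OF assms(1)])
    fix x assume x: "x \<in> S"
    have f: "(f has_derivative frechet_derivative f (at (g x))) (at (g x))"
      using x assms(4) by (intro Ck_on_has_derivative[OF Suc.prems(1)]) auto
    have "((\<lambda>x. f (g x)) has_derivative (\<lambda>v. frechet_derivative f (at (g x)) (frechet_derivative g (at x) v))) (at x)"
      using has_derivative_compose[OF Ck_on_has_derivative[OF Suc.prems(2) x] f] .
    then show "((\<lambda>x. f (g x)) has_derivative (\<lambda>v. \<Sum>i\<in>UNIV. frechet_derivative g (at x) v $ i *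
        frechet_derivative f (at (g x)) (axis i 1))) (at x)"
      unfolding linear_vec_expand[OF has_derivative_linear[OF f], of "frechet_derivative g (at x) _"] .
  next
    fix v
    have "Ck_on k S g" using Suc.prems(2) by (rule Ck_on_SucD)
    then show "Ck_on k S (\<lambda>x. \<Sum>i\<in>UNIV. frechet_derivative g (at x) v $ i *
        frechet_derivative f (at (g x)) (axis i 1))"
      by (intro Ck_on_sum Ck_on_mult assms(1) Ck_on_nth Ck_on_deriv[OF Suc.prems(2)]
          Suc.IH[of "\<lambda>y. frechet_derivative f (at y) (axis _ 1)"] Ck_on_deriv[OF Suc.prems(1)])
  qed
qed

lemma Ck_on_ident: "Ck_on k S (\<lambda>x. x)"
  by (cases k) (simp_all add: Ck_on_const Ck_on.simps(2))

lemma Ck_on_local: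
  assumes "\<And>x. x \<in> S \<Longrightarrow> \<exists>T. open T \<and> x \<in> T \<and> Ck_on k T f"
  shows "Ck_on k S f"
  using assms
proof (induction k arbitrary: f)
  case 0
  have "isCont f x" if x: "x \<in> S" for x
  proof -
    obtain T where "open T" "x \<in> T" "continuous_on T f" using 0[OF x] by auto
    then show ?thesis using continuous_on_eq_continuous_at by blast
  qed
  then show ?case by (simp add: continuous_at_imp_continuous_on)
next
  case (Suc k)
  have "Ck_on k S (\<lambda>x. frechet_derivative f (at x) v)" for v
  proof (rule Suc.IH)
    fix x assume "x \<in> S"
    then obtain T where "open T" "x \<in> T" "Ck_on (Suc k) T f" using Suc.prems by blast
    then show "\<exists>T. open T \<and> x \<in> T \<and> Ck_on k T (\<lambda>x. frechet_derivative f (at x) v)"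
      using Ck_on_deriv by blast
  qed
  moreover have "f differentiable (at x)" if "x \<in> S" for x
    using Suc.prems[OF that] by (auto simp: Ck_on.simps(2))
  ultimately show ?case by (auto simp: Ck_on.simps(2))
qed

lemma smooth_on_cong: "open S \<Longrightarrow> (\<And>x. x \<in> S \<Longrightarrow> f x = g x) \<Longrightarrow> smooth_on S f \<longleftrightarrow> smooth_on S g"
  using Ck_on_cong unfolding smooth_on_def by blast
lemma smooth_on_subset: "smooth_on S f \<Longrightarrow> T \<subseteq> S \<Longrightarrow> smooth_on T f"
  using Ck_on_subset unfolding smooth_on_def by blast
lemma smooth_on_const: "smooth_on S (\<lambda>x. c)"
  unfolding smooth_on_def by (simp add: Ck_on_const)
lemma smooth_on_add: "open S \<Longrightarrow> smooth_on S f \<Longrightarrow> smooth_on S g \<Longrightarrow> smooth_on S (\<lambda>x. f x + g x)"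
  unfolding smooth_on_def using Ck_on_add by blast
lemma smooth_on_mult:
  fixes f g :: "_ \<Rightarrow> real"
  shows "open S \<Longrightarrow> smooth_on S f \<Longrightarrow> smooth_on S g \<Longrightarrow> smooth_on S (\<lambda>x. f x * g x)"
  unfolding smooth_on_def using Ck_on_mult by blast
lemma smooth_on_inverse:
  fixes f :: "_ \<Rightarrow> real"
  shows "open S \<Longrightarrow> smooth_on S f \<Longrightarrow> (\<And>x. x \<in> S \<Longrightarrow> f x \<noteq> 0) \<Longrightarrow> smooth_on S (\<lambda>x. inverse (f x))"
  unfolding smooth_on_def using Ck_on_inverse by blast
lemma smooth_on_compose:
  fixes f :: "real ^ 'n \<Rightarrow> real" and g :: "'a::real_normed_vector \<Rightarrow> real ^ 'n"
  shows "open S \<Longrightarrow> smooth_on T f \<Longrightarrow> smooth_on S g \<Longrightarrow> g ` S \<subseteq> T \<Longrightarrow> smooth_on S (\<lambda>x. f (g x))"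
  unfolding smooth_on_def using Ck_on_compose by blast
lemma smooth_on_nth:
  fixes f :: "_ \<Rightarrow> real ^ 'n"
  shows "open S \<Longrightarrow> smooth_on S f \<Longrightarrow> smooth_on S (\<lambda>x. f x $ i)"
  unfolding smooth_on_def using Ck_on_nth by blast
lemma smooth_on_deriv: "smooth_on S f \<Longrightarrow> smooth_on S (\<lambda>x. frechet_derivative f (at x) v)"
  unfolding smooth_on_def using Ck_on_deriv by blast
lemma smooth_on_has_derivative:
  "smooth_on S f \<Longrightarrow> x \<in> S \<Longrightarrow> (f has_derivative frechet_derivative f (at x)) (at x)"
  unfolding smooth_on_def using Ck_on_has_derivative by blast
lemma smooth_on_continuous: "smooth_on S f \<Longrightarrow> continuous_on S f"
  unfolding smooth_on_def by (metis Ck_on.simps(1))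
lemma smooth_on_local:
  "(\<And>x. x \<in> S \<Longrightarrow> \<exists>T. open T \<and> x \<in> T \<and> smooth_on T f) \<Longrightarrow> smooth_on S f"
  unfolding smooth_on_def by (meson Ck_on_local)

section \<open>Symmetry of second derivatives\<close>

lemma second_difference:
  fixes f :: "'a::real_normed_vector \<Rightarrow> real"
  assumes S: "smooth_on S f" and t: "0 < t" and box: "\<And>a b. 0 \<le> a \<Longrightarrow> a \<le> t \<Longrightarrow> 0 \<le> b \<Longrightarrow> b \<le> t \<Longrightarrow> x + a *\<^sub>R v + b *\<^sub>R w \<in> S"
  shows "\<exists>a b. 0 \<le> a \<and> a \<le> t \<and> 0 \<le> b \<and> b \<le> t \<and>
    f (x + t *\<^sub>R v + t *\<^sub>R w) - f (x + t *\<^sub>R v) - f (x + t *\<^sub>R w) + f x =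
    t\<^sup>2 * frechet_derivative (\<lambda>y. frechet_derivative f (at y) v) (at (x + a *\<^sub>R v + b *\<^sub>R w)) w"
proof -
  have fd: "((\<lambda>a. f (x + a *\<^sub>R v + b *\<^sub>R w)) has_derivative (\<lambda>h. h * frechet_derivative f (at (x + a *\<^sub>R v + b *\<^sub>R w)) v)) (at a)"
    if "0 \<le> a" "a \<le> t" "0 \<le> b" "b \<le> t" for a b
  proof -
    have d: "(f has_derivative frechet_derivative f (at (x + a *\<^sub>R v + b *\<^sub>R w))) (at (x + a *\<^sub>R v + b *\<^sub>R w))"
      using smooth_on_has_derivative[OF S] box that by blast
    have l: "frechet_derivative f (at (x + a *\<^sub>R v + b *\<^sub>R w)) (h *\<^sub>R v) = h * frechet_derivative f (at (x + a *\<^sub>R v + b *\<^sub>R w)) v" for h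
      using has_derivative_linear[OF d] by (simp add: linear_cmul)
    have "((\<lambda>a. x + a *\<^sub>R v + b *\<^sub>R w) has_derivative (\<lambda>h. h *\<^sub>R v)) (at a)"
      by (auto intro!: derivative_eq_intros)
    from has_derivative_compose[OF this d] show ?thesis by (simp add: l)
  qed
  let ?g = "\<lambda>y. frechet_derivative f (at y) v"
  have gd: "((\<lambda>b. ?g (x + a *\<^sub>R v + b *\<^sub>R w)) has_derivative (\<lambda>h. h * frechet_derivative ?g (at (x + a *\<^sub>R v + b *\<^sub>R w)) w)) (at b)"
    if "0 \<le> a" "a \<le> t" "0 \<le> b" "b \<le> t" for a b
  proof -
    have d: "(?g has_derivative frechet_derivative ?g (at (x + a *\<^sub>R v + b *\<^sub>R w))) (at (x + a *\<^sub>R v + b *\<^sub>R w))"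
      using smooth_on_has_derivative[OF smooth_on_deriv[OF S]] box that by blast
    have l: "frechet_derivative ?g (at (x + a *\<^sub>R v + b *\<^sub>R w)) (h *\<^sub>R w) = h * frechet_derivative ?g (at (x + a *\<^sub>R v + b *\<^sub>R w)) w" for h
      using has_derivative_linear[OF d] by (simp add: linear_cmul)
    have "((\<lambda>b. x + a *\<^sub>R v + b *\<^sub>R w) has_derivative (\<lambda>h. h *\<^sub>R w)) (at b)"
      by (auto intro!: derivative_eq_intros)
    from has_derivative_compose[OF this d] show ?thesis by (simp add: l)
  qed
  \<comment> \<open>The difference in direction \<open>w\<close> as a function of the step in
    direction \<open>v\<close>; the vacuous \<open>0 *\<^sub>R w\<close> lets \<open>fd\<close>
    apply with \<open>b = 0\<close>. The mean value theorem in \<open>a\<close>, and then in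
    \<open>b\<close>, produces the two intermediate parameters.\<close>
  let ?\<phi> = "\<lambda>a. f (x + a *\<^sub>R v + t *\<^sub>R w) - f (x + a *\<^sub>R v + 0 *\<^sub>R w)"
  have "\<exists>a\<in>{0<..<t}. ?\<phi> t - ?\<phi> 0 = (\<lambda>h. h * ?g (x + a *\<^sub>R v + t *\<^sub>R w) - h * ?g (x + a *\<^sub>R v + 0 *\<^sub>R w)) (t - 0)"
  proof (rule mvt_simple[OF t])
    fix a assume "0 \<le> a" "a \<le> t"
    then show "(?\<phi> has_derivative (\<lambda>h. h * ?g (x + a *\<^sub>R v + t *\<^sub>R w) - h * ?g (x + a *\<^sub>R v + 0 *\<^sub>R w))) (at a within {0..t})"
      using t by (intro has_derivative_at_withinI[OF has_derivative_diff] fd) auto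
  qed
  then obtain a where a: "0 < a" "a < t" and
    ea: "?\<phi> t - ?\<phi> 0 = t * (?g (x + a *\<^sub>R v + t *\<^sub>R w) - ?g (x + a *\<^sub>R v + 0 *\<^sub>R w))"
    by (auto simp: algebra_simps)
  have "\<exists>b\<in>{0<..<t}. ?g (x + a *\<^sub>R v + t *\<^sub>R w) - ?g (x + a *\<^sub>R v + 0 *\<^sub>R w) =
      (\<lambda>h. h * frechet_derivative ?g (at (x + a *\<^sub>R v + b *\<^sub>R w)) w) (t - 0)"
  proof (rule mvt_simple[OF t])
    fix b assume "0 \<le> b" "b \<le> t"
    then show "((\<lambda>b. ?g (x + a *\<^sub>R v + b *\<^sub>R w)) has_derivative
        (\<lambda>h. h * frechet_derivative ?g (at (x + a *\<^sub>R v + b *\<^sub>R w)) w)) (at b within {0..t})"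
      using a by (intro has_derivative_at_withinI[OF gd]) auto
  qed
  then obtain b where "0 < b" "b < t" and
    eb: "?g (x + a *\<^sub>R v + t *\<^sub>R w) - ?g (x + a *\<^sub>R v + 0 *\<^sub>R w) = t * frechet_derivative ?g (at (x + a *\<^sub>R v + b *\<^sub>R w)) w"
    by auto
  then show ?thesis using ea a unfolding eb
    by (intro exI[of _ a] exI[of _ b]) (auto simp: power2_eq_square algebra_simps)
qed

text \<open>Schwarz: the second difference over the parallelogram spanned by t v and t w is
  symmetric in \<open>v\<close> and \<open>w\<close>, and divided by the square of t it tends to
  either mixed derivative, as these are continuous.\<close>

lemma frechet_derivative_commute:
  fixes f :: "'a::real_normed_vector \<Rightarrow> real"
  assumes "open S" "smooth_on S f" "x \<in> S"
  shows "frechet_derivative (\<lambda>y. frechet_derivative f (at y) v) (at x) w =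
         frechet_derivative (\<lambda>y. frechet_derivative f (at y) w) (at x) v"
proof -
  have lim: "((\<lambda>t. (f (x + t *\<^sub>R v + t *\<^sub>R w) - f (x + t *\<^sub>R v) - f (x + t *\<^sub>R w) + f x) / t\<^sup>2) \<longlongrightarrow>
      frechet_derivative (\<lambda>y. frechet_derivative f (at y) v) (at x) w) (at_right 0)" for v w
  proof (rule tendstoI)
    fix e :: real assume e: "0 < e"
    let ?H = "\<lambda>y. frechet_derivative (\<lambda>y. frechet_derivative f (at y) v) (at y) w"
    have "continuous_on S ?H" using assms(2) by (intro smooth_on_continuous smooth_on_deriv)
    then have "isCont ?H x" using assms continuous_on_eq_continuous_at by blast
    then obtain d1 where d1: "0 < d1" "\<And>y. dist y x < d1 \<Longrightarrow> dist (?H y) (?H x) < e"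
      using e unfolding continuous_at by (auto simp: tendsto_iff eventually_at) (metis dist_self)
    obtain d2 where d2: "0 < d2" "ball x d2 \<subseteq> S" using assms openE by blast
    \<comment> \<open>For \<open>t < d\<close> the parallelogram stays within
      \<open>min d1 d2\<close> of \<open>x\<close>; the summand 1 keeps the denominator positive
      when \<open>v\<close> and \<open>w\<close> both vanish.\<close>
    define d where "d = min d1 d2 / (norm v + norm w + 1)"
    have pos: "0 < norm v + norm w + 1" by (smt (verit) norm_ge_zero)
    have d: "0 < d" using d1 d2 pos by (simp add: d_def)
    have nb: "dist (x + a *\<^sub>R v + b *\<^sub>R w) x < min d1 d2" if "0 \<le> a" "a \<le> t" "0 \<le> b" "b \<le> t" "t < d" for a b t
    proof -
      have "dist (x + a *\<^sub>R v + b *\<^sub>R w) x \<le> a * norm v + b * norm w"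
        using that norm_triangle_ineq[of "a *\<^sub>R v" "b *\<^sub>R w"] by (simp add: dist_norm algebra_simps)
      also have "\<dots> \<le> t * norm v + t * norm w" using that by (intro add_mono mult_right_mono) auto
      also have "\<dots> \<le> t * (norm v + norm w + 1)" using that by (simp add: algebra_simps)
      also have "\<dots> < d * (norm v + norm w + 1)" using that pos by (intro mult_strict_right_mono) auto
      also have "\<dots> = min d1 d2" using pos by (simp add: d_def)
      finally show ?thesis .
    qed
    show "\<forall>\<^sub>F t in at_right 0. dist ((f (x + t *\<^sub>R v + t *\<^sub>R w) - f (x + t *\<^sub>R v) - f (x + t *\<^sub>R w) + f x) / t\<^sup>2) (?H x) < e"
      unfolding eventually_at_right[OF d]
    proof (intro exI[of _ d] conjI d allI impI)
      fix t assume t: "0 < t" "t < d"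
      have "\<exists>a b. 0 \<le> a \<and> a \<le> t \<and> 0 \<le> b \<and> b \<le> t \<and>
        f (x + t *\<^sub>R v + t *\<^sub>R w) - f (x + t *\<^sub>R v) - f (x + t *\<^sub>R w) + f x = t\<^sup>2 * ?H (x + a *\<^sub>R v + b *\<^sub>R w)"
      proof (rule second_difference[OF assms(2) t(1)])
        fix a b assume "0 \<le> a" "a \<le> t" "0 \<le> b" "b \<le> t"
        then show "x + a *\<^sub>R v + b *\<^sub>R w \<in> S" using nb[of a t b] t d2 by (auto simp: dist_commute subset_eq)
      qed
      then obtain a b where ab: "0 \<le> a" "a \<le> t" "0 \<le> b" "b \<le> t"
        "f (x + t *\<^sub>R v + t *\<^sub>R w) - f (x + t *\<^sub>R v) - f (x + t *\<^sub>R w) + f x = t\<^sup>2 * ?H (x + a *\<^sub>R v + b *\<^sub>R w)" by blast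
      have "dist (?H (x + a *\<^sub>R v + b *\<^sub>R w)) (?H x) < e"
        using nb[of a t b] ab t by (intro d1(2)) auto
      then show "dist ((f (x + t *\<^sub>R v + t *\<^sub>R w) - f (x + t *\<^sub>R v) - f (x + t *\<^sub>R w) + f x) / t\<^sup>2) (?H x) < e"
        using ab t by simp
    qed
  qed
  show ?thesis
  proof (rule tendsto_unique[OF _ lim[of v w]])
    show "((\<lambda>t. (f (x + t *\<^sub>R v + t *\<^sub>R w) - f (x + t *\<^sub>R v) - f (x + t *\<^sub>R w) + f x) / t\<^sup>2) \<longlongrightarrow>
      frechet_derivative (\<lambda>y. frechet_derivative f (at y) w) (at x) v) (at_right 0)"
      using lim[of w v] by (simp add: algebra_simps)
  qed simp
qed

section \<open>Calculus in a chart\<close>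

text \<open>Chart-smooth: only the chart \<open>c\<close> is consulted, so components of a tensor in
  \<open>c\<close>, which have no meaning in other charts, are treated like scalar
  functions.\<close>

definition csm :: "('a, 'k::finite) chart \<Rightarrow> 'a set \<Rightarrow> ('a \<Rightarrow> real) \<Rightarrow> bool" where
  "csm c U f \<longleftrightarrow> smooth_on (snd c ` U) (\<lambda>y. f (chart_inv c y))"

text \<open>\<open>U\<close> may be smaller than the domain of \<open>c\<close>: overlaps of two
  charts and open sets avoiding the zeros of Q occur as well.\<close>

locale chart_domain =
  fixes c :: "('a::topological_space, 'k::finite) chart" and U :: "'a set"
  assumes open_dom: "open (snd c ` fst c)"
    and homeo: "homeomorphism (fst c) (snd c ` fst c) (snd c) (chart_inv c)"
    and open_U: "open U" and U_sub: "U \<subseteq> fst c"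
begin

lemma chart_inv_chart [simp]: "p \<in> fst c \<Longrightarrow> chart_inv c (snd c p) = p"
  using homeo by (simp add: homeomorphism_def)

lemma chart_inv_U [simp]: "p \<in> U \<Longrightarrow> chart_inv c (snd c p) = p"
  using U_sub by auto

lemma open_image: "open (snd c ` U)"
proof -
  have "snd c ` U = snd c ` fst c \<inter> chart_inv c -` U"
    using U_sub by auto
  moreover have "open (snd c ` fst c \<inter> chart_inv c -` U)"
    using homeo open_dom open_U continuous_on_open_vimage[of "snd c ` fst c" "chart_inv c"]
    by (auto simp: homeomorphism_def Int_commute)
  ultimately show ?thesis by simp
qed

lemma csm_cong: "(\<And>x. x \<in> U \<Longrightarrow> f x = g x) \<Longrightarrow> csm c U f \<longleftrightarrow> csm c U g"
  unfolding csm_def by (rule smooth_on_cong[OF open_image]) auto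

lemma csm_const [simp]: "csm c U (\<lambda>x. r)"
  by (simp add: csm_def smooth_on_const)

lemma csm_add: "csm c U f \<Longrightarrow> csm c U g \<Longrightarrow> csm c U (\<lambda>x. f x + g x)"
  unfolding csm_def by (rule smooth_on_add[OF open_image])

lemma csm_mult: "csm c U f \<Longrightarrow> csm c U g \<Longrightarrow> csm c U (\<lambda>x. f x * g x)"
  unfolding csm_def by (rule smooth_on_mult[OF open_image])

lemma csm_minus: "csm c U f \<Longrightarrow> csm c U (\<lambda>x. - f x)"
  using csm_mult[of "\<lambda>_. -1" f] by simp

lemma csm_diff: "csm c U f \<Longrightarrow> csm c U g \<Longrightarrow> csm c U (\<lambda>x. f x - g x)"
  using csm_add[of f "\<lambda>x. - g x"] by (simp add: csm_minus)

lemma csm_inverse: "csm c U f \<Longrightarrow> (\<And>x. x \<in> U \<Longrightarrow> f x \<noteq> 0) \<Longrightarrow> csm c U (\<lambda>x. inverse (f x))"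
  unfolding csm_def by (rule smooth_on_inverse[OF open_image]) auto

lemma csm_divide: "csm c U f \<Longrightarrow> csm c U g \<Longrightarrow> (\<And>x. x \<in> U \<Longrightarrow> g x \<noteq> 0) \<Longrightarrow> csm c U (\<lambda>x. f x / g x)"
  unfolding divide_inverse by (intro csm_mult csm_inverse)

lemma csm_divide_const: "csm c U f \<Longrightarrow> csm c U (\<lambda>x. f x / r)"
  unfolding divide_inverse by (intro csm_mult csm_const)

lemma csm_sum: "(\<And>i. i \<in> I \<Longrightarrow> csm c U (f i)) \<Longrightarrow> csm c U (\<lambda>x. \<Sum>i\<in>I. f i x)"
  by (induction I rule: infinite_finite_induct) (simp_all add: csm_add)

lemma csm_prod: "(\<And>i. i \<in> I \<Longrightarrow> csm c U (f i)) \<Longrightarrow> csm c U (\<lambda>x. \<Prod>i\<in>I. f i x)"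
  by (induction I rule: infinite_finite_induct) (simp_all add: csm_mult)

lemma csm_pd: "csm c U f \<Longrightarrow> csm c U (pd c a f)"
  unfolding csm_def pd_def
  by (subst smooth_on_cong[OF open_image, of _ "\<lambda>x. frechet_derivative (\<lambda>y. f (chart_inv c y)) (at x) (axis a 1)"])
    (auto intro: smooth_on_deriv)

lemmas csm_intros = csm_const csm_add csm_diff csm_minus csm_mult csm_sum csm_prod csm_pd csm_divide_const

lemma csm_continuous: "csm c U f \<Longrightarrow> continuous_on U f"
proof -
  assume "csm c U f"
  then have 1: "continuous_on (snd c ` U) (\<lambda>y. f (chart_inv c y))"
    unfolding csm_def by (rule smooth_on_continuous)
  have "continuous_on U (snd c)" using homeo U_sub by (auto simp: homeomorphism_def intro: continuous_on_subset)
  from continuous_on_compose2[OF 1 this] have "continuous_on U (\<lambda>x. f (chart_inv c (snd c x)))" by auto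
  then show ?thesis using U_sub by (auto cong: continuous_on_cong)
qed

lemma csm_has_derivative:
  "csm c U f \<Longrightarrow> p \<in> U \<Longrightarrow> ((\<lambda>y. f (chart_inv c y)) has_derivative
     frechet_derivative (\<lambda>y. f (chart_inv c y)) (at (snd c p))) (at (snd c p))"
  unfolding csm_def by (rule smooth_on_has_derivative) auto

lemma pd_eqI:
  "((\<lambda>y. f (chart_inv c y)) has_derivative D) (at (snd c p)) \<Longrightarrow> D (axis a 1) = r \<Longrightarrow> pd c a f p = r"
  unfolding pd_def using frechet_derivative_at by metis

text \<open>Functions that agree on \<open>U\<close> have the same derivatives at \<open>p\<close>,
  so the choice hidden in \<open>frechet_derivative\<close> returns the same map even where no
  derivative exists.\<close>

lemma pd_cong:
  assumes "p \<in> U" "\<And>x. x \<in> U \<Longrightarrow> f x = g x"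
  shows "pd c a f p = pd c a g p"
proof -
  have *: "((\<lambda>y. g (chart_inv c y)) has_derivative D) (at (snd c p))"
    if "((\<lambda>y. f (chart_inv c y)) has_derivative D) (at (snd c p))" "\<And>x. x \<in> U \<Longrightarrow> f x = g x" for D f g
    by (rule has_derivative_transform_within_open[OF that(1) open_image]) (use assms that in auto)
  have "((\<lambda>y. f (chart_inv c y)) has_derivative D) (at (snd c p)) \<longleftrightarrow>
      ((\<lambda>y. g (chart_inv c y)) has_derivative D) (at (snd c p))" for D
    using *[of f D g] *[of g D f] assms(2) by auto
  then show ?thesis unfolding pd_def frechet_derivative_def by simp
qed

lemma pd_const [simp]: "pd c a (\<lambda>x. r) p = 0"
  by (rule pd_eqI) (rule has_derivative_const, simp)

lemma pd_add:
  assumes "csm c U f" "csm c U g" "p \<in> U"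
  shows "pd c a (\<lambda>x. f x + g x) p = pd c a f p + pd c a g p"
  by (rule pd_eqI[OF has_derivative_add[OF csm_has_derivative csm_has_derivative]]) (use assms in \<open>auto simp: pd_def\<close>)

lemma pd_mult:
  assumes "csm c U f" "csm c U g" "p \<in> U"
  shows "pd c a (\<lambda>x. f x * g x) p = pd c a f p * g p + f p * pd c a g p"
  by (rule pd_eqI[OF has_derivative_mult[OF csm_has_derivative csm_has_derivative]])
    (use assms in \<open>auto simp: pd_def\<close>)

lemma pd_minus: "csm c U f \<Longrightarrow> p \<in> U \<Longrightarrow> pd c a (\<lambda>x. - f x) p = - pd c a f p"
  using pd_mult[of "\<lambda>_. -1" f p a] by simp

lemma pd_cmult: "csm c U f \<Longrightarrow> p \<in> U \<Longrightarrow> pd c a (\<lambda>x. r * f x) p = r * pd c a f p"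
  using pd_mult[of "\<lambda>_. r" f p a] by simp

lemma pd_sum:
  "(\<And>i. i \<in> I \<Longrightarrow> csm c U (f i)) \<Longrightarrow> p \<in> U \<Longrightarrow>
    pd c a (\<lambda>x. \<Sum>i\<in>I. f i x) p = (\<Sum>i\<in>I. pd c a (f i) p)"
  by (induction I rule: infinite_finite_induct) (simp_all add: pd_add csm_sum)

lemma pd_commute:
  assumes "csm c U f" "p \<in> U"
  shows "pd c a (pd c b f) p = pd c b (pd c a f) p"
proof -
  let ?f = "\<lambda>y. f (chart_inv c y)"
  have s: "smooth_on (snd c ` U) ?f" using assms(1) by (simp add: csm_def)
  have *: "pd c a (pd c b f) p = frechet_derivative (\<lambda>y. frechet_derivative ?f (at y) (axis b 1)) (at (snd c p)) (axis a 1)" for a b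
  proof (rule pd_eqI[OF _ refl])
    show "((\<lambda>y. pd c b f (chart_inv c y)) has_derivative
      frechet_derivative (\<lambda>y. frechet_derivative ?f (at y) (axis b 1)) (at (snd c p))) (at (snd c p))"
    proof (rule has_derivative_transform_within_open[OF _ open_image])
      show "((\<lambda>y. frechet_derivative ?f (at y) (axis b 1)) has_derivative
        frechet_derivative (\<lambda>y. frechet_derivative ?f (at y) (axis b 1)) (at (snd c p))) (at (snd c p))"
        by (rule smooth_on_has_derivative[OF smooth_on_deriv[OF s]]) (use assms(2) in auto)
    qed (use assms(2) in \<open>auto simp: pd_def\<close>)
  qed
  show ?thesis unfolding * using assms(2) by (intro frechet_derivative_commute[OF open_image s]) auto
qed

end

lemma chart_domain_subset: "chart_domain c U \<Longrightarrow> open V \<Longrightarrow> V \<subseteq> U \<Longrightarrow> chart_domain c V"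
  unfolding chart_domain_def by auto

lemma csm_subset: "csm c U f \<Longrightarrow> V \<subseteq> U \<Longrightarrow> csm c V f"
  unfolding csm_def by (rule smooth_on_subset) auto

lemma csm_local:
  assumes "chart_domain c U" "\<And>x. x \<in> U \<Longrightarrow> \<exists>V. open V \<and> x \<in> V \<and> V \<subseteq> U \<and> csm c V f"
  shows "csm c U f"
  unfolding csm_def
proof (rule smooth_on_local)
  fix y assume "y \<in> snd c ` U"
  then obtain x where x: "x \<in> U" "y = snd c x" by auto
  then obtain V where V: "open V" "x \<in> V" "V \<subseteq> U" "csm c V f" using assms(2) by blast
  then interpret V: chart_domain c V using chart_domain_subset assms(1) by blast
  show "\<exists>T. open T \<and> y \<in> T \<and> smooth_on T (\<lambda>y. f (chart_inv c y))"
    using V x V.open_image unfolding csm_def by blast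
qed

section \<open>Coordinate changes and their Jacobians\<close>

locale chart_pair = C: chart_domain c U + D: chart_domain d U
  for c d :: "('a::topological_space, 'k::finite) chart" and U +
  assumes trans_cd: "smooth_on (snd c ` U) (\<lambda>y. snd d (chart_inv c y))"
    and trans_dc: "smooth_on (snd d ` U) (\<lambda>y. snd c (chart_inv d y))"
begin

lemma csm_change: "csm c U f \<Longrightarrow> csm d U f"
proof -
  assume f: "csm c U f"
  have "smooth_on (snd d ` U) (\<lambda>y. f (chart_inv c (snd c (chart_inv d y))))"
    by (rule smooth_on_compose[OF D.open_image f[unfolded csm_def] trans_dc]) auto
  then show ?thesis unfolding csm_def
    by (subst smooth_on_cong[OF D.open_image]) auto
qed

lemma csm_coord: "csm d U (\<lambda>x. snd c x $ m)"
  unfolding csm_def by (rule smooth_on_nth[OF D.open_image trans_dc])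

lemma jac_pd: 
  assumes "p \<in> U"
  shows "jac d c p $ m $ a = pd d a (\<lambda>x. snd c x $ m) p"
proof -
  have "((\<lambda>y. snd c (chart_inv d y)) has_derivative frechet_derivative (\<lambda>y. snd c (chart_inv d y)) (at (snd d p))) (at (snd d p))"
    by (rule smooth_on_has_derivative[OF trans_dc]) (use assms in auto)
  from bounded_linear.has_derivative[OF bounded_linear_vec_nth this, of m]
  show ?thesis by (intro D.pd_eqI[symmetric]) (auto simp: jac_def matrix_def)
qed

lemma pd_change:
  assumes "csm c U f" "p \<in> U"
  shows "pd d a f p = (\<Sum>m\<in>UNIV. pd c m f p * jac d c p $ m $ a)"
proof -
  let ?T = "\<lambda>y. snd c (chart_inv d y)"
  have T: "(?T has_derivative frechet_derivative ?T (at (snd d p))) (at (snd d p))"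
    by (rule smooth_on_has_derivative[OF trans_dc]) (use assms in auto)
  have e: "?T (snd d p) = snd c p" using assms by simp
  note F = C.csm_has_derivative[OF assms]
  have "((\<lambda>y. f (chart_inv c (?T y))) has_derivative
      (\<lambda>v. frechet_derivative (\<lambda>y. f (chart_inv c y)) (at (snd c p)) (frechet_derivative ?T (at (snd d p)) v))) (at (snd d p))"
    by (rule has_derivative_compose[OF T]) (use F e in simp)
  then have "((\<lambda>y. f (chart_inv d y)) has_derivative
      (\<lambda>v. frechet_derivative (\<lambda>y. f (chart_inv c y)) (at (snd c p)) (frechet_derivative ?T (at (snd d p)) v))) (at (snd d p))"
    by (rule has_derivative_transform_within_open[OF _ D.open_image]) (use assms in auto)
  then show ?thesis
    by (rule D.pd_eqI) (auto simp: linear_vec_expand[OF has_derivative_linear[OF F], of "frechet_derivative _ _ _"] pd_def jac_def matrix_def mult.commute)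
qed

lemma csm_jac: "csm d U (\<lambda>x. jac d c x $ m $ a)"
  by (subst D.csm_cong[OF jac_pd]) (simp_all add: D.csm_pd csm_coord)

end

lemma chart_pair_sym: "chart_pair c d U \<Longrightarrow> chart_pair d c U"
  unfolding chart_pair_def chart_pair_axioms_def by auto

lemma (in chart_domain) pd_coord:
  assumes "p \<in> U"
  shows "pd c a (\<lambda>x. snd c x $ i) p = (if i = a then 1 else 0)"
proof (rule pd_eqI)
  have "((\<lambda>y. y $ i) has_derivative (\<lambda>y. y $ i)) (at (snd c p))"
    by (rule bounded_linear_imp_has_derivative[OF bounded_linear_vec_nth])
  then show "((\<lambda>y. snd c (chart_inv c y) $ i) has_derivative (\<lambda>y. y $ i)) (at (snd c p))"
    by (rule has_derivative_transform_within_open[OF _ open_image]) (use assms in auto)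
qed (simp add: axis_def)

text \<open>The chain rule \<open>pd_change\<close> applied to the coordinate functions of
  \<open>d\<close>, whose partial derivatives in \<open>d\<close> itself are Kronecker
  deltas.\<close>

lemma (in chart_pair) jac_mult:
  assumes "p \<in> U"
  shows "jac c d p ** jac d c p = mat 1"
proof -
  interpret S: chart_pair d c U using chart_pair_axioms chart_pair_sym by blast
  have "(\<Sum>m\<in>UNIV. jac c d p $ i $ m * jac d c p $ m $ a) = (if i = a then 1 else 0)" for i a
    using pd_change[OF S.csm_coord assms, of a i] D.pd_coord[OF assms, of a i] by (simp add: S.jac_pd[OF assms])
  then show ?thesis by (simp add: vec_eq_iff matrix_matrix_mult_def mat_def)
qed

lemma jac_cocycle:
  assumes "chart_pair c d U" "chart_pair c e U" "chart_pair d e U" "p \<in> U"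
  shows "jac c e p = jac d e p ** jac c d p"
proof -
  interpret cd: chart_pair c d U by fact
  interpret dc: chart_pair d c U using assms chart_pair_sym by blast
  interpret ec: chart_pair e c U using assms chart_pair_sym by blast
  interpret ed: chart_pair e d U using assms chart_pair_sym by blast
  show ?thesis
    using dc.pd_change[OF ed.csm_coord assms(4)]
    by (simp add: vec_eq_iff matrix_matrix_mult_def ec.jac_pd[OF assms(4)] ed.jac_pd[OF assms(4)])
qed

lemma matrix_inv_eqI:
  fixes A B :: "real ^ 'n ^ 'n"
  assumes "A ** B = mat 1"
  shows "matrix_inv A = B"
proof -
  have BA: "B ** A = mat 1" using assms matrix_left_right_inverse by blast
  have "matrix_inv A ** A = mat 1"
    using someI[of "\<lambda>A'. A ** A' = mat 1 \<and> A' ** A = mat 1", OF conjI[OF assms BA]]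
    by (simp add: matrix_inv_def)
  then have "matrix_inv A ** A ** B = B" by simp
  then show ?thesis using assms by (simp flip: matrix_mul_assoc)
qed

lemma (in chart_pair) jac_inv: "p \<in> U \<Longrightarrow> matrix_inv (jac c d p) = jac d c p"
  by (rule matrix_inv_eqI) (rule jac_mult)

lemma smooth_atlas_chart_domain:
  assumes "smooth_atlas B" "c \<in> B" "open U" "U \<subseteq> fst c"
  shows "chart_domain c U"
  using assms unfolding smooth_atlas_def chart_domain_def by auto

lemma smooth_atlas_open: "smooth_atlas B \<Longrightarrow> c \<in> B \<Longrightarrow> open (fst c)"
  unfolding smooth_atlas_def by auto

lemma smooth_atlas_chart_pair:
  assumes "smooth_atlas B" "c \<in> B" "d \<in> B" "open U" "U \<subseteq> fst c" "U \<subseteq> fst d"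
  shows "chart_pair c d U"
proof -
  have *: "smooth_on (snd c ` U) (\<lambda>y. snd d (chart_inv c y))"
    if "c \<in> B" "d \<in> B" "U \<subseteq> fst c" "U \<subseteq> fst d" for c d
  proof -
    have "smooth_on (snd c ` (fst c \<inter> fst d)) (\<lambda>y. snd d (chart_inv c y))"
      using assms(1) that unfolding smooth_atlas_def by blast
    then show ?thesis by (rule smooth_on_subset) (use that in auto)
  qed
  show ?thesis
    unfolding chart_pair_def chart_pair_axioms_def
    by (intro conjI smooth_atlas_chart_domain[OF assms(1)] assms *)
qed

section \<open>Algebra of tensor components\<close>

lemma sum_lists_Suc:
  fixes f :: "'k::finite list \<Rightarrow> 'b::comm_monoid_add"
  shows "(\<Sum>is | length is = Suc n. f is) = (\<Sum>i\<in>UNIV. \<Sum>is | length is = n. f (i # is))"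
proof -
  have e: "{is :: 'k list. length is = Suc n} = (\<lambda>(i, is). i # is) ` (UNIV \<times> {is. length is = n})"
    by (auto simp: length_Suc_conv image_iff)
  have i: "inj_on (\<lambda>(i, is). i # is) (UNIV \<times> {is :: 'k list. length is = n})"
    by (auto simp: inj_on_def)
  show ?thesis unfolding e sum.reindex[OF i] sum.cartesian_product by (simp add: case_prod_unfold)
qed

text \<open>The matrix by which the endomorphism \<open>M\<close> acts on one index:
  \<open>M\<close> on an upper one, minus its transpose on a lower one. \<open>act_coeff\<close> is
  the corresponding matrix for a change of basis \<open>A\<close>, with \<open>K\<close> standing
  for the inverse.\<close>

definition slot_coeff :: "index_pos \<Rightarrow> real ^ 'n ^ 'n \<Rightarrow> 'n \<Rightarrow> 'n \<Rightarrow> real" where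
  "slot_coeff \<phi> M i e = (case \<phi> of Up \<Rightarrow> M $ i $ e | Dn \<Rightarrow> - (M $ e $ i))"

definition act_coeff :: "index_pos \<Rightarrow> real ^ 'n ^ 'n \<Rightarrow> real ^ 'n ^ 'n \<Rightarrow> 'n \<Rightarrow> 'n \<Rightarrow> real" where
  "act_coeff \<phi> A K j i = (case \<phi> of Up \<Rightarrow> A $ j $ i | Dn \<Rightarrow> K $ i $ j)"

lemma sum_mult_assoc:
  fixes a :: "'i \<Rightarrow> 'b::semiring_0"
  shows "(\<Sum>i\<in>I. a i * (\<Sum>m\<in>J. b i m * X m)) = (\<Sum>m\<in>J. (\<Sum>i\<in>I. a i * b i m) * X m)"
  unfolding sum_distrib_left sum_distrib_right mult.assoc by (rule sum.swap)

lemma sharp_Nil [simp]: "sharp [] M t is = 0"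
  by (simp add: sharp_def)

text \<open>The derivation property for splitting off the first index. Together with the recursion
  of \<open>act2\<close> it reduces identities for tensors of any type to one index and an
  induction.\<close>

lemma sharp_Cons:
  "sharp (\<phi> # \<Phi>) M t (i # is) =
    (\<Sum>e\<in>UNIV. slot_coeff \<phi> M i e * t (e # is)) + sharp \<Phi> M (\<lambda>ks. t (i # ks)) is"
  unfolding sharp_def length_Cons sum.lessThan_Suc_shift
  by (cases \<phi>) (simp_all add: slot_coeff_def sum_negf cong: index_pos.case_cong)

lemma sharp_cong:
  assumes "\<And>ks. length ks = length is \<Longrightarrow> t ks = s ks"
  shows "sharp \<Phi> M t is = sharp \<Phi> M s is"
  unfolding sharp_def using assms by (intro sum.cong) (auto split: index_pos.split)

lemma sharp_add_right: "sharp \<Phi> M (\<lambda>ks. t ks + s ks) is = sharp \<Phi> M t is + sharp \<Phi> M s is"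
  unfolding sharp_def sum.distrib[symmetric]
  by (intro sum.cong) (auto simp: algebra_simps sum.distrib split: index_pos.split)

lemma sharp_scale_right: "sharp \<Phi> M (\<lambda>ks. r * t ks) is = r * sharp \<Phi> M t is"
  unfolding sharp_def sum_distrib_left
  by (intro sum.cong) (auto simp: sum_distrib_left mult.left_commute split: index_pos.split)

lemma sharp_zero_right [simp]: "sharp \<Phi> M (\<lambda>ks. 0) is = 0"
  using sharp_scale_right[of \<Phi> M 0 "\<lambda>_. 0"] by simp

lemma sharp_sum_right: "sharp \<Phi> M (\<lambda>ks. \<Sum>x\<in>I. T x ks) is = (\<Sum>x\<in>I. sharp \<Phi> M (T x) is)"
  by (induction I rule: infinite_finite_induct) (simp_all add: sharp_add_right)

lemma sharp_lin_right: "sharp \<Phi> M (\<lambda>ks. \<Sum>x\<in>I. f x * T x ks) is = (\<Sum>x\<in>I. f x * sharp \<Phi> M (T x) is)"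
  by (simp add: sharp_sum_right sharp_scale_right)

lemma sharp_add_left: "sharp \<Phi> (M + N) t is = sharp \<Phi> M t is + sharp \<Phi> N t is"
  unfolding sharp_def sum.distrib[symmetric]
  by (intro sum.cong) (auto simp: algebra_simps sum.distrib split: index_pos.split)

lemma sharp_scale_left: "sharp \<Phi> (r *\<^sub>R M) t is = r * sharp \<Phi> M t is"
  unfolding sharp_def sum_distrib_left
  by (intro sum.cong) (auto simp: sum_distrib_left mult.assoc split: index_pos.split)

lemma sharp_zero_left [simp]: "sharp \<Phi> 0 t is = 0"
  using sharp_scale_left[of \<Phi> 0 0] by simp

lemma sharp_minus_left: "sharp \<Phi> (- M) t is = - sharp \<Phi> M t is"
  using sharp_scale_left[of \<Phi> "-1" M] by simp

lemma sharp_diff_left: "sharp \<Phi> (M - N) t is = sharp \<Phi> M t is - sharp \<Phi> N t is"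
  using sharp_add_left[of \<Phi> M "-N"] by (simp add: sharp_minus_left)

lemma sharp_sum_left: "sharp \<Phi> (\<Sum>x\<in>I. F x) t is = (\<Sum>x\<in>I. sharp \<Phi> (F x) t is)"
  by (induction I rule: infinite_finite_induct) (simp_all add: sharp_add_left)

lemma slot_coeff_commutator:
  "slot_coeff \<phi> (M ** N - N ** M) i e =
    (\<Sum>f\<in>UNIV. slot_coeff \<phi> M i f * slot_coeff \<phi> N f e) - (\<Sum>f\<in>UNIV. slot_coeff \<phi> N i f * slot_coeff \<phi> M f e)"
  by (cases \<phi>) (auto simp: slot_coeff_def matrix_matrix_mult_def mult.commute)

text \<open>\<open>sharp\<close> represents the Lie algebra of endomorphisms. In the induction the
  mixed terms, where one matrix acts on the first index and the other on the rest, are symmetric in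
  \<open>M\<close> and \<open>N\<close> and drop out.\<close>

lemma sharp_commutator:
  assumes "length is = length \<Phi>"
  shows "sharp \<Phi> (M ** N - N ** M) t is = sharp \<Phi> M (sharp \<Phi> N t) is - sharp \<Phi> N (sharp \<Phi> M t) is"
  using assms
proof (induction \<Phi> arbitrary: t "is")
  case (Cons \<phi> \<Phi>)
  then obtain i ks where is_eq: "is = i # ks" and l: "length ks = length \<Phi>"
    by (cases "is") auto
  have e: "sharp (\<phi> # \<Phi>) M (sharp (\<phi> # \<Phi>) N t) (i # ks) =
      (\<Sum>e\<in>UNIV. \<Sum>f\<in>UNIV. slot_coeff \<phi> M i f * slot_coeff \<phi> N f e * t (e # ks))
      + (\<Sum>e\<in>UNIV. slot_coeff \<phi> M i e * sharp \<Phi> N (\<lambda>ks. t (e # ks)) ks)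
      + (\<Sum>e\<in>UNIV. slot_coeff \<phi> N i e * sharp \<Phi> M (\<lambda>ks. t (e # ks)) ks)
      + sharp \<Phi> M (sharp \<Phi> N (\<lambda>ks. t (i # ks))) ks" for M N
    by (simp add: sharp_Cons sharp_add_right sharp_lin_right distrib_left sum.distrib sum_mult_assoc)
      (simp add: sum_distrib_right)
  show ?case
    unfolding is_eq e
    by (simp add: sharp_Cons Cons.IH[OF l] slot_coeff_commutator left_diff_distrib sum_subtractf sum_distrib_right)
qed simp

text \<open>The action of \<open>tensor_act\<close> with the inverse matrix as a separate argument \<open>K\<close>. The recursion on
  \<open>\<Phi>\<close> peels off one index at a time, which makes all the identities below provable by induction.\<close>

primrec act2 :: "index_pos list \<Rightarrow> real ^ 'n ^ 'n \<Rightarrow> real ^ 'n ^ 'n \<Rightarrow> ('n::finite list \<Rightarrow> real) \<Rightarrow> 'n list \<Rightarrow> real" where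
  "act2 [] A K t js = t []"
| "act2 (\<phi> # \<Phi>) A K t js =
     (\<Sum>i\<in>UNIV. act_coeff \<phi> A K (hd js) i * act2 \<Phi> A K (\<lambda>is. t (i # is)) (tl js))"

lemma tensor_act_eq_act2:
  assumes "length js = length \<Phi>"
  shows "tensor_act \<Phi> A t js = act2 \<Phi> A (matrix_inv A) t js"
  using assms
proof (induction \<Phi> arbitrary: t js)
  case Nil
  then show ?case by (simp add: tensor_act_def)
next
  case (Cons \<phi> \<Phi>)
  then obtain j ks where js: "js = j # ks" and l: "length ks = length \<Phi>"
    by (cases js) auto
  show ?case
    unfolding js act2.simps Cons.IH[OF l, symmetric, unfolded tensor_act_def] list.sel
    by (cases \<phi>) (simp_all add: act_coeff_def tensor_act_def l sum_lists_Suc prod.lessThan_Suc_shift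
        sum_distrib_left mult.assoc del: prod.lessThan_Suc cong: index_pos.case_cong)
qed

lemma act2_cong:
  assumes "\<And>ks. length ks = length \<Phi> \<Longrightarrow> t ks = s ks"
  shows "act2 \<Phi> A K t js = act2 \<Phi> A K s js"
  using assms
proof (induction \<Phi> arbitrary: t s js)
  case (Cons \<phi> \<Phi>)
  have "act2 \<Phi> A K (\<lambda>is. t (i # is)) (tl js) = act2 \<Phi> A K (\<lambda>is. s (i # is)) (tl js)" for i
    by (rule Cons.IH) (simp add: Cons.prems)
  then show ?case by simp
qed simp

lemma act2_add: "act2 \<Phi> A K (\<lambda>ks. t ks + s ks) js = act2 \<Phi> A K t js + act2 \<Phi> A K s js"
  by (induction \<Phi> arbitrary: t s js) (auto simp: distrib_left sum.distrib)

lemma act2_scale: "act2 \<Phi> A K (\<lambda>ks. r * t ks) js = r * act2 \<Phi> A K t js"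
  by (induction \<Phi> arbitrary: t js) (auto simp: sum_distrib_left mult.left_commute)

lemma act2_zero [simp]: "act2 \<Phi> A K (\<lambda>ks. 0) js = 0"
  using act2_scale[of \<Phi> A K 0 "\<lambda>_. 0"] by simp

lemma act2_sum: "act2 \<Phi> A K (\<lambda>ks. \<Sum>x\<in>I. T x ks) js = (\<Sum>x\<in>I. act2 \<Phi> A K (T x) js)"
  by (induction I rule: infinite_finite_induct) (simp_all add: act2_add)

lemma act2_mult:
  assumes "length js = length \<Phi>"
  shows "act2 \<Phi> A K (act2 \<Phi> B L t) js = act2 \<Phi> (A ** B) (L ** K) t js"
  using assms
proof (induction \<Phi> arbitrary: t js)
  case (Cons \<phi> \<Phi>)
  then obtain j ks where js: "js = j # ks" and l: "length ks = length \<Phi>"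
    by (cases js) auto
  have c: "(\<Sum>i\<in>UNIV. act_coeff \<phi> A K j i * act_coeff \<phi> B L i m) = act_coeff \<phi> (A ** B) (L ** K) j m" for m
    by (cases \<phi>) (simp_all add: act_coeff_def matrix_matrix_mult_def mult.commute)
  show ?case unfolding js
    by (simp add: act2_sum act2_scale Cons.IH[OF l] c[symmetric] sum_distrib_left sum_distrib_right mult.assoc)
qed simp

lemma act2_id: "length js = length \<Phi> \<Longrightarrow> act2 \<Phi> (mat 1) (mat 1) t js = t js"
proof (induction \<Phi> arbitrary: t js)
  case (Cons \<phi> \<Phi>)
  then obtain j ks where js: "js = j # ks" and l: "length ks = length \<Phi>"
    by (cases js) auto
  show ?case unfolding js
    by (cases \<phi>) (simp_all add: Cons.IH[OF l] act_coeff_def mat_def[of 1, THEN arg_cong, of "\<lambda>M. M $ _ $ _"]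
        if_distrib[of "\<lambda>x. x * _"] cong: if_cong)
qed simp

lemma matrix_mult_nth: "(M ** N) $ i $ j = (\<Sum>k\<in>UNIV. M $ i $ k * N $ k $ j)"
  by (simp add: matrix_matrix_mult_def)

text \<open>Equivariance: a change of basis conjugates the endomorphism. Fact \<open>c\<close> is
  the intertwining relation on one index.\<close>

lemma act2_sharp:
  assumes "K ** A = mat 1" "length js = length \<Phi>"
  shows "act2 \<Phi> A K (sharp \<Phi> M t) js = sharp \<Phi> (A ** M ** K) (act2 \<Phi> A K t) js"
  using assms(2)
proof (induction \<Phi> arbitrary: t js)
  case (Cons \<phi> \<Phi>)
  then obtain j ks where js: "js = j # ks" and l: "length ks = length \<Phi>"
    by (cases js) auto
  have c: "(\<Sum>i\<in>UNIV. act_coeff \<phi> A K j i * slot_coeff \<phi> M i e) =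
      (\<Sum>i\<in>UNIV. slot_coeff \<phi> (A ** M ** K) j i * act_coeff \<phi> A K i e)" for e
  proof (cases \<phi>)
    case Up
    have "(A ** M ** K ** A) $ j $ e = (A ** M) $ j $ e"
      using assms(1) by (simp flip: matrix_mul_assoc)
    then show ?thesis using Up by (simp add: act_coeff_def slot_coeff_def matrix_mult_nth[of _ A] matrix_mult_nth[of A M])
  next
    case Dn
    have "(K ** (A ** M ** K)) $ e $ j = (M ** K) $ e $ j"
      using assms(1) by (simp add: matrix_mul_assoc)
    then show ?thesis using Dn
      by (simp add: act_coeff_def slot_coeff_def matrix_mult_nth[of K] matrix_mult_nth[of M K] sum_negf mult.commute)
  qed
  show ?case unfolding js
    by (simp add: sharp_Cons sharp_lin_right act2_add act2_sum act2_scale Cons.IH[OF l] distrib_left sum.distrib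
        sum_mult_assoc c)
qed simp

text \<open>For a moving change of basis the derivative is the derivation action of the logarithmic
  derivative \<open>A' K\<close>. This serves twice: for coordinate changes, where it yields the
  transformation law of the connection, and for paths of isometries acting on a fibre.\<close>

lemma act2_has_derivative:
  fixes A A' :: "'x::real_normed_vector \<Rightarrow> real ^ 'n ^ 'n"
  assumes "\<And>i j. ((\<lambda>x. A x $ i $ j) has_derivative (\<lambda>h. A' h $ i $ j)) (at x)"
    and "\<And>i j. ((\<lambda>x. K x $ i $ j) has_derivative (\<lambda>h. - (K x ** A' h ** K x) $ i $ j)) (at x)"
    and "\<And>is. length is = length \<Phi> \<Longrightarrow> ((\<lambda>x. t x is) has_derivative (\<lambda>h. t' h is)) (at x)"
    and KA: "K x ** A x = mat 1" and "length js = length \<Phi>"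
  shows "((\<lambda>x. act2 \<Phi> (A x) (K x) (t x) js) has_derivative
     (\<lambda>h. sharp \<Phi> (A' h ** K x) (act2 \<Phi> (A x) (K x) (t x)) js + act2 \<Phi> (A x) (K x) (t' h) js)) (at x)"
  using assms(3,5)
proof (induction \<Phi> arbitrary: t t' js)
  case Nil
  then show ?case by simp
next
  case (Cons \<phi> \<Phi>)
  then obtain j ks where js: "js = j # ks" and l: "length ks = length \<Phi>"
    by (cases js) auto
  let ?c = "\<lambda>x. act_coeff \<phi> (A x) (K x)"
  let ?c' = "\<lambda>h. act_coeff \<phi> (A' h) (- (K x ** A' h ** K x))"
  have d: "((\<lambda>x. ?c x j i) has_derivative (\<lambda>h. ?c' h j i)) (at x)" for i
    using assms(1,2) by (cases \<phi>) (auto simp: act_coeff_def)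
  have IH: "((\<lambda>x. act2 \<Phi> (A x) (K x) (\<lambda>is. t x (i # is)) ks) has_derivative
     (\<lambda>h. sharp \<Phi> (A' h ** K x) (act2 \<Phi> (A x) (K x) (\<lambda>is. t x (i # is))) ks +
          act2 \<Phi> (A x) (K x) (\<lambda>is. t' h (i # is)) ks)) (at x)" for i
    using Cons.prems l by (intro Cons.IH) auto
  have c: "?c' h j i = (\<Sum>e\<in>UNIV. slot_coeff \<phi> (A' h ** K x) j e * ?c x e i)" for h i
  proof (cases \<phi>)
    case Up
    have "(A' h ** K x ** A x) $ j $ i = A' h $ j $ i"
      using KA by (simp flip: matrix_mul_assoc)
    then show ?thesis using Up by (simp add: act_coeff_def slot_coeff_def matrix_mult_nth[of _ "A x"])
  next
    case Dn
    then show ?thesis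
      by (simp add: act_coeff_def slot_coeff_def matrix_mult_nth[of "K x"] sum_negf mult.commute flip: matrix_mul_assoc)
  qed
  have D: "((\<lambda>x. \<Sum>i\<in>UNIV. ?c x j i * act2 \<Phi> (A x) (K x) (\<lambda>is. t x (i # is)) ks) has_derivative
     (\<lambda>h. \<Sum>i\<in>UNIV. ?c x j i * (sharp \<Phi> (A' h ** K x) (act2 \<Phi> (A x) (K x) (\<lambda>is. t x (i # is))) ks +
          act2 \<Phi> (A x) (K x) (\<lambda>is. t' h (i # is)) ks) + ?c' h j i * act2 \<Phi> (A x) (K x) (\<lambda>is. t x (i # is)) ks)) (at x)"
    by (intro has_derivative_sum has_derivative_mult d IH)
  have E: "(\<Sum>i\<in>UNIV. ?c x j i * (sharp \<Phi> (A' h ** K x) (act2 \<Phi> (A x) (K x) (\<lambda>is. t x (i # is))) ks +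
          act2 \<Phi> (A x) (K x) (\<lambda>is. t' h (i # is)) ks) + ?c' h j i * act2 \<Phi> (A x) (K x) (\<lambda>is. t x (i # is)) ks) =
      sharp (\<phi> # \<Phi>) (A' h ** K x) (act2 (\<phi> # \<Phi>) (A x) (K x) (t x)) (j # ks) + act2 (\<phi> # \<Phi>) (A x) (K x) (t' h) (j # ks)" for h
    by (simp add: sharp_Cons sharp_lin_right sum.distrib distrib_left sum_mult_assoc c)
  have F: "(\<lambda>x. act2 (\<phi> # \<Phi>) (A x) (K x) (t x) (j # ks)) =
      (\<lambda>x. \<Sum>i\<in>UNIV. ?c x j i * act2 \<Phi> (A x) (K x) (\<lambda>is. t x (i # is)) ks)"
    by simp
  show ?case unfolding js F by (rule has_derivative_eq_rhs[OF D]) (rule ext, rule E)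
qed

section \<open>The Levi-Civita connection in a chart\<close>

definition kron :: "'i \<Rightarrow> 'i \<Rightarrow> real" where "kron i j = (if i = j then 1 else 0)"

lemma kron_same [simp]: "kron i i = 1" by (simp add: kron_def)
lemma kron_sym: "kron i j = kron j i" by (simp add: kron_def)

lemma sum_kron [simp]:
  "(\<Sum>j\<in>UNIV. kron (i::'i::finite) j * f j) = f i"
  "(\<Sum>j\<in>UNIV. kron j i * f j) = f i"
  "(\<Sum>j\<in>UNIV. f j * kron i j) = f i"
  "(\<Sum>j\<in>UNIV. f j * kron j i) = f i"
  by (simp_all add: kron_def if_distrib[of "\<lambda>x. x * _"] if_distrib[of "\<lambda>x. _ * x"] cong: if_cong)

lemma sum_pull:
  fixes x :: "'e \<Rightarrow> 'b::comm_semiring_0"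
  shows "(\<Sum>a\<in>A. \<Sum>b\<in>B. F a b * (\<Sum>e\<in>E. x e * C e a b)) = (\<Sum>e\<in>E. x e * (\<Sum>a\<in>A. \<Sum>b\<in>B. F a b * C e a b))"
proof -
  have "(\<Sum>a\<in>A. \<Sum>b\<in>B. F a b * (\<Sum>e\<in>E. x e * C e a b)) = (\<Sum>a\<in>A. \<Sum>b\<in>B. \<Sum>e\<in>E. x e * (F a b * C e a b))"
    by (simp add: sum_distrib_left mult.left_commute)
  also have "\<dots> = (\<Sum>a\<in>A. \<Sum>e\<in>E. \<Sum>b\<in>B. x e * (F a b * C e a b))"
    by (intro sum.cong refl sum.swap)
  also have "\<dots> = (\<Sum>e\<in>E. \<Sum>a\<in>A. \<Sum>b\<in>B. x e * (F a b * C e a b))"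
    by (rule sum.swap)
  finally show ?thesis by (simp add: sum_distrib_left)
qed

lemma sum_swap_outer: "(\<Sum>f\<in>A. \<Sum>b\<in>B. \<Sum>d\<in>A. F f b d) = (\<Sum>f\<in>A. \<Sum>b\<in>B. \<Sum>d\<in>A. F d b f)"
proof -
  have "(\<Sum>f\<in>A. \<Sum>b\<in>B. \<Sum>d\<in>A. F f b d) = (\<Sum>f\<in>A. \<Sum>d\<in>A. \<Sum>b\<in>B. F f b d)"
    by (intro sum.cong refl sum.swap)
  also have "\<dots> = (\<Sum>f\<in>A. \<Sum>d\<in>A. \<Sum>b\<in>B. F d b f)" by (rule sum.swap)
  also have "\<dots> = (\<Sum>f\<in>A. \<Sum>b\<in>B. \<Sum>d\<in>A. F d b f)" by (intro sum.cong refl sum.swap)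
  finally show ?thesis .
qed

lemma mat_1_nth: "(mat 1 :: real ^ 'n ^ 'n) $ i $ j = kron i j"
  by (simp add: mat_def kron_def)

text \<open>Cramer's rule exhibits the inverse as a rational function of the entries. Smoothness of
  the inverse metric and continuity of inverses along a path are read off from it.\<close>

lemma matrix_inv_cramer:
  fixes M :: "real ^ 'n ^ 'n"
  assumes "det M \<noteq> 0"
  shows "matrix_inv M $ a $ b = det (\<chi> i j. if j = a then kron i b else M $ i $ j) / det M"
proof -
  have "invertible M" using assms invertible_det_nz by blast
  then obtain N where N: "M ** N = mat 1" unfolding invertible_def by blast
  have "M *v (matrix_inv M *v axis b 1) = axis b 1"
    using N matrix_inv_eqI[OF N] by (simp add: matrix_vector_mul_assoc)
  then have "matrix_inv M *v axis b 1 = (\<chi> k. det (\<chi> i j. if j = k then axis b 1 $ i else M $ i $ j) / det M)"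
    by (subst (asm) cramer[OF assms])
  then have "(matrix_inv M *v axis b 1) $ a = det (\<chi> i j. if j = a then axis b 1 $ i else M $ i $ j) / det M"
    by simp
  moreover have "(matrix_inv M *v axis b 1) $ a = matrix_inv M $ a $ b"
    by (simp add: matrix_vector_mult_basis column_def)
  moreover have "(axis b 1 :: real ^ 'n) $ i = kron i b" for i
    by (simp add: axis_def kron_def)
  ultimately show ?thesis by (simp cong: if_cong)
qed

lemma invertible_matrix_inv:
  fixes M :: "real ^ 'n ^ 'n"
  assumes "det M \<noteq> 0"
  shows "M ** matrix_inv M = mat 1" "matrix_inv M ** M = mat 1"
proof -
  have "invertible M" using assms invertible_det_nz by blast
  then obtain N where N: "M ** N = mat 1" unfolding invertible_def by blast
  then show "M ** matrix_inv M = mat 1" using matrix_inv_eqI[OF N] by simp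
  then show "matrix_inv M ** M = mat 1" using matrix_left_right_inverse by blast
qed

text \<open>Only multi-indices of the right length are constrained: the chart operators below also
  take values, of no significance, at other lengths.\<close>

definition tsm :: "('a, 'k::finite) chart \<Rightarrow> 'a set \<Rightarrow> nat \<Rightarrow> ('a \<Rightarrow> 'k list \<Rightarrow> real) \<Rightarrow> bool" where
  "tsm c U n S \<longleftrightarrow> (\<forall>is. length is = n \<longrightarrow> csm c U (\<lambda>x. S x is))"

lemma tsmD: "tsm c U n S \<Longrightarrow> length is = n \<Longrightarrow> csm c U (\<lambda>x. S x is)"
  by (simp add: tsm_def)

context chart_domain
begin

lemma csm_det:
  assumes "\<And>i j. csm c U (\<lambda>x. M x $ i $ j)"
  shows "csm c U (\<lambda>x. det (M x))"
  unfolding det_def by (intro csm_intros assms)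

lemma csm_matrix_inv:
  fixes M :: "'a \<Rightarrow> real ^ 'n ^ 'n"
  assumes "\<And>i j. csm c U (\<lambda>x. M x $ i $ j)" "\<And>x. x \<in> U \<Longrightarrow> det (M x) \<noteq> 0"
  shows "csm c U (\<lambda>x. matrix_inv (M x) $ i $ j)"
proof (subst csm_cong[OF matrix_inv_cramer[OF assms(2)]])
  show "csm c U (\<lambda>x. det (\<chi> ia ja. if ja = i then kron ia j else M x $ ia $ ja) / det (M x))"
  proof (intro csm_divide csm_det assms)
    fix k l
    show "csm c U (\<lambda>x. (\<chi> ia ja. if ja = i then kron ia j else M x $ ia $ ja) $ k $ l)"
      by (cases "l = i") (simp_all add: assms(1))
  qed
qed

lemma csm_sharp:
  assumes "\<And>i j. csm c U (\<lambda>x. M x $ i $ j)" "tsm c U n S" "length is = n"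
  shows "csm c U (\<lambda>x. sharp \<Phi> (M x) (S x) is)"
  unfolding sharp_def
proof (rule csm_sum)
  fix l
  show "csm c U (\<lambda>x. case \<Phi> ! l of
      Up \<Rightarrow> (\<Sum>e\<in>UNIV. M x $ (is ! l) $ e * S x (is[l := e]))
    | Dn \<Rightarrow> - (\<Sum>e\<in>UNIV. M x $ e $ (is ! l) * S x (is[l := e])))"
    by (cases "\<Phi> ! l") (auto intro!: csm_intros assms tsmD[OF assms(2)] simp: assms(3))
qed

lemma pd_sharp:
  assumes M: "\<And>i j. csm c U (\<lambda>x. M x $ i $ j)" and S: "tsm c U n S" and l: "length is = n" and p: "p \<in> U"
  shows "pd c a (\<lambda>x. sharp \<Phi> (M x) (S x) is) p =
    sharp \<Phi> (\<chi> i j. pd c a (\<lambda>x. M x $ i $ j) p) (S p) is + sharp \<Phi> (M p) (\<lambda>ks. pd c a (\<lambda>x. S x ks) p) is"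
proof -
  have s: "csm c U (\<lambda>x. S x (is[k := e]))" for k e using tsmD[OF S] l by simp
  have "pd c a (\<lambda>x. sharp \<Phi> (M x) (S x) is) p =
    (\<Sum>l<length \<Phi>. pd c a (\<lambda>x. case \<Phi> ! l of
      Up \<Rightarrow> (\<Sum>e\<in>UNIV. M x $ (is ! l) $ e * S x (is[l := e]))
    | Dn \<Rightarrow> - (\<Sum>e\<in>UNIV. M x $ e $ (is ! l) * S x (is[l := e]))) p)"
    unfolding sharp_def
  proof (rule pd_sum[OF _ p])
    fix l
    show "csm c U (\<lambda>x. case \<Phi> ! l of
        Up \<Rightarrow> (\<Sum>e\<in>UNIV. M x $ (is ! l) $ e * S x (is[l := e]))
      | Dn \<Rightarrow> - (\<Sum>e\<in>UNIV. M x $ e $ (is ! l) * S x (is[l := e])))"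
      by (cases "\<Phi> ! l") (auto intro!: csm_intros M s)
  qed
  also have "\<dots> = sharp \<Phi> (\<chi> i j. pd c a (\<lambda>x. M x $ i $ j) p) (S p) is + sharp \<Phi> (M p) (\<lambda>ks. pd c a (\<lambda>x. S x ks) p) is"
    unfolding sharp_def sum.distrib[symmetric]
  proof (rule sum.cong[OF refl])
    fix l
    have e: "pd c a (\<lambda>x. \<Sum>e\<in>UNIV. F x e * S x (is[l := e])) p =
       (\<Sum>e\<in>UNIV. pd c a (\<lambda>x. F x e) p * S p (is[l := e]) + F p e * pd c a (\<lambda>x. S x (is[l := e])) p)"
      if "\<And>e. csm c U (\<lambda>x. F x e)" for F
      using that s p by (subst pd_sum) (auto intro!: csm_intros sum.cong pd_mult)
    have m: "csm c U (\<lambda>x. \<Sum>e\<in>UNIV. M x $ e $ (is ! l) * S x (is[l := e]))"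
      by (intro csm_intros M s)
    show "pd c a (\<lambda>x. case \<Phi> ! l of
      Up \<Rightarrow> (\<Sum>e\<in>UNIV. M x $ (is ! l) $ e * S x (is[l := e]))
    | Dn \<Rightarrow> - (\<Sum>e\<in>UNIV. M x $ e $ (is ! l) * S x (is[l := e]))) p =
     (case \<Phi> ! l of
      Up \<Rightarrow> (\<Sum>e\<in>UNIV. (\<chi> i j. pd c a (\<lambda>x. M x $ i $ j) p) $ (is ! l) $ e * S p (is[l := e]))
    | Dn \<Rightarrow> - (\<Sum>e\<in>UNIV. (\<chi> i j. pd c a (\<lambda>x. M x $ i $ j) p) $ e $ (is ! l) * S p (is[l := e]))) +
     (case \<Phi> ! l of
      Up \<Rightarrow> (\<Sum>e\<in>UNIV. M p $ (is ! l) $ e * pd c a (\<lambda>x. S x (is[l := e])) p)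
    | Dn \<Rightarrow> - (\<Sum>e\<in>UNIV. M p $ e $ (is ! l) * pd c a (\<lambda>x. S x (is[l := e])) p))"
      by (cases "\<Phi> ! l") (simp_all add: pd_minus[OF m p] e M sum.distrib)
  qed
  finally show ?thesis .
qed

end

definition conn :: "('m, 'n::finite) tfield \<Rightarrow> ('m, 'n) chart \<Rightarrow> 'n \<Rightarrow> 'm \<Rightarrow> real ^ 'n ^ 'n" where
  "conn h c a p = (\<chi> i j. christoffel h p c i a j)"

text \<open>In \<open>cd h c \<Phi> a S\<close> the index \<open>a\<close> is a label rather than a tensor slot, so \<open>cd a (cd b S)\<close> has no
  Christoffel term for \<open>b\<close>: the commutator of two such operators is exactly the action of the
  curvature, and the second Bianchi identity is their Jacobi identity. \<open>cdm\<close> is the same operator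
  on fields of endomorphisms, and \<open>covd\<close> makes \<open>a\<close> the first tensor index.\<close>

definition cd :: "('m, 'n::finite) tfield \<Rightarrow> ('m, 'n) chart \<Rightarrow> index_pos list \<Rightarrow> 'n \<Rightarrow>
    ('m \<Rightarrow> 'n list \<Rightarrow> real) \<Rightarrow> 'm \<Rightarrow> 'n list \<Rightarrow> real" where
  "cd h c \<Phi> a S p is = pd c a (\<lambda>x. S x is) p + sharp \<Phi> (conn h c a p) (S p) is"

definition covd :: "('m, 'n::finite) tfield \<Rightarrow> ('m, 'n) chart \<Rightarrow> index_pos list \<Rightarrow>
    ('m \<Rightarrow> 'n list \<Rightarrow> real) \<Rightarrow> 'm \<Rightarrow> 'n list \<Rightarrow> real" where
  "covd h c \<Phi> S p is = cd h c \<Phi> (hd is) S p (tl is)"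

definition curv :: "('m, 'n::finite) tfield \<Rightarrow> ('m, 'n) chart \<Rightarrow> 'n \<Rightarrow> 'n \<Rightarrow> 'm \<Rightarrow> real ^ 'n ^ 'n" where
  "curv h c a b p = (\<chi> e d. riemann h p c a b e d)"

definition cdm :: "('m, 'n::finite) tfield \<Rightarrow> ('m, 'n) chart \<Rightarrow> 'n \<Rightarrow> ('m \<Rightarrow> real ^ 'n ^ 'n) \<Rightarrow> 'm \<Rightarrow> real ^ 'n ^ 'n" where
  "cdm h c a M p = (\<chi> i j. pd c a (\<lambda>x. M x $ i $ j) p) + (conn h c a p ** M p - M p ** conn h c a p)"

locale chart_metric = chart_domain c U
  for c :: "('a::topological_space, 'k::finite) chart" and U +
  fixes h :: "('a, 'k) tfield"
  assumes h_csm: "\<And>a b. csm c U (\<lambda>x. h x c [a, b])"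
    and h_sym: "\<And>p a b. p \<in> U \<Longrightarrow> h p c [a, b] = h p c [b, a]"
    and h_det: "\<And>p. p \<in> U \<Longrightarrow> det (gmat h p c) \<noteq> 0"
begin

abbreviation "g p a b \<equiv> h p c [a, b]"
abbreviation "gi p a b \<equiv> ginv h p c a b"
abbreviation "\<Gamma> p i a b \<equiv> christoffel h p c i a b"

lemma csm_ginv: "csm c U (\<lambda>x. gi x a b)"
  unfolding ginv_def by (rule csm_matrix_inv) (auto simp: gmat_def h_csm h_det[unfolded gmat_def])

lemma g_gi: "p \<in> U \<Longrightarrow> (\<Sum>e\<in>UNIV. g p a e * gi p e b) = kron a b"
  using invertible_matrix_inv(1)[OF h_det, THEN arg_cong, of p "\<lambda>M. M $ a $ b"]
  by (simp add: matrix_mult_nth mat_1_nth ginv_def gmat_def)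

lemma gi_g: "p \<in> U \<Longrightarrow> (\<Sum>e\<in>UNIV. gi p a e * g p e b) = kron a b"
  using invertible_matrix_inv(2)[OF h_det, THEN arg_cong, of p "\<lambda>M. M $ a $ b"]
  by (simp add: matrix_mult_nth mat_1_nth ginv_def gmat_def)

lemma gi_sym: 
  assumes "p \<in> U" shows "gi p a b = gi p b a"
proof -
  let ?G = "gmat h p c" and ?I = "matrix_inv (gmat h p c)"
  have "transpose ?G = ?G" using h_sym[OF assms] by (simp add: transpose_def gmat_def vec_eq_iff)
  then have "?G ** transpose ?I = mat 1"
    using arg_cong[OF invertible_matrix_inv(2)[OF h_det[OF assms]], of transpose]
    by (simp add: matrix_transpose_mul)
  then have "?I = transpose ?I" using matrix_inv_eqI by blast
  then have "?I $ a $ b = transpose ?I $ a $ b" by simp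
  then show ?thesis by (simp add: ginv_def transpose_def)
qed

lemma lower_injective:
  assumes "p \<in> U" "\<And>e. (\<Sum>i\<in>UNIV. g p e i * f i) = (\<Sum>i\<in>UNIV. g p e i * f' i)"
  shows "f i = f' i"
proof -
  have "(\<Sum>e\<in>UNIV. gi p i e * (\<Sum>j\<in>UNIV. g p e j * f j)) = (\<Sum>e\<in>UNIV. gi p i e * (\<Sum>j\<in>UNIV. g p e j * f' j))"
    using assms(2) by simp
  then show ?thesis unfolding sum_mult_assoc gi_g[OF assms(1)] by simp
qed

lemma pd_g_sym: "p \<in> U \<Longrightarrow> pd c e (\<lambda>x. g x a b) p = pd c e (\<lambda>x. g x b a) p"
  by (rule pd_cong) (auto simp: h_sym)

lemma csm_christoffel: "csm c U (\<lambda>x. \<Gamma> x i a b)"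
  unfolding christoffel_def by (intro csm_intros csm_ginv h_csm)

lemma christoffel_sym: "p \<in> U \<Longrightarrow> \<Gamma> p i a b = \<Gamma> p i b a"
  unfolding christoffel_def by (simp add: pd_g_sym[of p _ a b] add.commute)

lemma christoffel_lower:
  assumes "p \<in> U"
  shows "(\<Sum>i\<in>UNIV. g p e i * \<Gamma> p i b d) =
    (pd c b (\<lambda>x. g x e d) p + pd c d (\<lambda>x. g x e b) p - pd c e (\<lambda>x. g x b d) p) / 2"
  unfolding christoffel_def times_divide_eq_right sum_divide_distrib[symmetric] sum_mult_assoc g_gi[OF assms] sum_kron ..

lemma metric_compat:
  assumes "p \<in> U"
  shows "pd c a (\<lambda>x. g x b d) p = (\<Sum>e\<in>UNIV. \<Gamma> p e a b * g p e d) + (\<Sum>e\<in>UNIV. \<Gamma> p e a d * g p b e)"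
proof -
  have "(\<Sum>e\<in>UNIV. \<Gamma> p e a b * g p e d) = (\<Sum>e\<in>UNIV. g p d e * \<Gamma> p e a b)"
    by (simp add: h_sym[OF assms, of d] mult.commute)
  moreover have "(\<Sum>e\<in>UNIV. \<Gamma> p e a d * g p b e) = (\<Sum>e\<in>UNIV. g p b e * \<Gamma> p e a d)"
    by (simp add: mult.commute)
  ultimately show ?thesis
    unfolding christoffel_lower[OF assms]
    using pd_g_sym[OF assms, of a d b] pd_g_sym[OF assms, of b d a] pd_g_sym[OF assms, of d a b] by (simp add: field_simps)
qed

text \<open>Koszul's argument at one point. It yields the transformation law of the Christoffel
  symbols later: the transformed symbols have only to be symmetric and compatible with the
  metric.\<close>

lemma christoffel_unique:
  assumes p: "p \<in> U"
    and sym: "\<And>i a b. N i a b = N i b a"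
    and compat: "\<And>a b d. pd c a (\<lambda>x. g x b d) p = (\<Sum>e\<in>UNIV. N e a b * g p e d) + (\<Sum>e\<in>UNIV. N e a d * g p b e)"
  shows "N i a b = \<Gamma> p i a b"
proof (rule lower_injective[OF p, of "\<lambda>i. N i a b" "\<lambda>i. \<Gamma> p i a b"])
  fix e
  have s: "(\<Sum>i\<in>UNIV. N i a b * g p d i) = (\<Sum>i\<in>UNIV. g p d i * N i a b)"
      "(\<Sum>i\<in>UNIV. N i a b * g p i d) = (\<Sum>i\<in>UNIV. g p d i * N i a b)" for a b d
    by (simp_all add: h_sym[OF p, of d] mult.commute)
  show "(\<Sum>i\<in>UNIV. g p e i * N i a b) = (\<Sum>i\<in>UNIV. g p e i * \<Gamma> p i a b)"
    unfolding christoffel_lower[OF p] compat s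
    by (simp add: sym[of _ e] sym[of _ b a])
qed

lemma conn_nth [simp]: "conn h c a p $ i $ j = \<Gamma> p i a j" by (simp add: conn_def)
lemma curv_nth [simp]: "curv h c a b p $ i $ j = riemann h p c a b i j" by (simp add: curv_def)

lemma csm_riemann: "csm c U (\<lambda>x. riemann h x c a b e d)"
  unfolding riemann_def by (intro csm_intros csm_christoffel)

lemma csm_cd:
  "tsm c U (length \<Phi>) S \<Longrightarrow> length is = length \<Phi> \<Longrightarrow> csm c U (\<lambda>x. cd h c \<Phi> a S x is)"
  unfolding cd_def by (rule csm_add[OF csm_pd[OF tsmD] csm_sharp]) (simp_all add: csm_christoffel)

lemma tsm_cd: "tsm c U (length \<Phi>) S \<Longrightarrow> tsm c U (length \<Phi>) (cd h c \<Phi> a S)"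
  using csm_cd by (subst tsm_def) blast

lemma tsm_covd: "tsm c U (length \<Phi>) S \<Longrightarrow> tsm c U (Suc (length \<Phi>)) (covd h c \<Phi> S)"
  by (subst tsm_def) (auto simp: covd_def intro!: csm_cd)

lemma covd_Cons: "covd h c \<Phi> S p (a # is) = cd h c \<Phi> a S p is"
  by (simp add: covd_def)

lemma cd_cong:
  assumes "p \<in> U" "length is = n" "\<And>x ks. x \<in> U \<Longrightarrow> length ks = n \<Longrightarrow> S x ks = T x ks"
  shows "cd h c \<Phi> a S p is = cd h c \<Phi> a T p is"
  unfolding cd_def using assms by (intro arg_cong2[where f="(+)"] pd_cong sharp_cong) auto

lemma cd_add:
  assumes "tsm c U (length \<Phi>) S" "tsm c U (length \<Phi>) T" "p \<in> U" "length is = length \<Phi>"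
  shows "cd h c \<Phi> a (\<lambda>x ks. S x ks + T x ks) p is = cd h c \<Phi> a S p is + cd h c \<Phi> a T p is"
  unfolding cd_def using tsmD[OF assms(1,4)] tsmD[OF assms(2,4)] assms(3)
  by (simp add: pd_add sharp_add_right)

lemma cd_mult:
  assumes "csm c U f" "tsm c U (length \<Phi>) S" "p \<in> U" "length is = length \<Phi>"
  shows "cd h c \<Phi> a (\<lambda>x ks. f x * S x ks) p is = pd c a f p * S p is + f p * cd h c \<Phi> a S p is"
  unfolding cd_def using tsmD[OF assms(2,4)] assms(1,3)
  by (simp add: pd_mult sharp_scale_right distrib_left)

lemma cd_sum:
  assumes "\<And>i. i \<in> I \<Longrightarrow> tsm c U (length \<Phi>) (S i)" "p \<in> U" "length is = length \<Phi>"
  shows "cd h c \<Phi> a (\<lambda>x ks. \<Sum>i\<in>I. S i x ks) p is = (\<Sum>i\<in>I. cd h c \<Phi> a (S i) p is)"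
  unfolding cd_def using tsmD[OF assms(1,3)] assms(2)
  by (simp add: pd_sum sharp_sum_right sum.distrib)

lemma tsm_mult: "csm c U f \<Longrightarrow> tsm c U n S \<Longrightarrow> tsm c U n (\<lambda>x ks. f x * S x ks)"
  by (auto simp: tsm_def intro: csm_mult)

lemma tsm_add: "tsm c U n S \<Longrightarrow> tsm c U n T \<Longrightarrow> tsm c U n (\<lambda>x ks. S x ks + T x ks)"
  by (auto simp: tsm_def intro: csm_add)

lemma tsm_sum: "(\<And>i. i \<in> I \<Longrightarrow> tsm c U n (S i)) \<Longrightarrow> tsm c U n (\<lambda>x ks. \<Sum>i\<in>I. S i x ks)"
  by (auto simp: tsm_def intro!: csm_sum)

lemma tsm_sharp: "(\<And>i j. csm c U (\<lambda>x. M x $ i $ j)) \<Longrightarrow> tsm c U n S \<Longrightarrow> tsm c U n (\<lambda>x. sharp \<Phi> (M x) (S x))"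
  using csm_sharp by (subst tsm_def) blast

text \<open>The Leibniz rule for an endomorphism acting on a tensor. The commutator with
  \<open>conn\<close> in \<open>cdm\<close> is what \<open>sharp_commutator\<close>
  produces.\<close>

lemma cd_sharp:
  assumes M: "\<And>i j. csm c U (\<lambda>x. M x $ i $ j)" and S: "tsm c U (length \<Phi>) S"
    and p: "p \<in> U" and l: "length is = length \<Phi>"
  shows "cd h c \<Phi> a (\<lambda>x. sharp \<Phi> (M x) (S x)) p is =
    sharp \<Phi> (cdm h c a M p) (S p) is + sharp \<Phi> (M p) (cd h c \<Phi> a S p) is"
  unfolding cd_def[abs_def] pd_sharp[OF M S l p] cdm_def sharp_add_left sharp_commutator[OF l] sharp_add_right
  by simp

text \<open>Second partial derivatives commute, and the terms with one connection matrix acting on a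
  first derivative of \<open>S\<close> are symmetric in \<open>a\<close> and \<open>b\<close>. What
  is left is the curl of the connection matrices plus their bracket, which is \<open>curv\<close>;
  the bracket comes from \<open>sharp_commutator\<close>.\<close>

lemma cd_commutator:
  assumes S: "tsm c U (length \<Phi>) S" and p: "p \<in> U" and l: "length is = length \<Phi>"
  shows "cd h c \<Phi> a (cd h c \<Phi> b S) p is - cd h c \<Phi> b (cd h c \<Phi> a S) p is = sharp \<Phi> (curv h c a b p) (S p) is"
proof -
  have e: "cd h c \<Phi> a (cd h c \<Phi> b S) p is =
     pd c a (pd c b (\<lambda>x. S x is)) p + sharp \<Phi> (\<chi> i j. pd c a (\<lambda>x. \<Gamma> x i b j) p) (S p) is
     + sharp \<Phi> (conn h c b p) (\<lambda>ks. pd c a (\<lambda>x. S x ks) p) is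
     + sharp \<Phi> (conn h c a p) (\<lambda>ks. pd c b (\<lambda>x. S x ks) p) is
     + sharp \<Phi> (conn h c a p) (sharp \<Phi> (conn h c b p) (S p)) is" for a b
  proof -
    have "pd c a (\<lambda>x. pd c b (\<lambda>x. S x is) x + sharp \<Phi> (conn h c b x) (S x) is) p =
      pd c a (pd c b (\<lambda>x. S x is)) p + (sharp \<Phi> (\<chi> i j. pd c a (\<lambda>x. \<Gamma> x i b j) p) (S p) is
     + sharp \<Phi> (conn h c b p) (\<lambda>ks. pd c a (\<lambda>x. S x ks) p) is)"
      using pd_sharp[OF _ S l p, of "conn h c b" a \<Phi>] csm_sharp[OF _ S l, of "conn h c b" \<Phi>] csm_christoffel tsmD[OF S l] p
      by (subst pd_add) (auto intro: csm_pd)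
    then show ?thesis unfolding cd_def by (simp add: sharp_add_right)
  qed
  have c: "curv h c a b p = (\<chi> i j. pd c a (\<lambda>x. \<Gamma> x i b j) p) - (\<chi> i j. pd c b (\<lambda>x. \<Gamma> x i a j) p) +
     (conn h c a p ** conn h c b p - conn h c b p ** conn h c a p)"
    by (simp add: vec_eq_iff riemann_def matrix_mult_nth sum_subtractf)
  show ?thesis
    unfolding c sharp_add_left sharp_diff_left sharp_commutator[OF l] e pd_commute[OF tsmD[OF S l] p, of a b]
    using sharp_commutator[OF l, of "conn h c a p" "conn h c b p" "S p"] by (simp add: sharp_diff_left)
qed

section \<open>Symmetries of the curvature and the Bianchi identities\<close>

lemma riemann_antisym: "riemann h p c b a e d = - riemann h p c a b e d"
  by (simp add: riemann_def sum_subtractf)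

lemma tsm_metric: "tsm c U 2 (\<lambda>x. h x c)"
  by (auto simp: tsm_def numeral_2_eq_2 length_Suc_conv h_csm)

lemma cd_metric:
  assumes "p \<in> U" "length is = 2"
  shows "cd h c [Dn, Dn] a (\<lambda>x. h x c) p is = 0"
  using assms by (auto simp: numeral_2_eq_2 length_Suc_conv cd_def sharp_Cons slot_coeff_def metric_compat sum_negf)

lemma cd_zero: "cd h c \<Phi> a (\<lambda>x ks. 0) p is = 0"
  by (simp add: cd_def)

text \<open>The metric is parallel, so the commutator of two derivatives of it vanishes; by
  \<open>cd_commutator\<close> the curvature therefore acts trivially on the metric.\<close>

lemma riemann_skew:
  assumes p: "p \<in> U"
  shows "(\<Sum>f\<in>UNIV. riemann h p c a b f e * g p f d) = - (\<Sum>f\<in>UNIV. riemann h p c a b f d * g p e f)"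
proof -
  have "cd h c [Dn, Dn] a (cd h c [Dn, Dn] b (\<lambda>x. h x c)) p [e, d] = cd h c [Dn, Dn] a (\<lambda>x ks. 0) p [e, d]" for a b
    by (rule cd_cong[OF p, of _ 2]) (auto simp: cd_metric)
  then have "sharp [Dn, Dn] (curv h c a b p) (h p c) [e, d] = 0"
    using tsm_metric by (subst cd_commutator[symmetric, OF _ p]) (auto simp: cd_zero numeral_2_eq_2)
  then show ?thesis by (simp add: sharp_Cons slot_coeff_def sum_negf)
qed

lemma tsm_const: "tsm c U n (\<lambda>x. t)"
  by (simp add: tsm_def)

text \<open>The family \<open>\<lambda>x ks. kron (hd ks) j\<close> is the \<open>j\<close>-th
  coordinate vector field. An endomorphism is determined by its action on these fields, which serve
  as test fields for both Bianchi identities.\<close>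

lemma cd_basis: "cd h c [Up] a (\<lambda>x ks. kron (hd ks) j) p [i] = \<Gamma> p i a j"
  by (simp add: cd_def sharp_Cons slot_coeff_def)

lemma sharp_basis: "sharp [Up] M (\<lambda>ks. kron (hd ks) j) [i] = M $ i $ j"
  by (simp add: sharp_Cons slot_coeff_def)

text \<open>By vanishing torsion, fact \<open>s\<close>, the coordinate fields \<open>b\<close> and
  \<open>d\<close> have the same derivative along one another, and the six terms of the cyclic sum
  cancel in pairs.\<close>

lemma bianchi1:
  assumes p: "p \<in> U"
  shows "riemann h p c a b i d + riemann h p c b d i a + riemann h p c d a i b = 0"
proof -
  let ?e = "\<lambda>j (x::'a) ks. kron (hd ks) j"
  have R: "riemann h p c a b i d = cd h c [Up] a (cd h c [Up] b (?e d)) p [i] - cd h c [Up] b (cd h c [Up] a (?e d)) p [i]" for a b d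
    by (subst cd_commutator[OF _ p]) (auto simp: tsm_const sharp_basis)
  have s: "cd h c [Up] a (cd h c [Up] b (?e d)) p [i] = cd h c [Up] a (cd h c [Up] d (?e b)) p [i]" for a b d
    by (rule cd_cong[OF p, of _ 1]) (auto simp: length_Suc_conv cd_basis christoffel_sym[of _ _ b])
  show ?thesis unfolding R using s[of a b d] s[of b d a] s[of d a b] by simp
qed

definition "riemann_low p a b e d = (\<Sum>f\<in>UNIV. g p e f * riemann h p c a b f d)"

text \<open>The octahedron argument: the first Bianchi identity is used four times, once for each
  index held in the third place, and the skew symmetries within each pair combine the terms.\<close>

lemma riemann_low_pair:
  assumes p: "p \<in> U"
  shows "riemann_low p a b e d = riemann_low p e d a b"
proof -
  have 1: "riemann_low p b a e d = - riemann_low p a b e d" for a b e d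
    by (simp add: riemann_low_def riemann_antisym[of p b a] sum_negf)
  have 2: "riemann_low p a b d e = - riemann_low p a b e d" for a b e d
    using riemann_skew[OF p, of a b e d] by (simp add: riemann_low_def h_sym[OF p, of d] mult.commute)
  have 3: "riemann_low p a b e d + riemann_low p b d e a + riemann_low p d a e b = 0" for a b e d
    using bianchi1[OF p, of a b _ d] by (simp add: riemann_low_def flip: sum.distrib distrib_left)
  show ?thesis
    using 3[of a b e d] 3[of e d a b] 3[of a e b d] 3[of a b d e]
      1[of b d a e] 2[of b d e a] 2[of e d a b] 2[of d a e b] 2[of a b e d] 2[of b e a d] 1[of a e d b] 2[of a e b d]
    by linarith
qed

lemma csm_curv: "csm c U (\<lambda>x. curv h c a b x $ i $ j)"
  by (simp add: csm_riemann)

lemma bianchi2: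
  assumes p: "p \<in> U"
  shows "cdm h c a (curv h c b d) p + cdm h c b (curv h c d a) p + cdm h c d (curv h c a b) p = 0"
proof -
  let ?D = "cd h c [Up]"
  have "(cdm h c a (curv h c b d) p + cdm h c b (curv h c d a) p + cdm h c d (curv h c a b) p) $ i $ j = 0" for i j
  proof -
    let ?e = "\<lambda>(x::'a) ks. kron (hd ks) j"
    have te: "tsm c U (length [Up]) ?e" by (rule tsm_const)
    have tD: "tsm c U (length [Up]) (?D a S)" if "tsm c U (length [Up]) S" for a S using tsm_cd that by blast
    \<comment> \<open>The commutator of \<open>?D a\<close> with the commutator of
      \<open>?D b\<close> and \<open>?D d\<close>, on a coordinate field. In the cyclic sum the
      twelve triple derivatives cancel.\<close>
    have R: "sharp [Up] (cdm h c a (curv h c b d) p) (?e p) [i] =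
       ?D a (?D b (?D d ?e)) p [i] - ?D a (?D d (?D b ?e)) p [i] - (?D b (?D d (?D a ?e)) p [i] - ?D d (?D b (?D a ?e)) p [i])" for a b d
    proof -
      have "sharp [Up] (cdm h c a (curv h c b d) p) (?e p) [i] =
         ?D a (\<lambda>x. sharp [Up] (curv h c b d x) (?e x)) p [i] - sharp [Up] (curv h c b d p) (?D a ?e p) [i]"
        by (subst cd_sharp[OF csm_curv te p]) auto
      also have "?D a (\<lambda>x. sharp [Up] (curv h c b d x) (?e x)) p [i] = ?D a (\<lambda>x ks. ?D b (?D d ?e) x ks + (-1) * ?D d (?D b ?e) x ks) p [i]"
        by (rule cd_cong[OF p, of _ "length [Up]"]) (auto simp: cd_commutator[OF te, symmetric])
      also have "\<dots> = ?D a (?D b (?D d ?e)) p [i] - ?D a (?D d (?D b ?e)) p [i]"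
        by (subst cd_add[OF tD[OF tD[OF te]] tsm_mult[OF csm_const tD[OF tD[OF te]]] p], simp,
            subst cd_mult[OF csm_const tD[OF tD[OF te]] p]) auto
      finally show ?thesis by (simp add: cd_commutator[OF tD[OF te] p])
    qed
    show ?thesis
      using R[of a b d] R[of b d a] R[of d a b] by (simp add: sharp_basis)
  qed
  then show ?thesis by (simp add: vec_eq_iff)
qed

end

section \<open>The Laplacian and the Euler field in a chart\<close>

definition lapc :: "('m, 'n::finite) tfield \<Rightarrow> ('m, 'n) chart \<Rightarrow> index_pos list \<Rightarrow>
    ('m \<Rightarrow> 'n list \<Rightarrow> real) \<Rightarrow> 'm \<Rightarrow> 'n list \<Rightarrow> real" where
  "lapc h c \<Phi> S p is =
    (\<Sum>a\<in>UNIV. \<Sum>b\<in>UNIV. ginv h p c a b * covd h c (Dn # \<Phi>) (covd h c \<Phi> S) p (a # b # is))"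

text \<open>This is \<open>curv_sharp_sharp\<close> with the sums over matrix units carried out: the
  inner factor is the curvature endomorphism \<open>curv h c f b\<close>, the outer one has entries
  \<open>ginv h p c i f * kron j b\<close>. Here \<open>f\<close> and \<open>b\<close> are labels,
  so the rules for \<open>cd\<close> and \<open>sharp\<close> apply to both factors.\<close>

definition curvc :: "('m, 'n::finite) tfield \<Rightarrow> ('m, 'n) chart \<Rightarrow> index_pos list \<Rightarrow>
    ('m \<Rightarrow> 'n list \<Rightarrow> real) \<Rightarrow> 'm \<Rightarrow> 'n list \<Rightarrow> real" where
  "curvc h c \<Phi> S p is = (\<Sum>f\<in>UNIV. \<Sum>b\<in>UNIV.
     sharp \<Phi> (\<chi> i j. ginv h p c i f * kron j b) (sharp \<Phi> (curv h c f b p) (S p)) is)"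

definition cX :: "('m, 'n::finite) tfield \<Rightarrow> ('m, 'n) chart \<Rightarrow> ('m \<Rightarrow> 'n \<Rightarrow> real) \<Rightarrow> index_pos list \<Rightarrow>
    ('m \<Rightarrow> 'n list \<Rightarrow> real) \<Rightarrow> 'm \<Rightarrow> 'n list \<Rightarrow> real" where
  "cX h c X \<Phi> S p is = (\<Sum>a\<in>UNIV. X p a * cd h c \<Phi> a S p is)"

context chart_metric
begin

lemma cd_covd:
  "cd h c (Dn # \<Phi>) b (covd h c \<Phi> S) p (a # is) =
     cd h c \<Phi> b (cd h c \<Phi> a S) p is - (\<Sum>e\<in>UNIV. \<Gamma> p e b a * cd h c \<Phi> e S p is)"
  by (simp add: cd_def[of h c "Dn # \<Phi>"] covd_Cons sharp_Cons slot_coeff_def sum_negf cd_def[of h c \<Phi> b "cd h c \<Phi> a S"])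

text \<open>The product of the metric with its inverse is differentiated,
  \<open>metric_compat\<close> is inserted, and the metric is cancelled by
  \<open>lower_injective\<close>. The formula says that the inverse metric is parallel.\<close>

lemma pd_gi:
  assumes p: "p \<in> U"
  shows "pd c e (\<lambda>x. gi x a b) p = - (\<Sum>f\<in>UNIV. \<Gamma> p a e f * gi p f b) - (\<Sum>f\<in>UNIV. gi p a f * \<Gamma> p b e f)"
proof (rule lower_injective[OF p, of "\<lambda>a. pd c e (\<lambda>x. gi x a b) p"
    "\<lambda>a. - (\<Sum>f\<in>UNIV. \<Gamma> p a e f * gi p f b) - (\<Sum>f\<in>UNIV. gi p a f * \<Gamma> p b e f)"])
  fix d
  have "pd c e (\<lambda>x. \<Sum>i\<in>UNIV. g x d i * gi x i b) p = pd c e (\<lambda>x. kron d b) p"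
    by (rule pd_cong[OF p]) (simp add: g_gi)
  then have "(\<Sum>i\<in>UNIV. pd c e (\<lambda>x. g x d i) p * gi p i b) + (\<Sum>i\<in>UNIV. g p d i * pd c e (\<lambda>x. gi x i b) p) = 0"
    using p by (simp add: pd_sum pd_mult csm_mult csm_ginv h_csm sum.distrib)
  moreover have "(\<Sum>i\<in>UNIV. pd c e (\<lambda>x. g x d i) p * gi p i b) =
     (\<Sum>i\<in>UNIV. g p d i * (\<Sum>f\<in>UNIV. \<Gamma> p i e f * gi p f b)) + (\<Sum>i\<in>UNIV. g p d i * (\<Sum>f\<in>UNIV. gi p i f * \<Gamma> p b e f))"
  proof -
    have "(\<Sum>i\<in>UNIV. g p d i * (\<Sum>f\<in>UNIV. gi p i f * \<Gamma> p b e f)) = \<Gamma> p b e d"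
      by (simp add: sum_mult_assoc g_gi[OF p])
    moreover have "(\<Sum>i\<in>UNIV. (\<Sum>f\<in>UNIV. \<Gamma> p f e d * g p f i) * gi p i b) = \<Gamma> p b e d"
      by (simp add: sum_mult_assoc[symmetric] g_gi[OF p])
    ultimately show ?thesis
      by (simp add: metric_compat[OF p] distrib_right sum.distrib sum_mult_assoc mult.commute[of "\<Gamma> p _ _ _" "g p _ _"])
  qed
  ultimately show "(\<Sum>a\<in>UNIV. g p d a * pd c e (\<lambda>x. gi x a b) p) = (\<Sum>a\<in>UNIV. g p d a *
      (- (\<Sum>f\<in>UNIV. \<Gamma> p a e f * gi p f b) - (\<Sum>f\<in>UNIV. gi p a f * \<Gamma> p b e f)))"
    by (simp add: right_diff_distrib sum_subtractf sum_negf)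
qed

text \<open>The trace commutes with \<open>cd\<close> because the inverse metric is parallel.\<close>

lemma cd_trace:
  assumes W: "tsm c U (Suc (Suc (length \<Phi>))) W" and p: "p \<in> U" and l: "length is = length \<Phi>"
  shows "cd h c \<Phi> e (\<lambda>p is. \<Sum>a\<in>UNIV. \<Sum>b\<in>UNIV. gi p a b * W p (a # b # is)) p is =
    (\<Sum>a\<in>UNIV. \<Sum>b\<in>UNIV. gi p a b * cd h c (Dn # Dn # \<Phi>) e W p (a # b # is))"
proof -
  have tW: "tsm c U (length \<Phi>) (\<lambda>p is. W p (a # b # is))" for a b using W by (auto simp: tsm_def)
  have "cd h c \<Phi> e (\<lambda>p is. \<Sum>a\<in>UNIV. \<Sum>b\<in>UNIV. gi p a b * W p (a # b # is)) p is =
    (\<Sum>a\<in>UNIV. \<Sum>b\<in>UNIV. pd c e (\<lambda>x. gi x a b) p * W p (a # b # is) + gi p a b * cd h c \<Phi> e (\<lambda>p is. W p (a # b # is)) p is)"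
    by (simp add: cd_sum[OF _ p l] tsm_sum tsm_mult csm_ginv tW cd_mult[OF _ tW p l])
  also have "\<dots> = (\<Sum>a\<in>UNIV. \<Sum>b\<in>UNIV. pd c e (\<lambda>x. gi x a b) p * W p (a # b # is)) +
     (\<Sum>a\<in>UNIV. \<Sum>b\<in>UNIV. gi p a b * cd h c \<Phi> e (\<lambda>p is. W p (a # b # is)) p is)"
    by (simp add: sum.distrib)
  also have "(\<Sum>a\<in>UNIV. \<Sum>b\<in>UNIV. pd c e (\<lambda>x. gi x a b) p * W p (a # b # is)) =
     - (\<Sum>a\<in>UNIV. \<Sum>b\<in>UNIV. gi p a b * (\<Sum>f\<in>UNIV. \<Gamma> p f e a * W p (f # b # is)))
     - (\<Sum>a\<in>UNIV. \<Sum>b\<in>UNIV. gi p a b * (\<Sum>f\<in>UNIV. \<Gamma> p f e b * W p (a # f # is)))"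
  proof -
    have "(\<Sum>a\<in>UNIV. \<Sum>b\<in>UNIV. (\<Sum>f\<in>UNIV. \<Gamma> p a e f * gi p f b) * W p (a # b # is)) =
       (\<Sum>b\<in>UNIV. \<Sum>a\<in>UNIV. \<Sum>f\<in>UNIV. gi p f b * \<Gamma> p a e f * W p (a # b # is))"
      by (subst sum.swap) (simp add: sum_distrib_right mult.commute[of "\<Gamma> p _ _ _" "gi p _ _"])
    also have "\<dots> = (\<Sum>b\<in>UNIV. \<Sum>f\<in>UNIV. \<Sum>a\<in>UNIV. gi p f b * \<Gamma> p a e f * W p (a # b # is))"
      by (intro sum.cong refl sum.swap)
    also have "\<dots> = (\<Sum>f\<in>UNIV. \<Sum>b\<in>UNIV. gi p f b * (\<Sum>a\<in>UNIV. \<Gamma> p a e f * W p (a # b # is)))"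
      by (subst sum.swap) (simp add: sum_distrib_left mult.assoc)
    finally have 1: "(\<Sum>a\<in>UNIV. \<Sum>b\<in>UNIV. (\<Sum>f\<in>UNIV. \<Gamma> p a e f * gi p f b) * W p (a # b # is)) = \<dots>" .
    have "(\<Sum>a\<in>UNIV. \<Sum>b\<in>UNIV. (\<Sum>f\<in>UNIV. gi p a f * \<Gamma> p b e f) * W p (a # b # is)) =
      (\<Sum>a\<in>UNIV. \<Sum>f\<in>UNIV. gi p a f * (\<Sum>b\<in>UNIV. \<Gamma> p b e f * W p (a # b # is)))"
      by (simp add: sum_mult_assoc)
    then show ?thesis unfolding pd_gi[OF p] left_diff_distrib sum_subtractf using 1
      by (simp add: sum_negf)
  qed
  also have "\<dots> + (\<Sum>a\<in>UNIV. \<Sum>b\<in>UNIV. gi p a b * cd h c \<Phi> e (\<lambda>p is. W p (a # b # is)) p is) =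
     (\<Sum>a\<in>UNIV. \<Sum>b\<in>UNIV. gi p a b * cd h c (Dn # Dn # \<Phi>) e W p (a # b # is))"
    by (simp add: cd_def sharp_Cons slot_coeff_def sum_negf right_diff_distrib distrib_left sum_subtractf sum.distrib algebra_simps)
  finally show ?thesis .
qed

text \<open>With \<open>f\<close> and \<open>b\<close> as tensor indices this field would be
  parallel. As they are labels, exactly the Christoffel terms for \<open>f\<close> and
  \<open>b\<close> remain; in \<open>curvc_cX\<close> they cancel those of the curvature.\<close>

lemma cdm_unit:
  assumes p: "p \<in> U"
  shows "cdm h c e (\<lambda>x. \<chi> i j. gi x i f * kron j b) p =
    - (\<Sum>d\<in>UNIV. \<Gamma> p f e d *\<^sub>R (\<chi> i j. gi p i d * kron j b)) - (\<Sum>d\<in>UNIV. \<Gamma> p b e d *\<^sub>R (\<chi> i j. gi p i f * kron j d))"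
  (is "?L = ?R")
proof -
  have "?L $ i $ j = ?R $ i $ j" for i j
  proof -
    have "pd c e (\<lambda>x. gi x i f * kron j b) p = pd c e (\<lambda>x. gi x i f) p * kron j b"
      using pd_cmult[OF csm_ginv p, of e "kron j b" i f] by (simp add: mult.commute)
    then show ?thesis
      by (simp add: cdm_def matrix_mult_nth pd_gi[OF p] sum_distrib_right[symmetric] mult.assoc[symmetric])
        (simp add: algebra_simps sum_distrib_right sum_distrib_left)
  qed
  then show ?thesis unfolding vec_eq_iff by blast
qed

end

section \<open>Consequences of \<nabla>X = id\<close>

locale chart_euler = chart_metric +
  fixes X :: "'a \<Rightarrow> 'b \<Rightarrow> real"
  assumes X_csm: "\<And>a. csm c U (\<lambda>x. X x a)"
    and X_deriv: "\<And>p a b. p \<in> U \<Longrightarrow> pd c a (\<lambda>x. X x b) p + (\<Sum>e\<in>UNIV. \<Gamma> p b a e * X p e) = kron a b"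
begin

text \<open>The derivative of \<open>X\<close> in direction \<open>b\<close> is the coordinate field
  \<open>b\<close>, so the commutator of two derivatives of \<open>X\<close> is a difference of
  Christoffel symbols, which vanishes by their symmetry.\<close>

lemma riemann_euler:
  assumes p: "p \<in> U"
  shows "(\<Sum>d\<in>UNIV. riemann h p c a b e d * X p d) = 0"
proof -
  let ?V = "\<lambda>x ks. X x (hd ks)"
  have t: "tsm c U (length [Up]) ?V" by (auto simp: tsm_def X_csm)
  have 1: "cd h c [Up] a ?V x [i] = kron a i" if "x \<in> U" for a x i
    using X_deriv[OF that, of a i] by (simp add: cd_def sharp_Cons slot_coeff_def)
  have 2: "cd h c [Up] a (cd h c [Up] b ?V) p [e] = \<Gamma> p e a b" for a b
  proof -
    have "cd h c [Up] a (cd h c [Up] b ?V) p [e] = cd h c [Up] a (\<lambda>x ks. kron (hd ks) b) p [e]"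
      by (rule cd_cong[OF p, of _ 1]) (auto simp: length_Suc_conv 1 kron_sym)
    then show ?thesis by (simp add: cd_basis)
  qed
  show ?thesis
    using cd_commutator[OF t p, of "[e]" a b] christoffel_sym[OF p, of e a b] by (simp add: 2 sharp_Cons slot_coeff_def)
qed

text \<open>After one index is lowered, pair symmetry carries \<open>X\<close> from the last slot of
  the curvature to the first.\<close>

lemma euler_riemann:
  assumes p: "p \<in> U"
  shows "(\<Sum>a\<in>UNIV. X p a * riemann h p c a b e d) = 0"
proof -
  have "(\<Sum>f\<in>UNIV. g p e f * (\<Sum>a\<in>UNIV. X p a * riemann h p c a b f d)) = (\<Sum>f\<in>UNIV. g p e f * 0)" for e
  proof -
    have "(\<Sum>f\<in>UNIV. g p e f * (\<Sum>a\<in>UNIV. X p a * riemann h p c a b f d)) = (\<Sum>a\<in>UNIV. X p a * riemann_low p a b e d)"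
      unfolding riemann_low_def sum_distrib_left by (subst sum.swap) (simp add: mult.left_commute)
    also have "\<dots> = - (\<Sum>a\<in>UNIV. X p a * riemann_low p e d b a)"
    proof -
      have "riemann_low p a b e d = - riemann_low p e d b a" for a
        using riemann_skew[OF p, of e d a b] riemann_low_pair[OF p, of a b e d]
        by (simp add: riemann_low_def h_sym[OF p, of a] h_sym[OF p, of b] mult.commute)
      then show ?thesis by (simp add: sum_negf)
    qed
    also have "(\<Sum>a\<in>UNIV. X p a * riemann_low p e d b a) = (\<Sum>f\<in>UNIV. g p b f * (\<Sum>a\<in>UNIV. riemann h p c e d f a * X p a))"
      unfolding riemann_low_def sum_distrib_left by (subst sum.swap) (simp add: mult_ac)
    finally show ?thesis by (simp add: riemann_euler[OF p])
  qed
  from lower_injective[OF p this] show ?thesis .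
qed

lemma tsm_cX: "tsm c U (length \<Phi>) S \<Longrightarrow> tsm c U (length \<Phi>) (cX h c X \<Phi> S)"
  unfolding cX_def[abs_def] by (intro tsm_sum tsm_mult X_csm tsm_cd)

text \<open>The first summand is \<nabla>X = id; exchanging the two derivatives in the other one
  costs a curvature term with \<open>X\<close> inserted, which is zero.\<close>

lemma covd_cX:
  assumes S: "tsm c U (length \<Phi>) S" and p: "p \<in> U" and l: "length is = length \<Phi>"
  shows "covd h c \<Phi> (cX h c X \<Phi> S) p (a # is) = covd h c \<Phi> S p (a # is) + cX h c X (Dn # \<Phi>) (covd h c \<Phi> S) p (a # is)"
proof -
  let ?D = "\<lambda>a S. cd h c \<Phi> a S p is"
  have "?D a (cX h c X \<Phi> S) = (\<Sum>b\<in>UNIV. pd c a (\<lambda>x. X x b) p * ?D b S + X p b * ?D a (cd h c \<Phi> b S))"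
    unfolding cX_def[abs_def]
    by (simp add: cd_sum[OF _ p l] tsm_mult X_csm tsm_cd S cd_mult[OF _ tsm_cd[OF S] p l])
  also have "\<dots> = (\<Sum>b\<in>UNIV. (kron a b - (\<Sum>e\<in>UNIV. \<Gamma> p b a e * X p e)) * ?D b S) + (\<Sum>b\<in>UNIV. X p b * ?D a (cd h c \<Phi> b S))"
    using X_deriv[OF p, of a] by (simp add: sum.distrib eq_diff_eq[symmetric])
  also have "(\<Sum>b\<in>UNIV. X p b * ?D a (cd h c \<Phi> b S)) = (\<Sum>b\<in>UNIV. X p b * ?D b (cd h c \<Phi> a S)) + (\<Sum>b\<in>UNIV. X p b * sharp \<Phi> (curv h c a b p) (S p) is)"
    by (simp add: cd_commutator[OF S p l, symmetric] right_diff_distrib sum_subtractf)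
  also have "(\<Sum>b\<in>UNIV. X p b * sharp \<Phi> (curv h c a b p) (S p) is) = 0"
  proof -
    have "(\<Sum>b\<in>UNIV. X p b *\<^sub>R curv h c a b p) = 0"
      using euler_riemann[OF p, of a] by (simp add: vec_eq_iff riemann_antisym[of p _ a] sum_negf)
    then have "sharp \<Phi> (\<Sum>b\<in>UNIV. X p b *\<^sub>R curv h c a b p) (S p) is = 0" by simp
    then show ?thesis by (simp add: sharp_sum_left sharp_scale_left)
  qed
  \<comment> \<open>The Christoffel part of the derivative of \<open>X\<close> supplies the
    correction for the new lower index, which \<open>cd\<close> does not see as long as
    \<open>a\<close> is a label.\<close>
  also have "(\<Sum>b\<in>UNIV. (kron a b - (\<Sum>e\<in>UNIV. \<Gamma> p b a e * X p e)) * ?D b S) =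
      ?D a S - (\<Sum>e\<in>UNIV. X p e * (\<Sum>b\<in>UNIV. \<Gamma> p b e a * ?D b S))"
    by (simp add: left_diff_distrib sum_subtractf sum_mult_assoc[of "X p"])
      (simp add: christoffel_sym[OF p, of _ a] mult.commute[of "X p _"])
  finally show ?thesis
    unfolding covd_Cons cX_def[of _ _ _ "Dn # \<Phi>"] cd_covd by (simp add: right_diff_distrib sum_subtractf)
qed

lemma cX_add:
  assumes "tsm c U (length \<Phi>) S" "tsm c U (length \<Phi>) T" "p \<in> U" "length is = length \<Phi>"
  shows "cX h c X \<Phi> (\<lambda>x ks. S x ks + T x ks) p is = cX h c X \<Phi> S p is + cX h c X \<Phi> T p is"
  unfolding cX_def using assms by (simp add: cd_add distrib_left sum.distrib)

text \<open>Each of the two derivatives in the Laplacian contributes one copy by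
  \<open>covd_cX\<close>, hence the factor 2; the metric trace commutes with the derivative along
  \<open>X\<close> by \<open>cd_trace\<close>.\<close>

lemma lapc_cX:
  assumes S: "tsm c U (length \<Phi>) S" and p: "p \<in> U" and l: "length is = length \<Phi>"
  shows "lapc h c \<Phi> (cX h c X \<Phi> S) p is = 2 * lapc h c \<Phi> S p is + cX h c X \<Phi> (lapc h c \<Phi> S) p is"
proof -
  let ?W = "covd h c (Dn # \<Phi>) (covd h c \<Phi> S)"
  have t1: "tsm c U (length (Dn # \<Phi>)) (covd h c \<Phi> S)" using tsm_covd[OF S] by simp
  have t2: "tsm c U (Suc (Suc (length \<Phi>))) ?W" using tsm_covd[OF t1] by simp
  have "covd h c (Dn # \<Phi>) (covd h c \<Phi> (cX h c X \<Phi> S)) p (a # b # is) = 2 * ?W p (a # b # is) + cX h c X (Dn # Dn # \<Phi>) ?W p (a # b # is)" for a b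
  proof -
    have "covd h c (Dn # \<Phi>) (covd h c \<Phi> (cX h c X \<Phi> S)) p (a # b # is) =
      covd h c (Dn # \<Phi>) (\<lambda>x ks. covd h c \<Phi> S x ks + cX h c X (Dn # \<Phi>) (covd h c \<Phi> S) x ks) p (a # b # is)"
      unfolding covd_Cons
      by (rule cd_cong[OF p, of _ "Suc (length \<Phi>)"]) (use l in \<open>auto simp: length_Suc_conv covd_cX[OF S]\<close>)
    also have "\<dots> = ?W p (a # b # is) + covd h c (Dn # \<Phi>) (cX h c X (Dn # \<Phi>) (covd h c \<Phi> S)) p (a # b # is)"
      unfolding covd_Cons by (rule cd_add[OF t1 tsm_cX[OF t1] p]) (use l in simp)
    also have "covd h c (Dn # \<Phi>) (cX h c X (Dn # \<Phi>) (covd h c \<Phi> S)) p (a # b # is) =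
        ?W p (a # b # is) + cX h c X (Dn # Dn # \<Phi>) ?W p (a # b # is)"
      by (rule covd_cX[OF t1 p]) (use l in simp)
    finally show ?thesis by simp
  qed
  then have "lapc h c \<Phi> (cX h c X \<Phi> S) p is = 2 * lapc h c \<Phi> S p is +
     (\<Sum>a\<in>UNIV. \<Sum>b\<in>UNIV. gi p a b * cX h c X (Dn # Dn # \<Phi>) ?W p (a # b # is))"
    unfolding lapc_def by (simp add: distrib_left sum.distrib sum_distrib_left mult_ac)
  also have "(\<Sum>a\<in>UNIV. \<Sum>b\<in>UNIV. gi p a b * cX h c X (Dn # Dn # \<Phi>) ?W p (a # b # is)) =
     (\<Sum>e\<in>UNIV. X p e * (\<Sum>a\<in>UNIV. \<Sum>b\<in>UNIV. gi p a b * cd h c (Dn # Dn # \<Phi>) e ?W p (a # b # is)))"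
    unfolding cX_def by (rule sum_pull)
  also have "\<dots> = cX h c X \<Phi> (lapc h c \<Phi> S) p is"
    unfolding cX_def lapc_def[abs_def] cd_trace[OF t2 p l] ..
  finally show ?thesis .
qed

text \<open>This is \<nabla>_X R = -2 R. Contracted with \<open>X\<close>, the second Bianchi
  identity trades the derivative along \<open>X\<close> for derivatives in the directions
  \<open>f\<close> and \<open>b\<close> of curvatures with \<open>X\<close> in a slot, and each of
  these gives one copy of -R. The sums on the right are the Christoffel terms for the
  labels.\<close>

lemma cdm_curv_euler:
  assumes p: "p \<in> U"
  shows "(\<Sum>e\<in>UNIV. X p e *\<^sub>R cdm h c e (curv h c f b) p) = - 2 *\<^sub>R curv h c f b p +
    (\<Sum>d\<in>UNIV. (\<Sum>e\<in>UNIV. X p e * \<Gamma> p d e f) *\<^sub>R curv h c d b p) + (\<Sum>d\<in>UNIV. (\<Sum>e\<in>UNIV. X p e * \<Gamma> p d e b) *\<^sub>R curv h c f d p)"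
proof -
  \<comment> \<open>Differentiating the identity that \<open>X\<close> annihilates the curvature
    moves the derivative onto \<open>X\<close>, and \<nabla>X = id gives minus the
    curvature.\<close>
  have D: "(\<Sum>e\<in>UNIV. X p e *\<^sub>R cdm h c a (curv h c e d) p) =
    - curv h c a d p + (\<Sum>e\<in>UNIV. (\<Sum>i\<in>UNIV. X p i * \<Gamma> p e i a) *\<^sub>R curv h c e d p)" for a d
  proof -
    have "(\<Sum>e\<in>UNIV. X p e *\<^sub>R cdm h c a (curv h c e d) p) $ i $ j =
      (- curv h c a d p + (\<Sum>e\<in>UNIV. (\<Sum>i\<in>UNIV. X p i * \<Gamma> p e i a) *\<^sub>R curv h c e d p)) $ i $ j" for i j
    proof -
      \<comment> \<open>The commutator with the connection in \<open>cdm\<close> leaves the slot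
        contracted with \<open>X\<close> untouched, so it contributes nothing.\<close>
      have z: "(\<Sum>e\<in>UNIV. X p e * (\<Sum>k\<in>UNIV. N k * riemann h p c e d k j)) = 0"
        "(\<Sum>e\<in>UNIV. X p e * (\<Sum>k\<in>UNIV. riemann h p c e d i k * N k)) = 0" for N
        unfolding sum_distrib_left
        by (subst sum.swap, simp add: mult.left_commute[of "X p _"] euler_riemann[OF p] flip: sum_distrib_left)
          (subst sum.swap, simp add: euler_riemann[OF p] flip: sum_distrib_right mult.assoc)
      have "pd c a (\<lambda>x. \<Sum>e\<in>UNIV. X x e * riemann h x c e d i j) p = pd c a (\<lambda>x. 0) p"
        by (rule pd_cong[OF p]) (simp add: euler_riemann)
      then have "(\<Sum>e\<in>UNIV. X p e * pd c a (\<lambda>x. riemann h x c e d i j) p) = - (\<Sum>e\<in>UNIV. pd c a (\<lambda>x. X x e) p * riemann h p c e d i j)"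
        using p by (simp add: pd_sum pd_mult csm_mult X_csm csm_riemann sum.distrib)
      also have "\<dots> = - (\<Sum>e\<in>UNIV. (kron a e - (\<Sum>k\<in>UNIV. X p k * \<Gamma> p e k a)) * riemann h p c e d i j)"
        using X_deriv[OF p, of a] by (simp add: eq_diff_eq[symmetric] christoffel_sym[OF p, of _ a] mult.commute[of "X p _"])
      finally show ?thesis
        by (simp add: cdm_def matrix_mult_nth distrib_left right_diff_distrib sum.distrib sum_subtractf z left_diff_distrib)
    qed
    then show ?thesis unfolding vec_eq_iff by blast
  qed
  have a: "curv h c b a p = - curv h c a b p" for a b
    by (simp add: vec_eq_iff riemann_antisym[of p b a])
  have c: "cdm h c e (curv h c b a) p = - cdm h c e (curv h c a b) p" for e a b
  proof -
    have "pd c e (\<lambda>x. riemann h x c b a i j) p = - pd c e (\<lambda>x. riemann h x c a b i j) p" for i j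
      using pd_minus[OF csm_riemann p, of e a b i j] by (simp add: riemann_antisym[of _ b a])
    then show ?thesis
      unfolding cdm_def by (simp add: vec_eq_iff matrix_mult_nth riemann_antisym[of p b a] sum_negf)
  qed
  have "cdm h c e (curv h c f b) p = cdm h c f (curv h c e b) p - cdm h c b (curv h c e f) p" for e
  proof -
    have "cdm h c e (curv h c f b) p + cdm h c f (curv h c b e) p + cdm h c b (curv h c e f) p = 0"
      by (rule bianchi2[OF p])
    then have "cdm h c e (curv h c f b) p = - cdm h c f (curv h c b e) p - cdm h c b (curv h c e f) p"
      by (simp add: eq_neg_iff_add_eq_0 algebra_simps)
    then show ?thesis unfolding c[of f b e] by simp
  qed
  then have "(\<Sum>e\<in>UNIV. X p e *\<^sub>R cdm h c e (curv h c f b) p) =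
     (\<Sum>e\<in>UNIV. X p e *\<^sub>R cdm h c f (curv h c e b) p) - (\<Sum>e\<in>UNIV. X p e *\<^sub>R cdm h c b (curv h c e f) p)"
    by (simp add: scaleR_diff_right sum_subtractf)
  also have "\<dots> = - curv h c f b p + curv h c b f p + (\<Sum>e\<in>UNIV. (\<Sum>i\<in>UNIV. X p i * \<Gamma> p e i f) *\<^sub>R curv h c e b p)
      - (\<Sum>e\<in>UNIV. (\<Sum>i\<in>UNIV. X p i * \<Gamma> p e i b) *\<^sub>R curv h c e f p)"
    unfolding D by simp
  also have "(\<Sum>e\<in>UNIV. (\<Sum>i\<in>UNIV. X p i * \<Gamma> p e i b) *\<^sub>R curv h c e f p) = - (\<Sum>e\<in>UNIV. (\<Sum>i\<in>UNIV. X p i * \<Gamma> p e i b) *\<^sub>R curv h c f e p)"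
    unfolding a[of _ f] scaleR_minus_right sum_negf ..
  finally show ?thesis unfolding a[of b f] by (simp add: scaleR_2 algebra_simps)
qed

lemma cX_sharp:
  assumes M: "\<And>i j. csm c U (\<lambda>x. M x $ i $ j)" and S: "tsm c U (length \<Phi>) S"
    and p: "p \<in> U" and l: "length is = length \<Phi>"
  shows "cX h c X \<Phi> (\<lambda>x. sharp \<Phi> (M x) (S x)) p is =
    sharp \<Phi> (\<Sum>e\<in>UNIV. X p e *\<^sub>R cdm h c e M p) (S p) is + sharp \<Phi> (M p) (cX h c X \<Phi> S p) is"
  unfolding cX_def[abs_def] cd_sharp[OF M S p l] sharp_sum_left sharp_scale_left sharp_lin_right
  by (simp add: distrib_left sum.distrib)

lemma csm_unit: "csm c U (\<lambda>x. (\<chi> i j. gi x i f * kron j b) $ i $ j)"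
  by (simp add: csm_mult csm_ginv)

text \<open>Differentiation along \<open>X\<close> is a derivation on both endomorphisms and on
  \<open>S\<close>. The label terms cancel, and \<nabla>_X R = -2 R leaves the last summand.\<close>

lemma curvc_cX:
  assumes S: "tsm c U (length \<Phi>) S" and p: "p \<in> U" and l: "length is = length \<Phi>"
  shows "cX h c X \<Phi> (curvc h c \<Phi> S) p is = curvc h c \<Phi> (cX h c X \<Phi> S) p is - 2 * curvc h c \<Phi> S p is"
proof -
  let ?E = "\<lambda>f b x. (\<chi> i j. gi x i f * kron j b) :: real ^ 'b ^ 'b"
  let ?R = "\<lambda>f b x. curv h c f b x"
  let ?N = "\<lambda>d f. \<Sum>e\<in>UNIV. X p e * \<Gamma> p d e f"
  let ?T = "\<lambda>f b f' b'. sharp \<Phi> (?E f b p) (sharp \<Phi> (?R f' b' p) (S p)) is"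
  have tR: "tsm c U (length \<Phi>) (\<lambda>x. sharp \<Phi> (?R f b x) (S x))" for f b
    by (rule tsm_sharp[OF csm_curv S])
  have E: "(\<Sum>e\<in>UNIV. X p e *\<^sub>R cdm h c e (?E f b) p) = - (\<Sum>d\<in>UNIV. ?N f d *\<^sub>R ?E d b p) - (\<Sum>d\<in>UNIV. ?N b d *\<^sub>R ?E f d p)" for f b
  proof -
    have "(\<Sum>e\<in>UNIV. X p e *\<^sub>R (\<Sum>d\<in>UNIV. C e d *\<^sub>R M d)) = (\<Sum>d\<in>UNIV. (\<Sum>e\<in>UNIV. X p e * C e d) *\<^sub>R M d)" for C and M :: "'b \<Rightarrow> real ^ 'b ^ 'b"
      unfolding scaleR_sum_right scaleR_sum_left by (subst sum.swap) simp
    then show ?thesis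
      unfolding cdm_unit[OF p] by (simp add: scaleR_diff_right sum_subtractf sum_negf)
  qed
  have "cX h c X \<Phi> (curvc h c \<Phi> S) p is = (\<Sum>f\<in>UNIV. \<Sum>b\<in>UNIV. cX h c X \<Phi> (\<lambda>x. sharp \<Phi> (?E f b x) (sharp \<Phi> (?R f b x) (S x))) p is)"
  proof -
    have "cd h c \<Phi> e (curvc h c \<Phi> S) p is = (\<Sum>f\<in>UNIV. \<Sum>b\<in>UNIV. cd h c \<Phi> e (\<lambda>x. sharp \<Phi> (?E f b x) (sharp \<Phi> (?R f b x) (S x))) p is)" for e
      unfolding curvc_def[abs_def]
      by (simp add: cd_sum[OF _ p l] tsm_sum tsm_sharp[OF csm_unit tR])
    then show ?thesis
      unfolding cX_def
      by (simp add: sum_pull[where A=UNIV and B=UNIV and E=UNIV and F="\<lambda>_ _. 1" and x="X p", unfolded mult_1])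
  qed
  also have "\<dots> = (\<Sum>f\<in>UNIV. \<Sum>b\<in>UNIV.
      (- (\<Sum>d\<in>UNIV. ?N f d * ?T d b f b) - (\<Sum>d\<in>UNIV. ?N b d * ?T f d f b)
       + (- 2 * ?T f b f b + (\<Sum>d\<in>UNIV. ?N d f * ?T f b d b) + (\<Sum>d\<in>UNIV. ?N d b * ?T f b f d)))
       + sharp \<Phi> (?E f b p) (sharp \<Phi> (?R f b p) (cX h c X \<Phi> S p)) is)"
  proof (intro sum.cong refl)
    fix f b
    have 1: "sharp \<Phi> (?E f b p) (cX h c X \<Phi> (\<lambda>x. sharp \<Phi> (?R f b x) (S x)) p) is =
      sharp \<Phi> (?E f b p) (\<lambda>ks. sharp \<Phi> (\<Sum>e\<in>UNIV. X p e *\<^sub>R cdm h c e (?R f b) p) (S p) ks + sharp \<Phi> (?R f b p) (cX h c X \<Phi> S p) ks) is"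
      by (rule sharp_cong) (use l in \<open>simp add: cX_sharp[OF csm_curv S p]\<close>)
    show "cX h c X \<Phi> (\<lambda>x. sharp \<Phi> (?E f b x) (sharp \<Phi> (?R f b x) (S x))) p is =
      (- (\<Sum>d\<in>UNIV. ?N f d * ?T d b f b) - (\<Sum>d\<in>UNIV. ?N b d * ?T f d f b)
       + (- 2 * ?T f b f b + (\<Sum>d\<in>UNIV. ?N d f * ?T f b d b) + (\<Sum>d\<in>UNIV. ?N d b * ?T f b f d)))
       + sharp \<Phi> (?E f b p) (sharp \<Phi> (?R f b p) (cX h c X \<Phi> S p)) is"
      unfolding cX_sharp[OF csm_unit tR p l] E 1 cdm_curv_euler[OF p]
      by (simp only: sharp_diff_left sharp_minus_left sharp_add_left sharp_sum_left sharp_scale_left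
        sharp_add_right sharp_sum_right sharp_scale_right)
  qed
  also have "\<dots> = curvc h c \<Phi> (cX h c X \<Phi> S) p is - 2 * curvc h c \<Phi> S p is"
  proof -
    \<comment> \<open>The terms from \<open>cdm_unit\<close> and those from
      \<open>cdm_curv_euler\<close> agree after renaming the summation indices and carry opposite
      signs.\<close>
    have 1: "(\<Sum>f\<in>UNIV. \<Sum>b\<in>UNIV. \<Sum>d\<in>UNIV. ?N f d * ?T d b f b) = (\<Sum>f\<in>UNIV. \<Sum>b\<in>UNIV. \<Sum>d\<in>UNIV. ?N d f * ?T f b d b)"
      by (rule sum_swap_outer)
    have 2: "(\<Sum>f\<in>UNIV. \<Sum>b\<in>UNIV. \<Sum>d\<in>UNIV. ?N b d * ?T f d f b) = (\<Sum>f\<in>UNIV. \<Sum>b\<in>UNIV. \<Sum>d\<in>UNIV. ?N d b * ?T f b f d)"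
      by (rule sum.cong[OF refl], rule sum.swap)
    show ?thesis
      unfolding sum.distrib sum_subtractf sum_negf 1 2 curvc_def sum_distrib_left by (simp add: sum_negf)
  qed
  finally show ?thesis .
qed

end

section \<open>The commutator of the Laplacian with Q\<close>

locale chart_ambient = chart_euler +
  fixes Q :: "'a \<Rightarrow> real"
  assumes Q_csm: "csm c U Q"
    and Q_deriv: "\<And>p a. p \<in> U \<Longrightarrow> pd c a Q p = 2 * (\<Sum>b\<in>UNIV. g p a b * X p b)"
begin

text \<open>The Hessian of Q is 2 h, because dQ = 2 h(X, .) with h parallel and \<nabla>X =
  id.\<close>

lemma hess_Q:
  assumes p: "p \<in> U"
  shows "pd c b (pd c a Q) p - (\<Sum>e\<in>UNIV. \<Gamma> p e b a * pd c e Q p) = 2 * g p b a"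
proof -
  have "pd c b (pd c a Q) p = pd c b (\<lambda>x. 2 * (\<Sum>d\<in>UNIV. g x a d * X x d)) p"
    by (rule pd_cong[OF p]) (simp add: Q_deriv)
  also have "\<dots> = 2 * (\<Sum>d\<in>UNIV. pd c b (\<lambda>x. g x a d) p * X p d + g p a d * pd c b (\<lambda>x. X x d) p)"
    using p by (simp add: pd_cmult csm_sum csm_mult h_csm X_csm pd_sum pd_mult)
  also have "(\<Sum>d\<in>UNIV. pd c b (\<lambda>x. g x a d) p * X p d + g p a d * pd c b (\<lambda>x. X x d) p) =
    (\<Sum>d\<in>UNIV. (\<Sum>e\<in>UNIV. \<Gamma> p e b a * g p e d) * X p d) + (\<Sum>d\<in>UNIV. (\<Sum>e\<in>UNIV. g p a e * \<Gamma> p e b d) * X p d)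
     + (\<Sum>d\<in>UNIV. g p a d * (kron b d - (\<Sum>e\<in>UNIV. \<Gamma> p d b e * X p e)))"
    using X_deriv[OF p, of b]
    by (simp add: metric_compat[OF p] distrib_right sum.distrib eq_diff_eq[symmetric] mult.commute[of "\<Gamma> p _ _ _" "g p a _"])
  also have "(\<Sum>d\<in>UNIV. (\<Sum>e\<in>UNIV. \<Gamma> p e b a * g p e d) * X p d) = (\<Sum>e\<in>UNIV. \<Gamma> p e b a * (\<Sum>d\<in>UNIV. g p e d * X p d))"
    by (simp add: sum_mult_assoc)
  also have "(\<Sum>d\<in>UNIV. g p a d * (kron b d - (\<Sum>e\<in>UNIV. \<Gamma> p d b e * X p e))) =
     g p a b - (\<Sum>d\<in>UNIV. (\<Sum>e\<in>UNIV. g p a e * \<Gamma> p e b d) * X p d)"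
    by (simp add: right_diff_distrib sum_subtractf sum_mult_assoc)
  finally show ?thesis
    by (simp add: Q_deriv[OF p] mult.left_commute[of _ 2] h_sym[OF p, of a b] flip: sum_distrib_left)
qed

text \<open>In the product rule the trace of the Hessian 2 h gives twice the dimension, and each of
  the two cross terms gives twice the derivative along \<open>X\<close>, half the gradient of Q
  being \<open>X\<close>.\<close>

lemma lapc_mult_Q:
  assumes S: "tsm c U (length \<Phi>) S" and p: "p \<in> U" and l: "length is = length \<Phi>"
  shows "lapc h c \<Phi> (\<lambda>x ks. Q x * S x ks) p is =
     Q p * lapc h c \<Phi> S p is + 4 * cX h c X \<Phi> S p is + 2 * real CARD('b) * S p is"
proof -
  let ?D = "\<lambda>a. cd h c \<Phi> a S p is"
  have "cd h c \<Phi> a (cd h c \<Phi> b (\<lambda>x ks. Q x * S x ks)) p is =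
    pd c a (pd c b Q) p * S p is + pd c b Q p * ?D a + pd c a Q p * ?D b + Q p * cd h c \<Phi> a (cd h c \<Phi> b S) p is" for a b
  proof -
    have "cd h c \<Phi> a (cd h c \<Phi> b (\<lambda>x ks. Q x * S x ks)) p is = cd h c \<Phi> a (\<lambda>x ks. pd c b Q x * S x ks + Q x * cd h c \<Phi> b S x ks) p is"
      by (rule cd_cong[OF p l]) (rule cd_mult[OF Q_csm S])
    then show ?thesis
      by (simp add: cd_add[OF tsm_mult[OF csm_pd[OF Q_csm] S] tsm_mult[OF Q_csm tsm_cd[OF S]] p l]
          cd_mult[OF csm_pd[OF Q_csm] S p l] cd_mult[OF Q_csm tsm_cd[OF S] p l])
  qed
  then have c: "covd h c (Dn # \<Phi>) (covd h c \<Phi> (\<lambda>x ks. Q x * S x ks)) p (a # b # is) =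
     2 * g p a b * S p is + pd c b Q p * ?D a + pd c a Q p * ?D b + Q p * covd h c (Dn # \<Phi>) (covd h c \<Phi> S) p (a # b # is)" for a b
    unfolding covd_Cons cd_covd cd_mult[OF Q_csm S p l] hess_Q[OF p, of a b, symmetric]
    by (simp add: distrib_left sum.distrib right_diff_distrib left_diff_distrib sum_distrib_left sum_distrib_right mult_ac)
  have q: "(\<Sum>a\<in>UNIV. \<Sum>b\<in>UNIV. gi p a b * (pd c a Q p * f b)) = 2 * (\<Sum>b\<in>UNIV. X p b * f b)" for f
  proof -
    have "(\<Sum>a\<in>UNIV. \<Sum>b\<in>UNIV. gi p a b * (pd c a Q p * f b)) = (\<Sum>b\<in>UNIV. (\<Sum>a\<in>UNIV. gi p b a * pd c a Q p) * f b)"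
      by (subst sum.swap) (simp add: sum_distrib_right mult.assoc gi_sym[OF p])
    moreover have "(\<Sum>a\<in>UNIV. gi p b a * pd c a Q p) = 2 * X p b" for b
      by (simp add: Q_deriv[OF p] mult.left_commute[of _ 2] sum_mult_assoc gi_g[OF p] flip: sum_distrib_left)
    ultimately show ?thesis by (simp add: sum_distrib_left mult.assoc)
  qed
  have q': "(\<Sum>a\<in>UNIV. \<Sum>b\<in>UNIV. gi p a b * (pd c b Q p * f a)) = 2 * (\<Sum>b\<in>UNIV. X p b * f b)" for f
    using q[of f] by (subst sum.swap) (simp add: gi_sym[OF p])
  have t: "(\<Sum>a\<in>UNIV. \<Sum>b\<in>UNIV. gi p a b * (2 * g p a b * S p is)) = 2 * real CARD('b) * S p is"
  proof -
    have "(\<Sum>a\<in>UNIV. \<Sum>b\<in>UNIV. gi p a b * (2 * g p a b * S p is)) = (\<Sum>a\<in>UNIV. (\<Sum>b\<in>UNIV. gi p a b * g p b a) * (2 * S p is))"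
      unfolding sum_distrib_right by (intro sum.cong refl) (simp add: h_sym[OF p])
    then show ?thesis by (simp add: gi_g[OF p])
  qed
  show ?thesis
    unfolding lapc_def c distrib_left sum.distrib q q' t
    by (simp add: cX_def sum_distrib_left mult_ac)
qed

end

section \<open>Change of charts\<close>

lemma matrix_add_rdistrib:
  fixes A B C :: "real ^ 'n ^ 'n"
  shows "(A + B) ** C = A ** C + B ** C"
  by (simp add: vec_eq_iff matrix_mult_nth distrib_right sum.distrib)

lemma matrix_scaleR_left:
  fixes A B :: "real ^ 'n ^ 'n"
  shows "(r *\<^sub>R A) ** B = r *\<^sub>R (A ** B)"
  by (simp add: vec_eq_iff matrix_mult_nth mult.assoc sum_distrib_left)

lemma matrix_scaleR_right:
  fixes A B :: "real ^ 'n ^ 'n"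
  shows "A ** (r *\<^sub>R B) = r *\<^sub>R (A ** B)"
  by (simp add: vec_eq_iff matrix_mult_nth mult.left_commute sum_distrib_left)

locale chart_metric_pair = chart_pair c d U + MC: chart_metric c U h + MD: chart_metric d U h
  for c d :: "('a::topological_space, 'k::finite) chart" and U and h :: "('a, 'k) tfield" +
  assumes h_law: "\<And>x js. x \<in> U \<Longrightarrow> length js = 2 \<Longrightarrow>
    h x d js = act2 [Dn, Dn] (jac c d x) (jac d c x) (h x c) js"
begin

sublocale dc: chart_pair d c U using chart_pair_axioms chart_pair_sym by blast

abbreviation "J \<equiv> jac c d"
abbreviation "K \<equiv> jac d c"

lemma JK: "p \<in> U \<Longrightarrow> J p ** K p = mat 1" by (rule jac_mult)
lemma KJ: "p \<in> U \<Longrightarrow> K p ** J p = mat 1" by (rule dc.jac_mult)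
lemma KJ_nth: "p \<in> U \<Longrightarrow> (\<Sum>m\<in>UNIV. K p $ i $ m * J p $ m $ j) = kron i j"
  using KJ[of p] by (simp add: vec_eq_iff matrix_mult_nth mat_1_nth)

definition "dJ m p = (\<chi> i j. pd c m (\<lambda>x. J x $ i $ j) p)"

lemma csm_J: "csm c U (\<lambda>x. J x $ i $ j)" by (rule dc.csm_jac)
lemma csm_K: "csm c U (\<lambda>x. K x $ i $ j)" by (rule dc.csm_change[OF csm_jac])

lemma pd_K:
  assumes p: "p \<in> U"
  shows "pd c m (\<lambda>x. K x $ i $ j) p = - (K p ** dJ m p ** K p) $ i $ j"
proof -
  let ?dK = "(\<chi> i j. pd c m (\<lambda>x. K x $ i $ j) p) :: real ^ 'k ^ 'k"
  have "?dK ** J p + K p ** dJ m p = 0"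
  proof -
    have "pd c m (\<lambda>x. \<Sum>k\<in>UNIV. K x $ i $ k * J x $ k $ j) p = 0" for i j
      using C.pd_cong[OF p, of "\<lambda>x. \<Sum>k\<in>UNIV. K x $ i $ k * J x $ k $ j" "\<lambda>x. kron i j" m] by (simp add: KJ_nth)
    then show ?thesis
      using p by (simp add: vec_eq_iff matrix_mult_nth dJ_def C.pd_sum C.pd_mult C.csm_mult csm_J csm_K sum.distrib)
  qed
  then have "?dK ** J p ** K p + K p ** dJ m p ** K p = 0"
    by (simp flip: matrix_add_rdistrib)
  then have "?dK + K p ** dJ m p ** K p = 0"
    using JK[OF p] by (simp flip: matrix_mul_assoc)
  then have "?dK = - (K p ** dJ m p ** K p)" by (simp add: eq_neg_iff_add_eq_0)
  then show ?thesis by (simp add: vec_eq_iff)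
qed

lemma pd_act2:
  assumes S: "tsm c U (length \<Phi>) S" and p: "p \<in> U" and l: "length js = length \<Phi>"
  shows "pd c m (\<lambda>x. act2 \<Phi> (J x) (K x) (S x) js) p =
    sharp \<Phi> (dJ m p ** K p) (act2 \<Phi> (J p) (K p) (S p)) js + act2 \<Phi> (J p) (K p) (\<lambda>ks. pd c m (\<lambda>x. S x ks) p) js"
proof -
  let ?F = "\<lambda>f h. frechet_derivative (\<lambda>y. f (chart_inv c y)) (at (snd c p)) h"
  let ?A' = "\<lambda>h. \<chi> i j. ?F (\<lambda>x. J x $ i $ j) h"
  have A'_lin: "?A' h = (\<Sum>m\<in>UNIV. h $ m *\<^sub>R dJ m p)" for h
    by (simp add: vec_eq_iff dJ_def pd_def linear_vec_expand[OF has_derivative_linear[OF C.csm_has_derivative[OF csm_J p]], of _ _ h])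
  have K': "?F (\<lambda>x. K x $ i $ j) h = - (K p ** ?A' h ** K p) $ i $ j" for i j h
  proof -
    have "?F (\<lambda>x. K x $ i $ j) h = (\<Sum>m\<in>UNIV. h $ m * - (K p ** dJ m p ** K p) $ i $ j)"
      unfolding pd_K[OF p, symmetric]
      by (subst linear_vec_expand[OF has_derivative_linear[OF C.csm_has_derivative[OF csm_K p]]]) (simp add: pd_def)
    also have "\<dots> = - (K p ** (\<Sum>m\<in>UNIV. h $ m *\<^sub>R dJ m p) ** K p) $ i $ j"
    proof -
      have "K p ** (\<Sum>m\<in>I. h $ m *\<^sub>R dJ m p) ** K p = (\<Sum>m\<in>I. h $ m *\<^sub>R (K p ** dJ m p ** K p))" if "finite I" for I
        using that by (induction I) (simp_all add: matrix_add_ldistrib matrix_add_rdistrib matrix_scaleR_left matrix_scaleR_right)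
      then show ?thesis by (simp add: sum_negf)
    qed
    finally show ?thesis unfolding A'_lin .
  qed
  have "((\<lambda>y. act2 \<Phi> (J (chart_inv c y)) (K (chart_inv c y)) (S (chart_inv c y)) js) has_derivative
     (\<lambda>h. sharp \<Phi> (?A' h ** K (chart_inv c (snd c p))) (act2 \<Phi> (J (chart_inv c (snd c p))) (K (chart_inv c (snd c p))) (S (chart_inv c (snd c p)))) js
        + act2 \<Phi> (J (chart_inv c (snd c p))) (K (chart_inv c (snd c p))) (\<lambda>ks. ?F (\<lambda>x. S x ks) h) js)) (at (snd c p))"
  proof (rule act2_has_derivative)
    show "((\<lambda>y. J (chart_inv c y) $ i $ j) has_derivative (\<lambda>h. ?A' h $ i $ j)) (at (snd c p))" for i j
      using C.csm_has_derivative[OF csm_J p, of i j] by simp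
    show "((\<lambda>y. K (chart_inv c y) $ i $ j) has_derivative (\<lambda>h. - (K (chart_inv c (snd c p)) ** ?A' h ** K (chart_inv c (snd c p))) $ i $ j)) (at (snd c p))" for i j
      using C.csm_has_derivative[OF csm_K p, of i j] unfolding K' by (simp add: p)
    show "((\<lambda>y. S (chart_inv c y) ks) has_derivative ?F (\<lambda>x. S x ks)) (at (snd c p))" if "length ks = length \<Phi>" for ks
      by (rule C.csm_has_derivative[OF tsmD[OF S that] p])
  qed (use KJ[OF p] p l in simp_all)
  then show ?thesis
    by (rule C.pd_eqI) (simp add: p dJ_def pd_def)
qed

text \<open>The relation between the components in \<open>c\<close> and in \<open>d\<close> of one
  tensor field over \<open>U\<close>, without reference to the atlas.\<close>

definition law :: "index_pos list \<Rightarrow> ('a \<Rightarrow> 'k list \<Rightarrow> real) \<Rightarrow> ('a \<Rightarrow> 'k list \<Rightarrow> real) \<Rightarrow> bool" where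
  "law \<Phi> S T \<longleftrightarrow> tsm c U (length \<Phi>) S \<and> tsm d U (length \<Phi>) T \<and>
     (\<forall>x\<in>U. \<forall>js. length js = length \<Phi> \<longrightarrow> T x js = act2 \<Phi> (J x) (K x) (S x) js)"

lemma pd_law:
  assumes L: "law \<Phi> S T" and p: "p \<in> U" and l: "length js = length \<Phi>"
  shows "pd d a (\<lambda>x. T x js) p = (\<Sum>m\<in>UNIV. K p $ m $ a * (sharp \<Phi> (dJ m p ** K p) (T p) js
      + act2 \<Phi> (J p) (K p) (\<lambda>ks. pd c m (\<lambda>x. S x ks) p) js))"
proof -
  have S: "tsm c U (length \<Phi>) S" and T: "tsm d U (length \<Phi>) T"
    and e: "\<And>x js. x \<in> U \<Longrightarrow> length js = length \<Phi> \<Longrightarrow> T x js = act2 \<Phi> (J x) (K x) (S x) js"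
    using L by (auto simp: law_def)
  have "pd d a (\<lambda>x. T x js) p = (\<Sum>m\<in>UNIV. pd c m (\<lambda>x. T x js) p * K p $ m $ a)"
    by (rule pd_change[OF dc.csm_change[OF tsmD[OF T l]] p])
  also have "\<dots> = (\<Sum>m\<in>UNIV. K p $ m $ a * pd c m (\<lambda>x. act2 \<Phi> (J x) (K x) (S x) js) p)"
  proof (intro sum.cong refl)
    fix m
    have "pd c m (\<lambda>x. T x js) p = pd c m (\<lambda>x. act2 \<Phi> (J x) (K x) (S x) js) p"
      by (rule C.pd_cong[OF p]) (rule e[OF _ l])
    then show "pd c m (\<lambda>x. T x js) p * K p $ m $ a = K p $ m $ a * pd c m (\<lambda>x. act2 \<Phi> (J x) (K x) (S x) js) p" by simp
  qed
  also have "\<dots> = (\<Sum>m\<in>UNIV. K p $ m $ a * (sharp \<Phi> (dJ m p ** K p) (act2 \<Phi> (J p) (K p) (S p)) js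
      + act2 \<Phi> (J p) (K p) (\<lambda>ks. pd c m (\<lambda>x. S x ks) p) js))"
    unfolding pd_act2[OF S p l] ..
  also have "\<dots> = (\<Sum>m\<in>UNIV. K p $ m $ a * (sharp \<Phi> (dJ m p ** K p) (T p) js
      + act2 \<Phi> (J p) (K p) (\<lambda>ks. pd c m (\<lambda>x. S x ks) p) js))"
  proof (intro sum.cong refl arg_cong2[where f="(*)"] arg_cong2[where f="(+)"] sharp_cong)
    fix ks :: "'k list" assume "length ks = length js"
    then show "act2 \<Phi> (J p) (K p) (S p) ks = T p ks" using e[OF p] l by simp
  qed
  finally show ?thesis .
qed

text \<open>The gauge transformation of the connection matrices, with \<open>K\<close> acting also
  on the direction of differentiation.\<close>

definition "conn' a p = (\<Sum>m\<in>UNIV. K p $ m $ a *\<^sub>R (J p ** conn h c m p ** K p - dJ m p ** K p))"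

lemma law_metric: "law [Dn, Dn] (\<lambda>x. h x c) (\<lambda>x. h x d)"
  unfolding law_def using MC.tsm_metric MD.tsm_metric h_law by (simp add: numeral_2_eq_2)

lemma act2_sharp_law:
  assumes L: "law \<Phi> S T" and p: "p \<in> U" and l: "length js = length \<Phi>"
  shows "act2 \<Phi> (J p) (K p) (sharp \<Phi> M (S p)) js = sharp \<Phi> (J p ** M ** K p) (T p) js"
  unfolding act2_sharp[OF KJ[OF p] l]
  by (rule sharp_cong) (use L p l in \<open>auto simp: law_def\<close>)

text \<open>By \<open>christoffel_unique\<close> in the chart \<open>d\<close>: the candidate is
  symmetric because \<open>dJ\<close> consists of second derivatives of the coordinates of
  \<open>d\<close>, and it is metric because parallelism of \<open>h\<close> in \<open>c\<close> is
  carried over by \<open>pd_law\<close>.\<close>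

lemma conn_transform:
  assumes p: "p \<in> U"
  shows "conn h d a p = conn' a p"
proof -
  have "conn' a p $ i $ b = christoffel h p d i a b" for i a b
  proof (rule MD.christoffel_unique[OF p])
    fix i a b
    have "dJ m p $ i $ n = dJ n p $ i $ m" for m n
    proof -
      have *: "pd c m (\<lambda>x. J x $ i $ n) p = pd c m (pd c n (\<lambda>x. snd d x $ i)) p" for m n
        by (rule C.pd_cong[OF p]) (simp add: dc.jac_pd)
      show ?thesis unfolding dJ_def using C.pd_commute[OF dc.csm_coord p, of m n i] * by simp
    qed
    then have s: "(\<Sum>m\<in>UNIV. \<Sum>n\<in>UNIV. K p $ m $ a * K p $ n $ b * dJ m p $ i $ n) = (\<Sum>m\<in>UNIV. \<Sum>n\<in>UNIV. K p $ m $ b * K p $ n $ a * dJ m p $ i $ n)" for a b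
      by (subst sum.swap) (simp add: mult.commute)
    have s2: "(\<Sum>m\<in>UNIV. \<Sum>n\<in>UNIV. K p $ m $ a * K p $ n $ b * (J p ** conn h c m p) $ i $ n) = (\<Sum>m\<in>UNIV. \<Sum>n\<in>UNIV. K p $ m $ b * K p $ n $ a * (J p ** conn h c m p) $ i $ n)" for a b
      by (subst sum.swap) (simp add: matrix_mult_nth MC.christoffel_sym[OF p] mult.commute[of "K p $ _ $ a"])
    have "conn' a p $ i $ b = (\<Sum>m\<in>UNIV. \<Sum>n\<in>UNIV. K p $ m $ a * K p $ n $ b * (J p ** conn h c m p) $ i $ n)
      - (\<Sum>m\<in>UNIV. \<Sum>n\<in>UNIV. K p $ m $ a * K p $ n $ b * dJ m p $ i $ n)" for a b
      unfolding conn'_def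
      by (simp add: matrix_mult_nth[of _ "K p"] sum_subtractf right_diff_distrib sum_distrib_left mult_ac)
    then show "conn' a p $ i $ b = conn' b p $ i $ a" using s[of a b] s2[of a b] by simp
  next
    fix a b e
    have "pd d a (\<lambda>x. h x d [b, e]) p = (\<Sum>m\<in>UNIV. K p $ m $ a * (sharp [Dn, Dn] (dJ m p ** K p) (h p d) [b, e]
      + act2 [Dn, Dn] (J p) (K p) (\<lambda>ks. pd c m (\<lambda>x. h x c ks) p) [b, e]))"
      by (rule pd_law[OF law_metric p]) simp
    also have "\<dots> = (\<Sum>m\<in>UNIV. K p $ m $ a * (sharp [Dn, Dn] (dJ m p ** K p) (h p d) [b, e]
      - sharp [Dn, Dn] (J p ** conn h c m p ** K p) (h p d) [b, e]))"
    proof -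
      have "act2 [Dn, Dn] (J p) (K p) (\<lambda>ks. pd c m (\<lambda>x. h x c ks) p) [b, e] =
         act2 [Dn, Dn] (J p) (K p) (\<lambda>ks. (-1) * sharp [Dn, Dn] (conn h c m p) (h p c) ks) [b, e]" for m
      proof (rule act2_cong)
        fix ks :: "'k list" assume "length ks = length [Dn, Dn]"
        then show "pd c m (\<lambda>x. h x c ks) p = (-1) * sharp [Dn, Dn] (conn h c m p) (h p c) ks"
          using MC.cd_metric[OF p, of ks m] by (simp add: cd_def)
      qed
      then show ?thesis unfolding act2_scale using act2_sharp_law[OF law_metric p, of "[b, e]"] by simp
    qed
    also have "\<dots> = - sharp [Dn, Dn] (conn' a p) (h p d) [b, e]"
      unfolding conn'_def sharp_sum_left sharp_scale_left sharp_diff_left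
      by (simp add: sum_negf[symmetric] right_diff_distrib)
    also have "\<dots> = (\<Sum>i\<in>UNIV. conn' a p $ i $ b * h p d [i, e]) + (\<Sum>i\<in>UNIV. conn' a p $ i $ e * h p d [b, i])"
      by (simp add: sharp_Cons slot_coeff_def sum_negf)
    finally show "pd d a (\<lambda>x. h x d [b, e]) p = (\<Sum>i\<in>UNIV. conn' a p $ i $ b * h p d [i, e]) + (\<Sum>i\<in>UNIV. conn' a p $ i $ e * h p d [b, i])" .
  qed
  then show ?thesis by (simp add: vec_eq_iff)
qed

text \<open>The inhomogeneous term with \<open>dJ\<close> in \<open>pd_law\<close> is cancelled by
  the one in \<open>conn'\<close>.\<close>

lemma cd_transform:
  assumes L: "law \<Phi> S T" and p: "p \<in> U" and l: "length js = length \<Phi>"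
  shows "cd h d \<Phi> a T p js = (\<Sum>m\<in>UNIV. K p $ m $ a * act2 \<Phi> (J p) (K p) (cd h c \<Phi> m S p) js)"
proof -
  have "act2 \<Phi> (J p) (K p) (cd h c \<Phi> m S p) js =
     act2 \<Phi> (J p) (K p) (\<lambda>ks. pd c m (\<lambda>x. S x ks) p) js + sharp \<Phi> (J p ** conn h c m p ** K p) (T p) js" for m
    unfolding cd_def act2_add using act2_sharp_law[OF L p l] by simp
  then show ?thesis
    unfolding cd_def[of h d] pd_law[OF L p l] conn_transform[OF p] conn'_def sharp_sum_left sharp_scale_left sharp_diff_left
    by (simp add: sum.distrib[symmetric] distrib_left[symmetric] right_diff_distrib[symmetric] del: distrib_left_numeral)
qed

lemma law_covd:
  assumes L: "law \<Phi> S T"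
  shows "law (Dn # \<Phi>) (covd h c \<Phi> S) (covd h d \<Phi> T)"
  unfolding law_def
proof (intro conjI ballI allI impI)
  show "tsm c U (length (Dn # \<Phi>)) (covd h c \<Phi> S)" using L MC.tsm_covd by (simp add: law_def)
  show "tsm d U (length (Dn # \<Phi>)) (covd h d \<Phi> T)" using L MD.tsm_covd by (simp add: law_def)
  fix x and js :: "'k list" assume x: "x \<in> U" and "length js = length (Dn # \<Phi>)"
  then obtain a ks where js: "js = a # ks" "length ks = length \<Phi>" by (cases js) auto
  then show "covd h d \<Phi> T x js = act2 (Dn # \<Phi>) (J x) (K x) (covd h c \<Phi> S x) js"
    using cd_transform[OF L x, of ks a] by (simp add: covd_def act_coeff_def)
qed

lemma gi_transform:
  assumes p: "p \<in> U"
  shows "ginv h p d a b = (\<Sum>m\<in>UNIV. J p $ a $ m * (\<Sum>n\<in>UNIV. ginv h p c m n * J p $ b $ n))"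
proof -
  have G: "gmat h p d = transpose (K p) ** gmat h p c ** K p"
  proof -
    have "h p d [i, j] = (\<Sum>n\<in>UNIV. (\<Sum>m\<in>UNIV. K p $ m $ i * h p c [m, n]) * K p $ n $ j)" for i j
      using h_law[OF p, of "[i, j]"] by (simp add: act_coeff_def sum_mult_assoc mult.commute[of "K p $ _ $ j"])
    then show ?thesis by (simp add: vec_eq_iff gmat_def matrix_mult_nth transpose_def)
  qed
  have "gmat h p d ** (J p ** matrix_inv (gmat h p c) ** transpose (J p)) = mat 1"
  proof -
    have "K p ** J p = mat 1" "transpose (K p) ** transpose (J p) = mat 1"
      using KJ[OF p] JK[OF p] by (simp_all add: matrix_transpose_mul[symmetric])
    moreover have "gmat h p d ** (J p ** matrix_inv (gmat h p c) ** transpose (J p)) =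
       transpose (K p) ** (gmat h p c ** (K p ** J p) ** matrix_inv (gmat h p c)) ** transpose (J p)"
      unfolding G by (simp add: matrix_mul_assoc)
    ultimately show ?thesis by (simp add: invertible_matrix_inv[OF MC.h_det[OF p]])
  qed
  then have "matrix_inv (gmat h p d) = J p ** matrix_inv (gmat h p c) ** transpose (J p)" by (rule matrix_inv_eqI)
  then have "ginv h p d a b = (J p ** (matrix_inv (gmat h p c) ** transpose (J p))) $ a $ b"
    by (simp add: ginv_def matrix_mul_assoc)
  then show ?thesis by (simp add: matrix_mult_nth transpose_def ginv_def)
qed

lemma gi_K:
  assumes p: "p \<in> U"
  shows "(\<Sum>b\<in>UNIV. ginv h p d a b * K p $ n $ b) = (\<Sum>m\<in>UNIV. J p $ a $ m * ginv h p c m n)"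
proof -
  have "(\<Sum>b\<in>UNIV. ginv h p d a b * K p $ n $ b) =
     (\<Sum>b\<in>UNIV. (\<Sum>k\<in>UNIV. (\<Sum>m\<in>UNIV. J p $ a $ m * ginv h p c m k) * J p $ b $ k) * K p $ n $ b)"
    unfolding gi_transform[OF p] sum_mult_assoc ..
  also have "\<dots> = (\<Sum>k\<in>UNIV. (\<Sum>m\<in>UNIV. J p $ a $ m * ginv h p c m k) * (\<Sum>b\<in>UNIV. K p $ n $ b * J p $ b $ k))"
    unfolding sum_mult_assoc[symmetric] by (simp add: sum_distrib_right mult.commute[of "K p $ n $ _"] sum_distrib_left)
  finally show ?thesis by (simp add: KJ_nth[OF p])
qed

lemma law_lapc:
  assumes L: "law \<Phi> S T" and p: "p \<in> U" and l: "length js = length \<Phi>"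
  shows "lapc h d \<Phi> T p js = act2 \<Phi> (J p) (K p) (lapc h c \<Phi> S p) js"
proof -
  let ?W = "\<lambda>m n. act2 \<Phi> (J p) (K p) (\<lambda>is. covd h c (Dn # \<Phi>) (covd h c \<Phi> S) p (m # n # is)) js"
  have "covd h d (Dn # \<Phi>) (covd h d \<Phi> T) p (a # b # js) =
    act2 (Dn # Dn # \<Phi>) (J p) (K p) (covd h c (Dn # \<Phi>) (covd h c \<Phi> S) p) (a # b # js)" for a b
    using law_covd[OF law_covd[OF L]] p l unfolding law_def by simp
  then have W: "covd h d (Dn # \<Phi>) (covd h d \<Phi> T) p (a # b # js) =
     (\<Sum>m\<in>UNIV. K p $ m $ a * (\<Sum>n\<in>UNIV. K p $ n $ b * ?W m n))" for a b
    by (simp add: act_coeff_def)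
  have "lapc h d \<Phi> T p js = (\<Sum>a\<in>UNIV. \<Sum>b\<in>UNIV. ginv h p d a b * (\<Sum>m\<in>UNIV. K p $ m $ a * (\<Sum>n\<in>UNIV. K p $ n $ b * ?W m n)))"
    unfolding lapc_def W ..
  also have "\<dots> = (\<Sum>a\<in>UNIV. \<Sum>m\<in>UNIV. K p $ m $ a * (\<Sum>b\<in>UNIV. ginv h p d a b * (\<Sum>n\<in>UNIV. K p $ n $ b * ?W m n)))"
    unfolding sum_distrib_left
    by (rule sum.cong[OF refl], subst sum.swap) (simp add: mult.left_commute)
  also have "\<dots> = (\<Sum>a\<in>UNIV. \<Sum>m\<in>UNIV. K p $ m $ a * (\<Sum>n\<in>UNIV. (\<Sum>k\<in>UNIV. J p $ a $ k * ginv h p c k n) * ?W m n))"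
    unfolding sum_mult_assoc[of "ginv h p d _"] gi_K[OF p] ..
  also have "\<dots> = (\<Sum>m\<in>UNIV. \<Sum>a\<in>UNIV. K p $ m $ a * (\<Sum>k\<in>UNIV. J p $ a $ k * (\<Sum>n\<in>UNIV. ginv h p c k n * ?W m n)))"
  proof -
    have A: "(\<Sum>n\<in>UNIV. (\<Sum>k\<in>UNIV. J p $ a $ k * ginv h p c k n) * ?W m n) = (\<Sum>k\<in>UNIV. J p $ a $ k * (\<Sum>n\<in>UNIV. ginv h p c k n * ?W m n))" for a m
      by (rule sum_mult_assoc[symmetric])
    show ?thesis unfolding A by (rule sum.swap)
  qed
  also have "\<dots> = (\<Sum>m\<in>UNIV. \<Sum>n\<in>UNIV. ginv h p c m n * ?W m n)"
  proof (rule sum.cong[OF refl])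
    fix m
    show "(\<Sum>a\<in>UNIV. K p $ m $ a * (\<Sum>k\<in>UNIV. J p $ a $ k * (\<Sum>n\<in>UNIV. ginv h p c k n * ?W m n))) = (\<Sum>n\<in>UNIV. ginv h p c m n * ?W m n)"
      by (subst sum_mult_assoc) (simp add: KJ_nth[OF p])
  qed
  also have "\<dots> = act2 \<Phi> (J p) (K p) (lapc h c \<Phi> S p) js"
    unfolding lapc_def by (simp add: act2_sum act2_scale)
  finally show ?thesis .
qed

text \<open>Derived from the tensoriality of second covariant derivatives and not from the formula
  in \<open>riemann_def\<close>: their skew part is the curvature, and \<open>law_covd\<close>,
  applied twice, transforms them.\<close>

lemma curv_transform:
  assumes p: "p \<in> U"
  shows "curv h d a b p = (\<Sum>m\<in>UNIV. \<Sum>n\<in>UNIV. (K p $ m $ a * K p $ n $ b) *\<^sub>R (J p ** curv h c m n p ** K p))"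
    (is "_ = ?R")
proof -
  have comm: "covd h c (Dn # \<Phi>) (covd h c \<Phi> S) p (a # b # is) - covd h c (Dn # \<Phi>) (covd h c \<Phi> S) p (b # a # is) = sharp \<Phi> (curv h c a b p) (S p) is"
    if "tsm c U (length \<Phi>) S" "length is = length \<Phi>" "chart_metric c U h" for \<Phi> S "is" a b c
  proof -
    interpret M: chart_metric c U h by fact
    show ?thesis unfolding M.covd_Cons M.cd_covd using M.cd_commutator[OF that(1) p that(2)] M.christoffel_sym[OF p] by simp
  qed
  have "(curv h d a b p ** J p) $ i $ j = (\<Sum>m\<in>UNIV. \<Sum>n\<in>UNIV. K p $ m $ a * (K p $ n $ b * (J p ** curv h c m n p) $ i $ j))" for i j
  proof -
    \<comment> \<open>The \<open>j\<close>-th coordinate field of \<open>c\<close>, and its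
      components in \<open>d\<close>, which form a column of the Jacobian.\<close>
    let ?S = "\<lambda>(x::'a) ks. kron (hd ks) j" and ?T = "\<lambda>(x::'a) ks. J x $ hd ks $ j"
    have L: "law [Up] ?S ?T"
      unfolding law_def tsm_def by (auto simp: csm_jac[of] act_coeff_def length_Suc_conv intro!: dc.chart_pair_axioms csm_change csm_J)
    then have S: "tsm c U (length [Up]) ?S" and T: "tsm d U (length [Up]) ?T" by (auto simp: law_def)
    let ?Wd = "covd h d [Dn, Up] (covd h d [Up] ?T) p" and ?Wc = "covd h c [Dn, Up] (covd h c [Up] ?S) p"
    have W: "?Wd [a, b, i] = (\<Sum>m\<in>UNIV. K p $ m $ a * (\<Sum>n\<in>UNIV. K p $ n $ b * (\<Sum>k\<in>UNIV. J p $ i $ k * ?Wc [m, n, k])))" for a b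
      using law_covd[OF law_covd[OF L]] p unfolding law_def by (simp add: act_coeff_def)
    have "(curv h d a b p ** J p) $ i $ j = ?Wd [a, b, i] - ?Wd [b, a, i]"
      using comm[OF T, of "[i]" a b] MD.chart_metric_axioms by (simp add: matrix_mult_nth sharp_Cons slot_coeff_def)
    also have "\<dots> = (\<Sum>m\<in>UNIV. \<Sum>n\<in>UNIV. K p $ m $ a * (K p $ n $ b * (\<Sum>k\<in>UNIV. J p $ i $ k * (?Wc [m, n, k] - ?Wc [n, m, k]))))"
    proof -
      have "?Wd [b, a, i] = (\<Sum>m\<in>UNIV. \<Sum>n\<in>UNIV. K p $ m $ a * (K p $ n $ b * (\<Sum>k\<in>UNIV. J p $ i $ k * ?Wc [n, m, k])))"
        unfolding W[of b a] sum_distrib_left[of "K p $ _ $ b"] by (subst sum.swap) (simp add: mult.left_commute[of "K p $ _ $ b" "K p $ _ $ a"] sum_distrib_left)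
      then show ?thesis unfolding W[of a b]
        by (simp add: sum_distrib_left[of "K p $ _ $ a"] sum_subtractf[symmetric] right_diff_distrib[symmetric])
    qed
    also have "\<dots> = (\<Sum>m\<in>UNIV. \<Sum>n\<in>UNIV. K p $ m $ a * (K p $ n $ b * (J p ** curv h c m n p) $ i $ j))"
    proof -
      have "?Wc [m, n, k] - ?Wc [n, m, k] = riemann h p c m n k j" for m n k
        using comm[OF S, of "[k]" m n] MC.chart_metric_axioms by (simp add: MC.sharp_basis)
      then show ?thesis by (simp add: matrix_mult_nth)
    qed
    finally show ?thesis .
  qed
  then have "curv h d a b p ** J p = (\<Sum>m\<in>UNIV. \<Sum>n\<in>UNIV. (K p $ m $ a * K p $ n $ b) *\<^sub>R (J p ** curv h c m n p))"
    by (simp add: vec_eq_iff mult.assoc)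
  note A = this
  have M: "(\<Sum>x\<in>I. F x) ** K p = (\<Sum>x\<in>I. F x ** K p)" if "finite I" for I and F :: "'k \<Rightarrow> real ^ 'k ^ 'k"
    using that by (induction I) (simp_all add: matrix_add_rdistrib)
  have "curv h d a b p = curv h d a b p ** (J p ** K p)" by (simp add: JK[OF p])
  also have "\<dots> = (\<Sum>m\<in>UNIV. \<Sum>n\<in>UNIV. (K p $ m $ a * K p $ n $ b) *\<^sub>R (J p ** curv h c m n p)) ** K p"
    by (simp only: matrix_mul_assoc A)
  also have "\<dots> = ?R"
    by (simp only: M[OF finite_class.finite_UNIV] matrix_scaleR_left)
  finally show ?thesis .
qed

lemma law_curvc:
  assumes L: "law \<Phi> S T" and p: "p \<in> U" and l: "length js = length \<Phi>"
  shows "curvc h d \<Phi> T p js = act2 \<Phi> (J p) (K p) (curvc h c \<Phi> S p) js"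
proof -
  let ?E = "\<lambda>c f b. (\<chi> i j. ginv h p c i f * kron j b) :: real ^ 'k ^ 'k"
  let ?Q = "\<lambda>m n. sharp \<Phi> (J p ** curv h c m n p ** K p) (T p)"
  \<comment> \<open>The outer endomorphisms transform by conjugation once \<open>K\<close> is
    contracted with their labels; this absorbs the factors \<open>K\<close> produced by
    \<open>curv_transform\<close>.\<close>
  have E: "(\<Sum>f\<in>UNIV. \<Sum>b\<in>UNIV. (K p $ m $ f * K p $ n $ b) *\<^sub>R ?E d f b) = J p ** ?E c m n ** K p" for m n
  proof -
    have "(\<Sum>f\<in>UNIV. \<Sum>b\<in>UNIV. (K p $ m $ f * K p $ n $ b) * (ginv h p d i f * kron j b)) = (J p ** ?E c m n ** K p) $ i $ j" for i j
    proof -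
      have "(\<Sum>f\<in>UNIV. \<Sum>b\<in>UNIV. (K p $ m $ f * K p $ n $ b) * (ginv h p d i f * kron j b)) =
         (\<Sum>f\<in>UNIV. (ginv h p d i f * K p $ m $ f) * (\<Sum>b\<in>UNIV. K p $ n $ b * kron j b))"
        unfolding sum_distrib_left by (intro sum.cong refl) (simp add: mult_ac)
      also have "\<dots> = (\<Sum>e\<in>UNIV. J p $ i $ e * ginv h p c e m) * K p $ n $ j"
        unfolding sum_kron sum_distrib_right[symmetric] gi_K[OF p] ..
      also have "\<dots> = (J p ** ?E c m n ** K p) $ i $ j"
        by (simp add: matrix_mult_nth mult.assoc[symmetric] sum_distrib_right[symmetric])
          (simp add: mult.assoc flip: sum_distrib_left sum_distrib_right)
      finally show ?thesis .
    qed
    then show ?thesis by (simp add: vec_eq_iff)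
  qed
  have "curvc h d \<Phi> T p js = (\<Sum>f\<in>UNIV. \<Sum>b\<in>UNIV. \<Sum>m\<in>UNIV. \<Sum>n\<in>UNIV. (K p $ m $ f * K p $ n $ b) * sharp \<Phi> (?E d f b) (?Q m n) js)"
  proof -
    have A: "sharp \<Phi> (\<Sum>m\<in>UNIV. \<Sum>n\<in>UNIV. (K p $ m $ f * K p $ n $ b) *\<^sub>R (J p ** curv h c m n p ** K p)) (T p) =
        (\<lambda>ks. \<Sum>m\<in>UNIV. \<Sum>n\<in>UNIV. (K p $ m $ f * K p $ n $ b) * ?Q m n ks)" for f b
      by (rule ext) (simp only: sharp_sum_left sharp_scale_left)
    show ?thesis unfolding curvc_def curv_transform[OF p] A sharp_sum_right sharp_scale_right ..
  qed
  also have "\<dots> = (\<Sum>m\<in>UNIV. \<Sum>n\<in>UNIV. \<Sum>f\<in>UNIV. \<Sum>b\<in>UNIV. (K p $ m $ f * K p $ n $ b) * sharp \<Phi> (?E d f b) (?Q m n) js)"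
  proof -
    have 4: "(\<Sum>f\<in>UNIV. \<Sum>b\<in>UNIV. \<Sum>m\<in>UNIV. \<Sum>n\<in>UNIV. F f b m n) = (\<Sum>m\<in>UNIV. \<Sum>n\<in>UNIV. \<Sum>f\<in>UNIV. \<Sum>b\<in>UNIV. F f b m n)"
      for F :: "'k \<Rightarrow> 'k \<Rightarrow> 'k \<Rightarrow> 'k \<Rightarrow> real"
    proof -
      have "(\<Sum>f\<in>UNIV. \<Sum>b\<in>UNIV. \<Sum>m\<in>UNIV. \<Sum>n\<in>UNIV. F f b m n) = (\<Sum>f\<in>UNIV. \<Sum>m\<in>UNIV. \<Sum>b\<in>UNIV. \<Sum>n\<in>UNIV. F f b m n)"
        by (rule sum.cong[OF refl], rule sum.swap)
      also have "\<dots> = (\<Sum>m\<in>UNIV. \<Sum>f\<in>UNIV. \<Sum>b\<in>UNIV. \<Sum>n\<in>UNIV. F f b m n)" by (rule sum.swap)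
      also have "\<dots> = (\<Sum>m\<in>UNIV. \<Sum>f\<in>UNIV. \<Sum>n\<in>UNIV. \<Sum>b\<in>UNIV. F f b m n)"
        by (rule sum.cong[OF refl], rule sum.cong[OF refl], rule sum.swap)
      also have "\<dots> = (\<Sum>m\<in>UNIV. \<Sum>n\<in>UNIV. \<Sum>f\<in>UNIV. \<Sum>b\<in>UNIV. F f b m n)"
        by (rule sum.cong[OF refl], rule sum.swap)
      finally show ?thesis .
    qed
    show ?thesis by (rule 4)
  qed
  also have "\<dots> = (\<Sum>m\<in>UNIV. \<Sum>n\<in>UNIV. sharp \<Phi> (J p ** ?E c m n ** K p) (?Q m n) js)"
    unfolding E[symmetric] sharp_sum_left sharp_scale_left ..
  also have "\<dots> = (\<Sum>m\<in>UNIV. \<Sum>n\<in>UNIV. act2 \<Phi> (J p) (K p) (sharp \<Phi> (?E c m n) (sharp \<Phi> (curv h c m n p) (S p))) js)"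
  proof (intro sum.cong refl)
    fix m n
    have "sharp \<Phi> (J p ** ?E c m n ** K p) (?Q m n) js =
       sharp \<Phi> (J p ** ?E c m n ** K p) (act2 \<Phi> (J p) (K p) (sharp \<Phi> (curv h c m n p) (S p))) js"
      by (rule sharp_cong) (use l in \<open>simp add: act2_sharp_law[OF L p]\<close>)
    then show "sharp \<Phi> (J p ** ?E c m n ** K p) (?Q m n) js = act2 \<Phi> (J p) (K p) (sharp \<Phi> (?E c m n) (sharp \<Phi> (curv h c m n p) (S p))) js"
      using act2_sharp[OF KJ[OF p] l] by simp
  qed
  also have "\<dots> = act2 \<Phi> (J p) (K p) (curvc h c \<Phi> S p) js"
    unfolding curvc_def by (simp add: act2_sum)
  finally show ?thesis .
qed

end

section \<open>Tensor fields and weights\<close>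

text \<open>If \<open>v + w\<close> is in the kernel, pairing with \<open>v\<close> and with
  \<open>w\<close> and the symmetry of \<open>G\<close> give
  \<open>v \<bullet> (G *v v) = w \<bullet> (G *v w)\<close>; the left side is positive unless
  \<open>v = 0\<close>, the right side negative unless \<open>w = 0\<close>.\<close>

lemma has_signature_nondegenerate:
  assumes "has_signature G p q"
  shows "transpose G = G" "det G \<noteq> 0"
proof -
  show t: "transpose G = G" using assms by (simp add: has_signature_def)
  obtain V W where VW: "\<And>x. \<exists>v\<in>V. \<exists>w\<in>W. x = v + w" "\<And>v. v \<in> V - {0} \<Longrightarrow> v \<bullet> (G *v v) > 0" "\<And>w. w \<in> W - {0} \<Longrightarrow> w \<bullet> (G *v w) < 0"
    using assms unfolding has_signature_def by blast
  have sym: "x \<bullet> (G *v y) = y \<bullet> (G *v x)" for x y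
    using dot_lmul_matrix[of x G y] t by (metis inner_commute transpose_matrix_vector)
  have "x = 0" if "G *v x = 0" for x
  proof -
    obtain v w where vw: "v \<in> V" "w \<in> W" "x = v + w" using VW(1) by blast
    have "v \<bullet> (G *v (v + w)) = 0" "w \<bullet> (G *v (v + w)) = 0" using that vw by simp_all
    then have "v \<bullet> (G *v v) = w \<bullet> (G *v w)"
      using sym[of v w] by (simp add: matrix_vector_right_distrib inner_add_right)
    moreover have "v \<bullet> (G *v v) \<ge> 0" using VW(2)[of v] vw by (cases "v = 0") auto
    moreover have "w \<bullet> (G *v w) \<le> 0" using VW(3)[of w] vw by (cases "w = 0") auto
    ultimately have "v = 0" "w = 0" using VW(2)[of v] VW(3)[of w] vw by fastforce+
    then show ?thesis using vw by simp
  qed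
  then have "invertible G"
    by (metis invertible_left_inverse matrix_left_invertible_ker)
  then show "det G \<noteq> 0" using invertible_det_nz by blast
qed

lemma smooth_atlas_cover: "smooth_atlas B \<Longrightarrow> \<exists>c\<in>B. p \<in> fst c"
proof -
  assume "smooth_atlas B"
  then have "p \<in> \<Union>(fst ` B)" unfolding smooth_atlas_def by (metis UNIV_I)
  then show ?thesis by auto
qed

lemma (in chart_metric) lapc_lin:
  assumes "tsm c U (length \<Phi>) S" "tsm c U (length \<Phi>) T" "p \<in> U" "length is = length \<Phi>"
  shows "lapc h c \<Phi> (\<lambda>x ks. a * S x ks + b * T x ks) p is = a * lapc h c \<Phi> S p is + b * lapc h c \<Phi> T p is"
proof -
  have cl: "covd h c \<Phi> (\<lambda>x ks. a * S x ks + b * T x ks) x (i # ks) = a * covd h c \<Phi> S x (i # ks) + b * covd h c \<Phi> T x (i # ks)"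
    if "tsm c U (length \<Phi>) S" "tsm c U (length \<Phi>) T" "x \<in> U" "length ks = length \<Phi>" for \<Phi> S T x i ks
    unfolding covd_Cons using that
    by (simp add: cd_add[OF tsm_mult[OF csm_const that(1)] tsm_mult[OF csm_const that(2)]] cd_mult[OF csm_const])
  have t: "tsm c U (length (Dn # \<Phi>)) (covd h c \<Phi> S)" "tsm c U (length (Dn # \<Phi>)) (covd h c \<Phi> T)"
    using assms tsm_covd by simp_all
  have "covd h c (Dn # \<Phi>) (covd h c \<Phi> (\<lambda>x ks. a * S x ks + b * T x ks)) p (i # j # is) =
    a * covd h c (Dn # \<Phi>) (covd h c \<Phi> S) p (i # j # is) + b * covd h c (Dn # \<Phi>) (covd h c \<Phi> T) p (i # j # is)" for i j
  proof -
    have "covd h c (Dn # \<Phi>) (covd h c \<Phi> (\<lambda>x ks. a * S x ks + b * T x ks)) p (i # j # is) =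
      covd h c (Dn # \<Phi>) (\<lambda>x ks. a * covd h c \<Phi> S x ks + b * covd h c \<Phi> T x ks) p (i # j # is)"
      unfolding covd_Cons
      by (rule cd_cong[OF assms(3), of _ "Suc (length \<Phi>)"]) (use assms in \<open>auto simp: length_Suc_conv cl\<close>)
    then show ?thesis using cl[OF t assms(3), of "j # is" i] assms(4) by simp
  qed
  then show ?thesis unfolding lapc_def by (simp add: distrib_left sum.distrib sum_distrib_left mult.left_commute)
qed

lemma curvc_lin: "curvc h c \<Phi> (\<lambda>x ks. f x * S x ks + g x * T x ks) p is = f p * curvc h c \<Phi> S p is + g p * curvc h c \<Phi> T p is"
proof -
  have "sharp \<Phi> M (\<lambda>ks. f p * S p ks + g p * T p ks) = (\<lambda>ks. f p * sharp \<Phi> M (S p) ks + g p * sharp \<Phi> M (T p) ks)" for M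
    by (simp add: fun_eq_iff sharp_add_right sharp_scale_right)
  then show ?thesis
    unfolding curvc_def by (simp add: sharp_add_right sharp_scale_right sum.distrib sum_distrib_left)
qed

lemma curvc_cong:
  assumes "\<And>ks. length ks = length \<Phi> \<Longrightarrow> S p ks = T p ks" "length is = length \<Phi>"
  shows "curvc h c \<Phi> S p is = curvc h c \<Phi> T p is"
  unfolding curvc_def using assms by (intro sum.cong refl sharp_cong) auto

section \<open>The operator on global tensor fields\<close>

locale metric_manifold =
  fixes B :: "('a::{t2_space, second_countable_topology}, 'k::finite) chart set" and h :: "('a, 'k) tfield"
  assumes atlas: "smooth_atlas B"
    and h_field: "h \<in> tensor_field B [Dn, Dn]"
    and nondegenerate: "\<And>c x. c \<in> B \<Longrightarrow> x \<in> fst c \<Longrightarrow> transpose (gmat h x c) = gmat h x c \<and> det (gmat h x c) \<noteq> 0"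
begin

lemma domain: "c \<in> B \<Longrightarrow> chart_domain c (fst c)"
  using smooth_atlas_chart_domain[OF atlas] smooth_atlas_open[OF atlas] by blast

lemma pair: "c \<in> B \<Longrightarrow> d \<in> B \<Longrightarrow> chart_pair c d (fst c \<inter> fst d)"
  using smooth_atlas_chart_pair[OF atlas] smooth_atlas_open[OF atlas] by (metis Int_lower1 Int_lower2 open_Int)

lemma field_law:
  assumes "S \<in> tensor_field B \<Phi>" "c \<in> B" "d \<in> B" "x \<in> fst c" "x \<in> fst d" "length js = length \<Phi>"
  shows "S x d js = act2 \<Phi> (jac c d x) (jac d c x) (S x c) js"
proof -
  have "S x d = tensor_act \<Phi> (jac c d x) (S x c)"
    using assms unfolding tensor_field_def tensor_space_def by blast
  then show ?thesis
    using tensor_act_eq_act2[OF assms(6)] chart_pair.jac_inv[OF pair[OF assms(2,3)]] assms by simp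
qed

lemma field_zero:
  assumes "S \<in> tensor_field B \<Phi>" "\<not> (c \<in> B \<and> x \<in> fst c \<and> length is = length \<Phi>)"
  shows "S x c is = 0"
proof -
  have "S x \<in> tensor_space B \<Phi> x" using assms(1) by (auto simp: tensor_field_def)
  then have "\<not> (c \<in> B \<and> x \<in> fst c) \<longrightarrow> S x c = (\<lambda>_. 0)" "length is \<noteq> length \<Phi> \<longrightarrow> S x c is = 0"
    unfolding tensor_space_def by blast+
  then show ?thesis using assms(2) by auto
qed

lemma field_tsm: "S \<in> tensor_field B \<Phi> \<Longrightarrow> c \<in> B \<Longrightarrow> tsm c (fst c) (length \<Phi>) (\<lambda>x. S x c)"
  by (auto simp: tensor_field_def tsm_def csm_def)

lemma field_eqI:
  assumes "S \<in> tensor_field B \<Phi>" "T \<in> tensor_field B \<Phi>"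
    "\<And>c x is. c \<in> B \<Longrightarrow> x \<in> fst c \<Longrightarrow> length is = length \<Phi> \<Longrightarrow> S x c is = T x c is"
  shows "S = T"
proof (intro ext)
  fix x c "is" show "S x c is = T x c is"
    using assms field_zero[OF assms(1)] field_zero[OF assms(2)] by metis
qed

lemma fieldI:
  assumes z: "\<And>c x is. \<not> (c \<in> B \<and> x \<in> fst c \<and> length is = length \<Phi>) \<Longrightarrow> F x c is = 0"
    and t: "\<And>c. c \<in> B \<Longrightarrow> tsm c (fst c) (length \<Phi>) (\<lambda>x. F x c)"
    and law: "\<And>c d x js. c \<in> B \<Longrightarrow> d \<in> B \<Longrightarrow> x \<in> fst c \<Longrightarrow> x \<in> fst d \<Longrightarrow> length js = length \<Phi> \<Longrightarrow>
      F x d js = act2 \<Phi> (jac c d x) (jac d c x) (F x c) js"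
  shows "F \<in> tensor_field B \<Phi>"
  unfolding tensor_field_def
proof (intro CollectI conjI allI ballI)
  fix p
  show "F p \<in> tensor_space B \<Phi> p"
    unfolding tensor_space_def
  proof (intro CollectI conjI allI ballI impI)
    fix c d assume cd: "c \<in> B" "d \<in> B" "p \<in> fst c \<and> p \<in> fst d"
    show "F p d = tensor_act \<Phi> (jac c d p) (F p c)"
    proof
      fix js show "F p d js = tensor_act \<Phi> (jac c d p) (F p c) js"
      proof (cases "length js = length \<Phi>")
        case True
        then show ?thesis
          using tensor_act_eq_act2[OF True] law[of c d p js] cd chart_pair.jac_inv[OF pair[OF cd(1,2)]] by simp
      qed (use z in \<open>simp add: tensor_act_def\<close>)
    qed
  qed (use z in auto)
next
  fix c "is" assume c: "c \<in> B"
  show "smooth_on (snd c ` fst c) (\<lambda>y. F (chart_inv c y) c is)"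
  proof (cases "length is = length \<Phi>")
    case True
    then show ?thesis using tsmD[OF t[OF c] True] by (simp add: csm_def)
  qed (simp add: z smooth_on_const)
qed

lemma h_pair_sym: "c \<in> B \<Longrightarrow> x \<in> fst c \<Longrightarrow> h x c [a, b] = h x c [b, a]"
  using nondegenerate[of c x] by (auto simp: gmat_def transpose_def vec_eq_iff)

lemma metric:
  assumes "c \<in> B" "open U" "U \<subseteq> fst c"
  shows "chart_metric c U h"
proof -
  interpret chart_domain c U using smooth_atlas_chart_domain[OF atlas] assms by blast
  show ?thesis
  proof
    show "csm c U (\<lambda>x. h x c [a, b])" for a b
      using csm_subset[OF tsmD[OF field_tsm[OF h_field assms(1)]] assms(3)] by simp
    show "h p c [a, b] = h p c [b, a]" if "p \<in> U" for p a b
      by (rule h_pair_sym) (use that assms in auto)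
    show "det (gmat h p c) \<noteq> 0" if "p \<in> U" for p using nondegenerate[OF assms(1)] that assms by auto
  qed
qed

lemma metric_fst: "c \<in> B \<Longrightarrow> chart_metric c (fst c) h"
  using metric smooth_atlas_open[OF atlas] by blast

lemma metric_pair: 
  assumes "c \<in> B" "d \<in> B"
  shows "chart_metric_pair c d (fst c \<inter> fst d) h"
proof -
  have o: "open (fst c \<inter> fst d)" using assms smooth_atlas_open[OF atlas] by blast
  interpret chart_pair c d "fst c \<inter> fst d" using pair assms by blast
  interpret c: chart_metric c "fst c \<inter> fst d" h by (rule metric) (use assms o in auto)
  interpret d: chart_metric d "fst c \<inter> fst d" h by (rule metric) (use assms o in auto)
  show ?thesis
    by unfold_locales (use field_law[OF h_field assms] in \<open>auto simp: numeral_2_eq_2\<close>)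
qed

lemma field_pair_law:
  assumes "S \<in> tensor_field B \<Phi>" "c \<in> B" "d \<in> B"
  shows "chart_metric_pair.law c d (fst c \<inter> fst d) \<Phi> (\<lambda>x. S x c) (\<lambda>x. S x d)"
proof -
  interpret chart_metric_pair c d "fst c \<inter> fst d" h using metric_pair assms by blast
  have "tsm c (fst c \<inter> fst d) (length \<Phi>) (\<lambda>x. S x c)" "tsm d (fst c \<inter> fst d) (length \<Phi>) (\<lambda>x. S x d)"
    using field_tsm[OF assms(1)] assms csm_subset unfolding tsm_def by (meson Int_lower1 Int_lower2)+
  then show ?thesis unfolding law_def using field_law[OF assms] by auto
qed

lemma cov_deriv_eq:
  assumes c: "c \<in> B" "p \<in> fst c" "length is = Suc (length \<Phi>)"
  shows "cov_deriv B h \<Phi> S p c is = covd h c \<Phi> (\<lambda>x. S x c) p is"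
  using assms by (simp add: cov_deriv_def on_charts_def covd_def cd_def conn_def)

lemma laplacian_eq:
  assumes c: "c \<in> B" "p \<in> fst c" "length is = length \<Phi>"
  shows "laplacian B h \<Phi> S p c is = lapc h c \<Phi> (\<lambda>x. S x c) p is"
proof -
  interpret chart_metric c "fst c" h using metric_fst c by blast
  have "cov_deriv B h (Dn # \<Phi>) (cov_deriv B h \<Phi> S) p c (a # b # is) =
      covd h c (Dn # \<Phi>) (covd h c \<Phi> (\<lambda>x. S x c)) p (a # b # is)" for a b
  proof -
    have "cov_deriv B h (Dn # \<Phi>) (cov_deriv B h \<Phi> S) p c (a # b # is) = covd h c (Dn # \<Phi>) (\<lambda>x. cov_deriv B h \<Phi> S x c) p (a # b # is)"
      by (rule cov_deriv_eq) (use c in auto)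
    also have "\<dots> = covd h c (Dn # \<Phi>) (covd h c \<Phi> (\<lambda>x. S x c)) p (a # b # is)"
      unfolding covd_Cons by (rule cd_cong[OF c(2)]) (use c in \<open>auto simp: cov_deriv_eq\<close>)
    finally show ?thesis .
  qed
  then show ?thesis using c by (simp add: laplacian_def on_charts_def lapc_def)
qed

text \<open>\<open>sharp\<close> is linear in the endomorphism, so the sums over \<open>e\<close>,
  \<open>d\<close> and over \<open>a\<close> collapse by the expansion of an endomorphism in matrix
  units.\<close>

lemma curv_sharp_sharp_eq:
  assumes c: "c \<in> B" "p \<in> fst c" "length is = length \<Phi>"
  shows "curv_sharp_sharp B h \<Phi> S p c is = curvc h c \<Phi> (\<lambda>x. S x c) p is"
proof -
  have mu: "(\<Sum>a\<in>UNIV. \<Sum>b\<in>UNIV. M $ a $ b *\<^sub>R matrix_unit a b) = M" for M :: "real ^ 'k ^ 'k"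
  proof -
    have "(\<Sum>a\<in>UNIV. \<Sum>b\<in>UNIV. M $ a $ b * (if i = a \<and> j = b then 1 else 0)) = M $ i $ j" for i j
    proof -
      have "(\<Sum>a\<in>UNIV. \<Sum>b\<in>UNIV. M $ a $ b * (if i = a \<and> j = b then 1 else 0)) = (\<Sum>a\<in>UNIV. kron i a * (\<Sum>b\<in>UNIV. M $ a $ b * kron j b))"
        by (auto simp: kron_def sum_distrib_left intro!: sum.cong)
      then show ?thesis by simp
    qed
    then show ?thesis by (simp add: vec_eq_iff matrix_unit_def)
  qed
  have E: "(\<Sum>a\<in>UNIV. ginv h p c a f *\<^sub>R matrix_unit a b) = (\<chi> i j. ginv h p c i f * kron j b)" for f b
  proof -
    have "(\<Sum>a\<in>UNIV. ginv h p c a f * (if i = a \<and> j = b then 1 else 0)) = ginv h p c i f * kron j b" for i j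
    proof -
      have "(\<Sum>a\<in>UNIV. ginv h p c a f * (if i = a \<and> j = b then 1 else 0)) = (\<Sum>a\<in>UNIV. kron i a * (ginv h p c a f * kron j b))"
        by (auto simp: kron_def intro!: sum.cong)
      then show ?thesis by simp
    qed
    then show ?thesis by (simp add: vec_eq_iff matrix_unit_def)
  qed
  let ?S = "S p c"
  let ?X = "\<lambda>a b e d. sharp \<Phi> (matrix_unit a b) (sharp \<Phi> (matrix_unit e d) ?S) is"
  have "curv_sharp_sharp B h \<Phi> S p c is = (\<Sum>a\<in>UNIV. \<Sum>b\<in>UNIV. \<Sum>e\<in>UNIV. \<Sum>d\<in>UNIV. \<Sum>f\<in>UNIV. ginv h p c a f * riemann h p c f b e d * ?X a b e d)"
    using c by (simp add: curv_sharp_sharp_def on_charts_def sum_distrib_right)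
  also have "\<dots> = (\<Sum>a\<in>UNIV. \<Sum>b\<in>UNIV. \<Sum>e\<in>UNIV. \<Sum>f\<in>UNIV. \<Sum>d\<in>UNIV. ginv h p c a f * riemann h p c f b e d * ?X a b e d)"
    by (rule sum.cong[OF refl], rule sum.cong[OF refl], rule sum.cong[OF refl], rule sum.swap)
  also have "\<dots> = (\<Sum>a\<in>UNIV. \<Sum>b\<in>UNIV. \<Sum>f\<in>UNIV. \<Sum>e\<in>UNIV. \<Sum>d\<in>UNIV. ginv h p c a f * riemann h p c f b e d * ?X a b e d)"
    by (rule sum.cong[OF refl], rule sum.cong[OF refl], rule sum.swap)
  also have "\<dots> = (\<Sum>a\<in>UNIV. \<Sum>b\<in>UNIV. \<Sum>f\<in>UNIV. ginv h p c a f * sharp \<Phi> (matrix_unit a b) (sharp \<Phi> (curv h c f b p) ?S) is)"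
  proof -
    have "sharp \<Phi> (matrix_unit a b) (sharp \<Phi> (curv h c f b p) ?S) is = (\<Sum>e\<in>UNIV. \<Sum>d\<in>UNIV. riemann h p c f b e d * ?X a b e d)" for a b f
    proof -
      have "sharp \<Phi> (curv h c f b p) ?S = (\<lambda>ks. \<Sum>e\<in>UNIV. \<Sum>d\<in>UNIV. riemann h p c f b e d * sharp \<Phi> (matrix_unit e d) ?S ks)"
      proof
        fix ks
        have "sharp \<Phi> (curv h c f b p) ?S ks = sharp \<Phi> (\<Sum>e\<in>UNIV. \<Sum>d\<in>UNIV. curv h c f b p $ e $ d *\<^sub>R matrix_unit e d) ?S ks"
          by (simp only: mu)
        also have "\<dots> = (\<Sum>e\<in>UNIV. \<Sum>d\<in>UNIV. curv h c f b p $ e $ d * sharp \<Phi> (matrix_unit e d) ?S ks)"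
          by (simp only: sharp_sum_left sharp_scale_left)
        finally show "sharp \<Phi> (curv h c f b p) ?S ks = (\<Sum>e\<in>UNIV. \<Sum>d\<in>UNIV. riemann h p c f b e d * sharp \<Phi> (matrix_unit e d) ?S ks)"
          by (simp add: curv_def)
      qed
      then show ?thesis by (simp only: sharp_sum_right sharp_scale_right)
    qed
    then show ?thesis by (simp add: sum_distrib_left mult.assoc)
  qed
  also have "\<dots> = (\<Sum>b\<in>UNIV. \<Sum>f\<in>UNIV. \<Sum>a\<in>UNIV. ginv h p c a f * sharp \<Phi> (matrix_unit a b) (sharp \<Phi> (curv h c f b p) ?S) is)"
    by (subst sum.swap, rule sum.cong[OF refl], rule sum.swap)
  also have "\<dots> = (\<Sum>f\<in>UNIV. \<Sum>b\<in>UNIV. \<Sum>a\<in>UNIV. ginv h p c a f * sharp \<Phi> (matrix_unit a b) (sharp \<Phi> (curv h c f b p) ?S) is)"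
    by (rule sum.swap)
  also have "\<dots> = curvc h c \<Phi> (\<lambda>x. S x c) p is"
    unfolding curvc_def E[symmetric] by (simp only: sharp_sum_left sharp_scale_left)
  finally show ?thesis .
qed

lemma laplacian_alpha_eq:
  assumes c: "c \<in> B" "p \<in> fst c" "length is = length \<Phi>"
  shows "laplacian_alpha B h \<Phi> \<alpha> S p c is = lapc h c \<Phi> (\<lambda>x. S x c) p is + \<alpha> * curvc h c \<Phi> (\<lambda>x. S x c) p is"
  using laplacian_eq[OF assms] curv_sharp_sharp_eq[OF assms] by (simp add: laplacian_alpha_def)

lemma laplacian_alpha_zero:
  "\<not> (c \<in> B \<and> p \<in> fst c \<and> length is = length \<Phi>) \<Longrightarrow> laplacian_alpha B h \<Phi> \<alpha> S p c is = 0"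
  by (auto simp: laplacian_alpha_def laplacian_def curv_sharp_sharp_def on_charts_def)

lemma laplacian_alpha_field:
  assumes S: "S \<in> tensor_field B \<Phi>"
  shows "laplacian_alpha B h \<Phi> \<alpha> S \<in> tensor_field B \<Phi>"
proof (rule fieldI)
  fix c assume c: "c \<in> B"
  interpret chart_metric c "fst c" h using metric_fst c by blast
  show "tsm c (fst c) (length \<Phi>) (\<lambda>x. laplacian_alpha B h \<Phi> \<alpha> S x c)"
    unfolding tsm_def
  proof (intro allI impI)
    fix "is" :: "'k list" assume l: "length is = length \<Phi>"
    note t = field_tsm[OF S c]
    have t2: "tsm c (fst c) (Suc (Suc (length \<Phi>))) (covd h c (Dn # \<Phi>) (covd h c \<Phi> (\<lambda>x. S x c)))"
      using tsm_covd[of "Dn # \<Phi>"] tsm_covd[OF t] by simp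
    have "csm c (fst c) (\<lambda>x. lapc h c \<Phi> (\<lambda>x. S x c) x is + \<alpha> * curvc h c \<Phi> (\<lambda>x. S x c) x is)"
      unfolding lapc_def curvc_def
      by (intro csm_intros csm_ginv tsmD[OF t2] csm_sharp[OF _ tsm_sharp[OF _ t] l]) (simp_all add: l csm_riemann csm_mult csm_ginv)
    then show "csm c (fst c) (\<lambda>x. laplacian_alpha B h \<Phi> \<alpha> S x c is)"
      by (subst csm_cong[OF laplacian_alpha_eq[OF c _ l]])
  qed
next
  fix c d x and js :: "'k list" assume cd: "c \<in> B" "d \<in> B" and x: "x \<in> fst c" "x \<in> fst d" and l: "length js = length \<Phi>"
  interpret chart_metric_pair c d "fst c \<inter> fst d" h using metric_pair cd by blast
  note L = field_pair_law[OF S cd]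
  have "act2 \<Phi> (jac c d x) (jac d c x) (laplacian_alpha B h \<Phi> \<alpha> S x c) js =
    act2 \<Phi> (jac c d x) (jac d c x) (\<lambda>ks. lapc h c \<Phi> (\<lambda>x. S x c) x ks + \<alpha> * curvc h c \<Phi> (\<lambda>x. S x c) x ks) js"
    by (rule act2_cong) (simp add: laplacian_alpha_eq[OF cd(1) x(1)])
  then show "laplacian_alpha B h \<Phi> \<alpha> S x d js = act2 \<Phi> (jac c d x) (jac d c x) (laplacian_alpha B h \<Phi> \<alpha> S x c) js"
    using law_lapc[OF L _ l, of x] law_curvc[OF L _ l, of x] x
    by (simp add: laplacian_alpha_eq[OF cd(2) x(2) l] act2_add act2_scale)
qed (rule laplacian_alpha_zero)

lemma lincomb_field:
  assumes "S \<in> tensor_field B \<Phi>" "T \<in> tensor_field B \<Phi>"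
  shows "lincomb a S b T \<in> tensor_field B \<Phi>"
proof (rule fieldI)
  fix c assume c: "c \<in> B"
  interpret chart_metric c "fst c" h using metric_fst c by blast
  show "tsm c (fst c) (length \<Phi>) (\<lambda>x. lincomb a S b T x c)"
    unfolding lincomb_def by (intro tsm_add tsm_mult csm_const field_tsm assms c)
next
  fix c d x and js :: "'k list" assume cd: "c \<in> B" "d \<in> B" and x: "x \<in> fst c" "x \<in> fst d" and l: "length js = length \<Phi>"
  show "lincomb a S b T x d js = act2 \<Phi> (jac c d x) (jac d c x) (lincomb a S b T x c) js"
    unfolding lincomb_def act2_add act2_scale using field_law[OF assms(1) cd x l] field_law[OF assms(2) cd x l] by simp
qed (use field_zero[OF assms(1)] field_zero[OF assms(2)] in \<open>auto simp: lincomb_def\<close>)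

lemma fmult_field:
  assumes "smooth_fun B f" "S \<in> tensor_field B \<Phi>"
  shows "fmult f S \<in> tensor_field B \<Phi>"
proof (rule fieldI)
  fix c assume c: "c \<in> B"
  interpret chart_metric c "fst c" h using metric_fst c by blast
  have "csm c (fst c) f" using assms(1) c by (simp add: smooth_fun_def csm_def)
  then show "tsm c (fst c) (length \<Phi>) (\<lambda>x. fmult f S x c)"
    unfolding fmult_def tscale_def by (intro tsm_mult field_tsm assms c)
next
  fix c d x and js :: "'k list" assume cd: "c \<in> B" "d \<in> B" and x: "x \<in> fst c" "x \<in> fst d" and l: "length js = length \<Phi>"
  show "fmult f S x d js = act2 \<Phi> (jac c d x) (jac d c x) (fmult f S x c) js"
    unfolding fmult_def tscale_def act2_scale using field_law[OF assms(2) cd x l] by simp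
qed (use field_zero[OF assms(2)] in \<open>auto simp: fmult_def tscale_def\<close>)

lemma laplacian_alpha_lincomb:
  assumes "S \<in> tensor_field B \<Phi>" "T \<in> tensor_field B \<Phi>"
  shows "laplacian_alpha B h \<Phi> \<alpha> (lincomb a S b T) = lincomb a (laplacian_alpha B h \<Phi> \<alpha> S) b (laplacian_alpha B h \<Phi> \<alpha> T)"
proof (rule field_eqI)
  fix c x and "is" :: "'k list" assume c: "c \<in> B" "x \<in> fst c" "length is = length \<Phi>"
  interpret chart_metric c "fst c" h using metric_fst c by blast
  show "laplacian_alpha B h \<Phi> \<alpha> (lincomb a S b T) x c is = lincomb a (laplacian_alpha B h \<Phi> \<alpha> S) b (laplacian_alpha B h \<Phi> \<alpha> T) x c is"
    using lapc_lin[OF field_tsm[OF assms(1) c(1)] field_tsm[OF assms(2) c(1)] c(2,3)] curvc_lin[of h c \<Phi> "\<lambda>_. a" "\<lambda>x. S x c" "\<lambda>_. b" "\<lambda>x. T x c"]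
    by (simp add: lincomb_def laplacian_alpha_eq[OF c] algebra_simps)
qed (intro laplacian_alpha_field lincomb_field assms)+

lemma laplacian_alpha_power_field: "S \<in> tensor_field B \<Phi> \<Longrightarrow> (laplacian_alpha B h \<Phi> \<alpha> ^^ m) S \<in> tensor_field B \<Phi>"
  by (induction m) (auto intro: laplacian_alpha_field)

lemma laplacian_alpha_power_lincomb:
  assumes "S \<in> tensor_field B \<Phi>" "T \<in> tensor_field B \<Phi>"
  shows "(laplacian_alpha B h \<Phi> \<alpha> ^^ m) (lincomb a S b T) = lincomb a ((laplacian_alpha B h \<Phi> \<alpha> ^^ m) S) b ((laplacian_alpha B h \<Phi> \<alpha> ^^ m) T)"
  by (induction m) (simp_all add: laplacian_alpha_lincomb laplacian_alpha_power_field assms)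

end

section \<open>The Euler field on the manifold\<close>

locale euler_manifold = metric_manifold B h
  for B :: "('a::{t2_space, second_countable_topology}, 'k::finite) chart set" and h :: "('a, 'k) tfield" +
  fixes X :: "('a, 'k) tfield" and Q :: "'a \<Rightarrow> real"
  assumes X_lie: "\<And>c u a b. c \<in> B \<Longrightarrow> u \<in> fst c \<Longrightarrow> lie_deriv2 X h u c a b = 2 * h u c [a, b]"
    and X_euler: "\<And>c u b. c \<in> B \<Longrightarrow> u \<in> fst c \<Longrightarrow> (\<Sum>a\<in>UNIV. h u c [a, b] * X u c [a]) = pd c b Q u / 2"
    and Q_norm: "Q = norm_sq B h X"
    and Q_smooth: "smooth_fun B Q"
    and Q_regular: "\<And>c u. c \<in> B \<Longrightarrow> u \<in> fst c \<Longrightarrow> Q u = 0 \<Longrightarrow> \<exists>a. pd c a Q u \<noteq> 0"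
begin

abbreviation "XX c \<equiv> \<lambda>x a. X x c [a]"

lemma Q_chart: "c \<in> B \<Longrightarrow> csm c (fst c) Q"
  using Q_smooth by (simp add: smooth_fun_def csm_def)

text \<open>\<open>X\<close> is half the gradient of \<open>Q\<close>. From this formula come its
  smoothness and its independence of the chart, neither of which is assumed.\<close>

lemma X_eq:
  assumes "c \<in> B" "u \<in> fst c"
  shows "X u c [a] = (\<Sum>b\<in>UNIV. ginv h u c a b * pd c b Q u) / 2"
proof -
  interpret chart_metric c "fst c" h using metric_fst assms by blast
  have "(\<Sum>b\<in>UNIV. ginv h u c a b * (\<Sum>e\<in>UNIV. h u c [b, e] * X u c [e])) = X u c [a]"
    unfolding sum_mult_assoc gi_g[OF assms(2)] by simp
  moreover have "(\<Sum>e\<in>UNIV. h u c [b, e] * X u c [e]) = pd c b Q u / 2" for b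
    using X_euler[OF assms, of b] by (simp add: h_sym[OF assms(2), of b])
  ultimately show ?thesis by (simp add: sum_divide_distrib)
qed

text \<open>With the index lowered, \<nabla>X has symmetric part \<open>h\<close> by the Lie
  derivative, and no skew part because the lowered \<open>X\<close> is dQ/2, a closed form. Hence
  \<nabla>X = id.\<close>

lemma ambient: 
  assumes c: "c \<in> B"
  shows "chart_ambient c (fst c) h (XX c) Q"
proof -
  interpret chart_metric c "fst c" h using metric_fst c by blast
  have X: "csm c (fst c) (\<lambda>x. X x c [a])" for a
    by (subst csm_cong[OF X_eq[OF c]], assumption) (intro csm_intros csm_ginv Q_chart[OF c])
  have Q: "pd c a Q p = 2 * (\<Sum>b\<in>UNIV. g p a b * X p c [b])" if "p \<in> fst c" for p a
    using X_euler[OF c that, of a] by (simp add: h_sym[OF that, of a])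
  have D: "pd c a (\<lambda>x. X x c [b]) p + (\<Sum>e\<in>UNIV. \<Gamma> p b a e * X p c [e]) = kron a b" if p: "p \<in> fst c" for p a b
  proof -
    let ?Y = "\<lambda>a b. pd c a (\<lambda>x. X x c [b]) p + (\<Sum>e\<in>UNIV. \<Gamma> p b a e * X p c [e])"
    let ?L = "\<lambda>a b. (\<Sum>e\<in>UNIV. g p b e * ?Y a e)"
    have L: "?L a b = (\<Sum>e\<in>UNIV. g p b e * pd c a (\<lambda>x. X x c [e]) p) + (\<Sum>e\<in>UNIV. (\<Sum>f\<in>UNIV. g p b f * \<Gamma> p f a e) * X p c [e])" for a b
      by (simp add: distrib_left sum.distrib sum_mult_assoc)
    have skew: "?L a b - ?L b a = 0" for a b
    proof -
      have 1: "pd c a (pd c b Q) p / 2 = (\<Sum>e\<in>UNIV. pd c a (\<lambda>x. g x b e) p * X p c [e] + g p b e * pd c a (\<lambda>x. X x c [e]) p)" for a b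
      proof -
        have "pd c a (pd c b Q) p = pd c a (\<lambda>x. 2 * (\<Sum>e\<in>UNIV. g x b e * X x c [e])) p"
          by (rule pd_cong[OF p]) (simp add: Q)
        then show ?thesis using p by (simp add: pd_cmult csm_sum csm_mult h_csm X pd_sum pd_mult)
      qed
      have 2: "(\<Sum>e\<in>UNIV. pd c a (\<lambda>x. g x b e) p * X p c [e]) =
          (\<Sum>e\<in>UNIV. (\<Sum>f\<in>UNIV. g p b f * \<Gamma> p f a e) * X p c [e]) + (\<Sum>e\<in>UNIV. (\<Sum>f\<in>UNIV. \<Gamma> p f a b * g p f e) * X p c [e])" for a b
        by (simp add: metric_compat[OF p] distrib_right sum.distrib mult.commute[of "\<Gamma> p _ _ _" "g p b _"])
      have "pd c a (pd c b Q) p / 2 - (\<Sum>e\<in>UNIV. (\<Sum>f\<in>UNIV. \<Gamma> p f a b * g p f e) * X p c [e]) = ?L a b" for a b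
        using 1[of a b] 2[of a b] unfolding L sum.distrib by linarith
      then show ?thesis
        using pd_commute[OF Q_chart[OF c] p, of a b] christoffel_sym[OF p, of _ a b] by (metis (no_types, lifting) cancel_comm_monoid_add_class.diff_cancel sum.cong)
    qed
    have sym: "?L a b + ?L b a = 2 * g p a b" for a b
    proof -
      have "lie_deriv2 X h p c a b = 2 * g p a b" by (rule X_lie[OF c p])
      moreover have "lie_deriv2 X h p c a b = (\<Sum>e\<in>UNIV. X p c [e] * pd c e (\<lambda>x. g x a b) p)
          + (\<Sum>e\<in>UNIV. g p b e * pd c a (\<lambda>x. X x c [e]) p) + (\<Sum>e\<in>UNIV. g p a e * pd c b (\<lambda>x. X x c [e]) p)"
        by (simp add: lie_deriv2_def sum.distrib h_sym[OF p, of _ b] mult.commute[of "pd _ _ _ _"])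
      moreover have "(\<Sum>e\<in>UNIV. X p c [e] * pd c e (\<lambda>x. g x a b) p) =
          (\<Sum>e\<in>UNIV. (\<Sum>f\<in>UNIV. g p b f * \<Gamma> p f a e) * X p c [e]) + (\<Sum>e\<in>UNIV. (\<Sum>f\<in>UNIV. g p a f * \<Gamma> p f b e) * X p c [e])"
      proof -
        have "(\<Sum>f\<in>UNIV. \<Gamma> p f e a * g p f b) = (\<Sum>f\<in>UNIV. g p b f * \<Gamma> p f a e)" for e
          by (simp add: christoffel_sym[OF p, of _ e a] h_sym[OF p, of _ b] mult.commute)
        moreover have "(\<Sum>f\<in>UNIV. \<Gamma> p f e b * g p a f) = (\<Sum>f\<in>UNIV. g p a f * \<Gamma> p f b e)" for e
          by (simp add: christoffel_sym[OF p, of _ e b] mult.commute)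
        ultimately show ?thesis
          by (simp add: metric_compat[OF p] distrib_left sum.distrib mult.commute)
      qed
      ultimately show ?thesis unfolding L by simp
    qed
    show ?thesis
    proof (rule lower_injective[OF p, of "?Y a" "\<lambda>b. kron a b"])
      fix e
      show "?L a e = (\<Sum>i\<in>UNIV. g p e i * kron a i)"
        using skew[of a e] sym[of a e] h_sym[OF p, of a e] by simp
    qed
  qed
  show ?thesis
    by unfold_locales (use X Q D Q_chart[OF c] in auto)
qed

text \<open>dQ(X) = 2 h(X, X) = 2 Q. As \<open>norm_sq\<close> evaluates in a chosen chart, dQ(X) is
  first shown to be the same in all charts, by the gradient form of \<open>X\<close>.\<close>

lemma X_Q:
  assumes c: "c \<in> B" and p: "p \<in> fst c"
  shows "(\<Sum>a\<in>UNIV. X p c [a] * pd c a Q p) = 2 * Q p"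
proof -
  have inv: "(\<Sum>a\<in>UNIV. X p d [a] * pd d a Q p) = (\<Sum>a\<in>UNIV. X p c [a] * pd c a Q p)"
    if d: "d \<in> B" "p \<in> fst d" for d
  proof -
    interpret chart_metric_pair c d "fst c \<inter> fst d" h using metric_pair c d by blast
    have p': "p \<in> fst c \<inter> fst d" using p d by blast
    have Q: "pd d a Q p = (\<Sum>m\<in>UNIV. K p $ m $ a * pd c m Q p)" for a
      using pd_change[OF csm_subset[OF Q_chart[OF c]] p', of a] by (simp add: mult.commute)
    have "(\<Sum>a\<in>UNIV. X p d [a] * pd d a Q p) = (\<Sum>a\<in>UNIV. (\<Sum>b\<in>UNIV. ginv h p d a b * (\<Sum>m\<in>UNIV. K p $ m $ b * pd c m Q p)) * pd d a Q p) / 2"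
      unfolding X_eq[OF d] Q[symmetric] by (simp add: sum_divide_distrib[symmetric])
    also have "\<dots> = (\<Sum>a\<in>UNIV. (\<Sum>k\<in>UNIV. J p $ a $ k * (\<Sum>m\<in>UNIV. ginv h p c k m * pd c m Q p)) * pd d a Q p) / 2"
      unfolding sum_mult_assoc gi_K[OF p'] ..
    also have "\<dots> = (\<Sum>a\<in>UNIV. (\<Sum>n\<in>UNIV. K p $ n $ a * pd c n Q p) * (\<Sum>k\<in>UNIV. J p $ a $ k * (2 * X p c [k]))) / 2"
    proof -
      have "(\<Sum>m\<in>UNIV. ginv h p c k m * pd c m Q p) = 2 * X p c [k]" for k
        by (simp add: X_eq[OF c p])
      then show ?thesis unfolding Q by (simp only: mult.commute)
    qed
    also have "\<dots> = (\<Sum>k\<in>UNIV. (\<Sum>a\<in>UNIV. (\<Sum>n\<in>UNIV. pd c n Q p * K p $ n $ a) * J p $ a $ k) * X p c [k])"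
      unfolding sum_mult_assoc by (simp add: sum_divide_distrib mult.commute[of "K p $ _ $ _"])
    also have "\<dots> = (\<Sum>k\<in>UNIV. (\<Sum>n\<in>UNIV. pd c n Q p * (\<Sum>a\<in>UNIV. K p $ n $ a * J p $ a $ k)) * X p c [k])"
      unfolding sum_mult_assoc ..
    also have "\<dots> = (\<Sum>k\<in>UNIV. X p c [k] * pd c k Q p)"
      unfolding KJ_nth[OF p'] by (simp add: mult.commute)
    finally show ?thesis .
  qed
  define d where "d = (SOME c. c \<in> B \<and> p \<in> fst c)"
  have d: "d \<in> B" "p \<in> fst d" using someI[of "\<lambda>c. c \<in> B \<and> p \<in> fst c" c] c p by (simp_all add: d_def)
  have "(\<Sum>a\<in>UNIV. X p d [a] * pd d a Q p) = 2 * (\<Sum>a\<in>UNIV. \<Sum>b\<in>UNIV. h p d [a, b] * X p d [a] * X p d [b])"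
  proof -
    interpret chart_ambient d "fst d" h "XX d" Q using ambient d by blast
    show ?thesis unfolding Q_deriv[OF d(2)] by (simp add: sum_distrib_left mult_ac)
  qed
  also have "\<dots> = 2 * Q p" by (simp add: Q_norm norm_sq_def d_def Let_def)
  finally show ?thesis using inv[OF d] by simp
qed

definition weight :: "index_pos list \<Rightarrow> real \<Rightarrow> ('a, 'k) tfield \<Rightarrow> bool" where
  "weight \<Phi> w S \<longleftrightarrow> (\<forall>c\<in>B. \<forall>p\<in>fst c. \<forall>is. length is = length \<Phi> \<longrightarrow> cX h c (XX c) \<Phi> (\<lambda>x. S x c) p is = w * S p c is)"

lemma cov_along_weight:
  assumes S: "S \<in> tensor_field B \<Phi>"
  shows "cov_along B h \<Phi> X S = (\<lambda>u. tscale w (S u)) \<longleftrightarrow> weight \<Phi> w S"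
proof -
  have e: "cov_along B h \<Phi> X S p c is = cX h c (XX c) \<Phi> (\<lambda>x. S x c) p is" if "c \<in> B" "p \<in> fst c" "length is = length \<Phi>" for c p "is"
    using that by (simp add: cov_along_def on_charts_def cX_def cov_deriv_eq covd_def)
  have z: "cov_along B h \<Phi> X S p c is = 0" if "\<not> (c \<in> B \<and> p \<in> fst c \<and> length is = length \<Phi>)" for c p "is"
    using that by (auto simp: cov_along_def on_charts_def)
  show ?thesis
  proof
    assume "cov_along B h \<Phi> X S = (\<lambda>u. tscale w (S u))"
    then show "weight \<Phi> w S" unfolding weight_def using e by (simp add: tscale_def)
  next
    assume w: "weight \<Phi> w S"
    show "cov_along B h \<Phi> X S = (\<lambda>u. tscale w (S u))"
    proof (intro ext)
      fix p c "is"
      show "cov_along B h \<Phi> X S p c is = tscale w (S p) c is"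
        using w e[of c p "is"] z[of c p "is"] field_zero[OF S, of c p "is"] unfolding weight_def tscale_def
        by (cases "c \<in> B \<and> p \<in> fst c \<and> length is = length \<Phi>") auto
    qed
  qed
qed

lemma weight_laplacian:
  assumes S: "S \<in> tensor_field B \<Phi>" and w: "weight \<Phi> w S"
  shows "weight \<Phi> (w - 2) (laplacian_alpha B h \<Phi> \<alpha> S)"
  unfolding weight_def
proof (intro ballI allI impI)
  fix c p and "is" :: "'k list" assume c: "c \<in> B" and p: "p \<in> fst c" and l: "length is = length \<Phi>"
  interpret chart_ambient c "fst c" h "XX c" Q using ambient c by blast
  let ?S = "\<lambda>x. S x c"
  note t = field_tsm[OF S c]
  have t2: "tsm c (fst c) (Suc (Suc (length \<Phi>))) (covd h c (Dn # \<Phi>) (covd h c \<Phi> ?S))"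
    using tsm_covd[of "Dn # \<Phi>"] tsm_covd[OF t] by simp
  have tl: "tsm c (fst c) (length \<Phi>) (lapc h c \<Phi> ?S)"
    unfolding tsm_def lapc_def by (auto intro!: csm_intros csm_ginv tsmD[OF t2])
  have tr: "tsm c (fst c) (length \<Phi>) (curvc h c \<Phi> ?S)"
    unfolding curvc_def[abs_def] by (intro tsm_sum tsm_sharp t csm_unit) (simp add: csm_riemann)
  have wS: "cX h c (XX c) \<Phi> ?S x ks = w * ?S x ks" if "x \<in> fst c" "length ks = length \<Phi>" for x ks
    using w c that by (auto simp: weight_def)
  have lc: "lapc h c \<Phi> (cX h c (XX c) \<Phi> ?S) p is = w * lapc h c \<Phi> ?S p is"
  proof -
    \<comment> \<open>The vacuous summand \<open>0 * ?S x ks\<close> brings the argument into the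
      form treated by \<open>lapc_lin\<close>.\<close>
    have "lapc h c \<Phi> (cX h c (XX c) \<Phi> ?S) p is = lapc h c \<Phi> (\<lambda>x ks. w * ?S x ks + 0 * ?S x ks) p is"
      unfolding lapc_def covd_Cons
      by (intro sum.cong refl arg_cong2[where f="(*)"] cd_cong[OF p, of _ "Suc (length \<Phi>)"])
        (use l in \<open>auto simp: length_Suc_conv covd_Cons intro!: cd_cong[where n="length \<Phi>"] wS\<close>)
    then show ?thesis unfolding lapc_lin[OF t t p l] by simp
  qed
  have rc: "curvc h c \<Phi> (cX h c (XX c) \<Phi> ?S) p is = w * curvc h c \<Phi> ?S p is"
    using curvc_cong[of \<Phi> "cX h c (XX c) \<Phi> ?S" p "\<lambda>x ks. w * ?S x ks + 0 * ?S x ks" "is" h c, OF _ l]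
      curvc_lin[of h c \<Phi> "\<lambda>_. w" ?S "\<lambda>_. 0" ?S p "is"] wS[OF p] by simp
  have "cX h c (XX c) \<Phi> (\<lambda>x. laplacian_alpha B h \<Phi> \<alpha> S x c) p is =
     cX h c (XX c) \<Phi> (\<lambda>x ks. lapc h c \<Phi> ?S x ks + \<alpha> * curvc h c \<Phi> ?S x ks) p is"
    unfolding cX_def by (intro sum.cong refl arg_cong2[where f="(*)"] cd_cong[OF p l]) (simp add: laplacian_alpha_eq[OF c])
  also have "\<dots> = cX h c (XX c) \<Phi> (lapc h c \<Phi> ?S) p is + \<alpha> * cX h c (XX c) \<Phi> (curvc h c \<Phi> ?S) p is"
    unfolding cX_add[OF tl tsm_mult[OF csm_const tr] p l]
    by (simp add: cX_def cd_mult[OF csm_const tr p l] sum_distrib_left mult_ac)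
  also have "\<dots> = (w - 2) * laplacian_alpha B h \<Phi> \<alpha> S p c is"
  proof -
    have "cX h c (XX c) \<Phi> (lapc h c \<Phi> ?S) p is = (w - 2) * lapc h c \<Phi> ?S p is"
      "cX h c (XX c) \<Phi> (curvc h c \<Phi> ?S) p is = (w - 2) * curvc h c \<Phi> ?S p is"
      using lapc_cX[OF t p l] curvc_cX[OF t p l] lc rc by (simp_all add: algebra_simps)
    note r = this
    show ?thesis unfolding laplacian_alpha_eq[OF c p l] r by (simp add: algebra_simps)
  qed
  finally show "cX h c (XX c) \<Phi> (\<lambda>x. laplacian_alpha B h \<Phi> \<alpha> S x c) p is = (w - 2) * laplacian_alpha B h \<Phi> \<alpha> S p c is" .
qed

lemma weight_laplacian_power:
  "S \<in> tensor_field B \<Phi> \<Longrightarrow> weight \<Phi> w S \<Longrightarrow> weight \<Phi> (w - 2 * real m) ((laplacian_alpha B h \<Phi> \<alpha> ^^ m) S)"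
proof (induction m)
  case (Suc m)
  then show ?case using weight_laplacian[OF laplacian_alpha_power_field[OF Suc.prems(1)] Suc.IH[OF Suc.prems]]
    by (simp add: algebra_simps)
qed simp

text \<open>The curvature term is algebraic in the section and commutes with \<open>Q\<close>; the
  derivative along \<open>X\<close> in \<open>lapc_mult_Q\<close> is multiplication by the
  weight.\<close>

lemma laplacian_fmult:
  assumes S: "S \<in> tensor_field B \<Phi>" and w: "weight \<Phi> w S"
  shows "laplacian_alpha B h \<Phi> \<alpha> (fmult Q S) =
    lincomb 1 (fmult Q (laplacian_alpha B h \<Phi> \<alpha> S)) (4 * w + 2 * real CARD('k)) S"
proof (rule field_eqI)
  fix c p and "is" :: "'k list" assume c: "c \<in> B" "p \<in> fst c" "length is = length \<Phi>"
  interpret chart_ambient c "fst c" h "XX c" Q using ambient c by blast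
  show "laplacian_alpha B h \<Phi> \<alpha> (fmult Q S) p c is =
    lincomb 1 (fmult Q (laplacian_alpha B h \<Phi> \<alpha> S)) (4 * w + 2 * real CARD('k)) S p c is"
    using lapc_mult_Q[OF field_tsm[OF S c(1)] c(2,3)] curvc_lin[of h c \<Phi> Q "\<lambda>x. S x c" "\<lambda>_. 0" "\<lambda>x. S x c" p "is"] w c
    by (simp add: laplacian_alpha_eq[OF c] fmult_def tscale_def lincomb_def weight_def algebra_simps)
qed (intro laplacian_alpha_field lincomb_field fmult_field Q_smooth S)+

text \<open>The coefficient is the sum of the arithmetic series
  \<open>4 * (v - 2 * j) + 2 * CARD('k)\<close> over \<open>j = 0, ..., m\<close>. Stating it for
  \<open>Suc m\<close> makes the power in the remainder term the natural number
  \<open>m\<close>.\<close>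

lemma laplacian_power_fmult:
  assumes S: "S \<in> tensor_field B \<Phi>" and w: "weight \<Phi> v S"
  shows "(laplacian_alpha B h \<Phi> \<alpha> ^^ Suc m) (fmult Q S) =
    lincomb 1 (fmult Q ((laplacian_alpha B h \<Phi> \<alpha> ^^ Suc m) S)) (real (Suc m) * (4 * v + 2 * real CARD('k) - 4 * real m)) ((laplacian_alpha B h \<Phi> \<alpha> ^^ m) S)"
proof (induction m)
  case 0
  then show ?case using laplacian_fmult[OF S w] by simp
next
  case (Suc m)
  let ?L = "laplacian_alpha B h \<Phi> \<alpha>"
  have f: "(?L ^^ k) S \<in> tensor_field B \<Phi>" for k by (rule laplacian_alpha_power_field[OF S])
  have "(?L ^^ Suc (Suc m)) (fmult Q S) = ?L (lincomb 1 (fmult Q ((?L ^^ Suc m) S)) (real (Suc m) * (4 * v + 2 * real CARD('k) - 4 * real m)) ((?L ^^ m) S))"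
    using Suc.IH by simp
  also have "\<dots> = lincomb 1 (?L (fmult Q ((?L ^^ Suc m) S))) (real (Suc m) * (4 * v + 2 * real CARD('k) - 4 * real m)) ((?L ^^ Suc m) S)"
    by (subst laplacian_alpha_lincomb[OF fmult_field[OF Q_smooth f[of "Suc m"]] f[of m]]) simp
  also have "?L (fmult Q ((?L ^^ Suc m) S)) = lincomb 1 (fmult Q ((?L ^^ Suc (Suc m)) S)) (4 * (v - 2 * real (Suc m)) + 2 * real CARD('k)) ((?L ^^ Suc m) S)"
    using laplacian_fmult[OF f[of "Suc m"] weight_laplacian_power[OF S w, of "Suc m"]] by simp
  finally show ?case by (simp add: lincomb_def fun_eq_iff algebra_simps)
qed

text \<open>The zeros of \<open>Q\<close> have no interior: if \<open>f\<close> did not vanish at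
  \<open>p\<close>, it would be nonzero, hence \<open>Q\<close> zero, on an open set around
  \<open>p\<close>, contradicting \<open>Q_regular\<close>. Continuous identities can thus be
  checked off the zero set.\<close>

lemma zero_off_zeros:
  assumes c: "c \<in> B" and U: "open U" "U \<subseteq> fst c" and f: "csm c U f"
    and nz: "\<And>x. x \<in> U \<Longrightarrow> Q x \<noteq> 0 \<Longrightarrow> f x = 0" and p: "p \<in> U"
  shows "f p = 0"
proof (rule ccontr)
  interpret chart_domain c U by (rule smooth_atlas_chart_domain[OF atlas c U])
  assume fp: "f p \<noteq> 0"
  have "open (f -` (- {0}) \<inter> U)"
    using continuous_on_open_vimage[OF U(1)] csm_continuous[OF f] by blast
  moreover have "f -` (- {0}) \<inter> U = {x \<in> U. f x \<noteq> 0}" by blast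
  ultimately have o: "open {x \<in> U. f x \<noteq> 0}" by simp
  interpret N: chart_domain c "{x \<in> U. f x \<noteq> 0}"
    by (rule chart_domain_subset[OF chart_domain_axioms o]) auto
  have "pd c a Q p = pd c a (\<lambda>x. 0) p" for a
    by (rule N.pd_cong) (use fp p nz in auto)
  then show False using Q_regular[OF c, of p] nz[OF p] fp p U by auto
qed

text \<open>By \<open>X_Q\<close>, \<nabla>_X (Q S) = Q (\<nabla>_X S + 2 S). The factor
  \<open>Q\<close> is cancelled where it is nonzero, and \<open>zero_off_zeros\<close> extends the
  result.\<close>

lemma weight_quotient:
  assumes S: "S \<in> tensor_field B \<Phi>" and w: "weight \<Phi> w (fmult Q S)"
  shows "weight \<Phi> (w - 2) S"
  unfolding weight_def
proof (intro ballI allI impI)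
  fix c p and "is" :: "'k list" assume c: "c \<in> B" and p: "p \<in> fst c" and l: "length is = length \<Phi>"
  interpret chart_ambient c "fst c" h "XX c" Q using ambient c by blast
  let ?S = "\<lambda>x. S x c"
  note t = field_tsm[OF S c]
  let ?f = "\<lambda>x. cX h c (XX c) \<Phi> ?S x is - (w - 2) * ?S x is"
  have nz: "?f x = 0" if "x \<in> fst c" "Q x \<noteq> 0" for x
  proof -
    have "cX h c (XX c) \<Phi> (\<lambda>x ks. Q x * ?S x ks) x is = w * (Q x * ?S x is)"
      using w c that l by (auto simp: weight_def fmult_def tscale_def)
    moreover have "cX h c (XX c) \<Phi> (\<lambda>x ks. Q x * ?S x ks) x is = (\<Sum>a\<in>UNIV. X x c [a] * pd c a Q x) * ?S x is + Q x * cX h c (XX c) \<Phi> ?S x is"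
      by (simp add: cX_def cd_mult[OF Q_csm t that(1) l] distrib_left sum.distrib sum_distrib_right sum_distrib_left mult_ac)
    ultimately have "Q x * ?f x = 0" unfolding X_Q[OF c that(1)] by (simp add: algebra_simps)
    then show ?thesis using that by simp
  qed
  have "?f p = 0"
  proof (rule zero_off_zeros[OF c open_U order_refl _ nz p])
    show "csm c (fst c) ?f"
      by (intro csm_diff csm_mult csm_const tsmD[OF tsm_cX[OF t] l] tsmD[OF t l])
  qed
  then show "cX h c (XX c) \<Phi> ?S p is = (w - 2) * ?S p is" by simp
qed

end

section \<open>Isometry-invariant subbundles\<close>

text \<open>A finite-dimensional subspace is closed. As \<open>W\<close> sits in a function space
  that carries no norm, the coordinates in \<open>I\<close> are eliminated one at a time.\<close>

lemma subspace_limit: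
  fixes W :: "('i \<Rightarrow> real) set" and f :: "'t \<Rightarrow> 'i \<Rightarrow> real"
  assumes "finite I" "F \<noteq> bot"
    and "(\<lambda>_. 0) \<in> W" "\<And>s t a b. s \<in> W \<Longrightarrow> t \<in> W \<Longrightarrow> (\<lambda>i. a * s i + b * t i) \<in> W"
    and "\<And>s i. s \<in> W \<Longrightarrow> i \<notin> I \<Longrightarrow> s i = 0"
    and "eventually (\<lambda>\<tau>. f \<tau> \<in> W) F" "\<And>i. ((\<lambda>\<tau>. f \<tau> i) \<longlongrightarrow> l i) F"
  shows "l \<in> W"
  using assms(1,3-)
proof (induction I arbitrary: W f l)
  case empty
  have "l = (\<lambda>_. 0)"
  proof
    fix i
    have "eventually (\<lambda>\<tau>. f \<tau> i = 0) F" using empty.prems(4) by eventually_elim (use empty.prems(3) in auto)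
    then have "((\<lambda>\<tau>. f \<tau> i) \<longlongrightarrow> 0) F" by (rule tendsto_eventually)
    then show "l i = 0" using tendsto_unique[OF assms(2)] empty.prems(5) by blast
  qed
  then show ?case using empty.prems(1) by simp
next
  case (insert j I)
  show ?case
  proof (cases "\<forall>s\<in>W. s j = 0")
    case True
    have "s i = 0" if "s \<in> W" "i \<notin> I" for s i
      using True insert.prems(3)[of s i] that by (cases "i = j") auto
    then show ?thesis
      using insert.IH[OF insert.prems(1) insert.prems(2) _ insert.prems(4,5)] by blast
  next
    case False
    then obtain w where w: "w \<in> W" "w j \<noteq> 0" by blast
    define w1 where "w1 = (\<lambda>i. (1 / w j) * w i + 0 * w i)"
    have w1: "w1 \<in> W" "w1 j = 1" unfolding w1_def using insert.prems(2)[OF w(1) w(1), of "1 / w j" 0] w(2) by auto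
    let ?W = "{s \<in> W. s j = 0}"
    \<comment> \<open>Subtracting multiples of \<open>w1\<close>, whose entry at \<open>j\<close> is
      1, moves the family into the subspace with vanishing entry at \<open>j\<close>.\<close>
    let ?f = "\<lambda>\<tau> i. 1 * f \<tau> i + (- f \<tau> j) * w1 i" and ?l = "\<lambda>i. 1 * l i + (- l j) * w1 i"
    have "?l \<in> ?W"
    proof (rule insert.IH[where f="?f"])
      show "(\<lambda>_. 0) \<in> ?W" using insert.prems(1) by simp
      show "(\<lambda>i. a * s i + b * t i) \<in> ?W" if "s \<in> ?W" "t \<in> ?W" for s t a b
        using insert.prems(2)[of s t a b] that by simp
      show "s i = 0" if "s \<in> ?W" "i \<notin> I" for s i using insert.prems(3)[of s i] that by (cases "i = j") auto
      show "eventually (\<lambda>\<tau>. ?f \<tau> \<in> ?W) F"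
        using insert.prems(4)
      proof eventually_elim
        case (elim \<tau>)
        then show ?case using insert.prems(2)[OF elim w1(1), of 1 "- f \<tau> j"] w1(2) by simp
      qed
      show "((\<lambda>\<tau>. ?f \<tau> i) \<longlongrightarrow> ?l i) F" for i
        by (intro tendsto_intros insert.prems(5))
    qed
    then have "(\<lambda>i. 1 * ?l i + l j * w1 i) \<in> W" using insert.prems(2)[OF _ w1(1)] by blast
    then show ?thesis by simp
  qed
qed

section \<open>Differentiable paths of isometries\<close>

definition mderiv :: "(real \<Rightarrow> real ^ 'n ^ 'n) \<Rightarrow> real ^ 'n ^ 'n \<Rightarrow> bool" where
  "mderiv A A' \<longleftrightarrow> (\<forall>i j. ((\<lambda>\<tau>. A \<tau> $ i $ j) has_real_derivative A' $ i $ j) (at 0))"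

lemma mderivD: "mderiv A A' \<Longrightarrow> ((\<lambda>\<tau>. A \<tau> $ i $ j) has_real_derivative A' $ i $ j) (at 0)"
  by (simp add: mderiv_def)

lemma mderiv_const: "mderiv (\<lambda>\<tau>. M) 0"
  by (simp add: mderiv_def)

lemma mderiv_mult:
  assumes "mderiv A A'" "mderiv B B'"
  shows "mderiv (\<lambda>\<tau>. A \<tau> ** B \<tau>) (A' ** B 0 + A 0 ** B')"
  unfolding mderiv_def
proof (intro allI)
  fix i j
  have "((\<lambda>\<tau>. \<Sum>k\<in>UNIV. A \<tau> $ i $ k * B \<tau> $ k $ j) has_real_derivative
     (\<Sum>k\<in>UNIV. A' $ i $ k * B 0 $ k $ j + B' $ k $ j * A 0 $ i $ k)) (at 0)"
    by (intro DERIV_sum DERIV_mult mderivD assms)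
  then show "((\<lambda>\<tau>. (A \<tau> ** B \<tau>) $ i $ j) has_real_derivative (A' ** B 0 + A 0 ** B') $ i $ j) (at 0)"
    by (simp add: matrix_mult_nth sum.distrib mult.commute[of "B' $ _ $ _"])
qed

lemma mderiv_transpose: "mderiv A A' \<Longrightarrow> mderiv (\<lambda>\<tau>. transpose (A \<tau>)) (transpose A')"
  by (simp add: mderiv_def transpose_def)

lemma mderiv_tendsto: "mderiv A A' \<Longrightarrow> ((\<lambda>\<tau>. A \<tau> $ i $ j) \<longlongrightarrow> A 0 $ i $ j) (at 0)"
  using DERIV_isCont[OF mderivD] isCont_def by blast

lemma mderiv_has_vector_derivative: "mderiv A A' \<longleftrightarrow> (A has_vector_derivative A') (at 0)"
proof
  assume A: "mderiv A A'"
  have "((\<lambda>\<tau>. A \<tau> \<bullet> b) has_derivative (\<lambda>h. (h *\<^sub>R A') \<bullet> b)) (at 0)" if "b \<in> Basis" for b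
  proof -
    have "b \<in> (\<Union>i. \<Union>j. {axis i (axis j 1)})" using that by (simp add: Basis_vec_def)
    then obtain i j where b: "b = axis i (axis j 1)" by blast
    show ?thesis using mderivD[OF A, of i j] unfolding has_field_derivative_def b
      by (simp add: inner_axis mult.commute[of _ "A' $ _ $ _"])
  qed
  then show "(A has_vector_derivative A') (at 0)"
    unfolding has_vector_derivative_def by (subst has_derivative_componentwise_within) blast
next
  assume A: "(A has_vector_derivative A') (at 0)"
  have "((\<lambda>\<tau>. A \<tau> $ i $ j) has_derivative (\<lambda>h. (h *\<^sub>R A') $ i $ j)) (at 0)" for i j
    using A unfolding has_vector_derivative_def
    by (intro bounded_linear.has_derivative[OF bounded_linear_vec_nth])
  then show "mderiv A A'"
    unfolding mderiv_def has_field_derivative_def by (simp add: mult.commute[of _ "A' $ _ $ _"])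
qed

lemma tendsto_det:
  fixes A :: "'t \<Rightarrow> real ^ 'n ^ 'n"
  assumes "\<And>i j. ((\<lambda>\<tau>. A \<tau> $ i $ j) \<longlongrightarrow> M $ i $ j) F"
  shows "((\<lambda>\<tau>. det (A \<tau>)) \<longlongrightarrow> det M) F"
  unfolding det_def by (intro tendsto_intros assms)

text \<open>The derivative is read off from \<open>A\<inverse> - 1 = - A\<inverse> (A - 1)\<close>.\<close>

lemma mderiv_inverse:
  assumes A: "mderiv A A'" and A0: "A 0 = mat 1"
  shows "eventually (\<lambda>\<tau>. det (A \<tau>) \<noteq> 0) (at 0)" "mderiv (\<lambda>\<tau>. matrix_inv (A \<tau>)) (- A')"
proof -
  have "((\<lambda>\<tau>. det (A \<tau>)) \<longlongrightarrow> 1) (at 0)"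
    using tendsto_det[OF mderiv_tendsto[OF A]] by (simp add: A0)
  then show ev: "eventually (\<lambda>\<tau>. det (A \<tau>) \<noteq> 0) (at 0)"
    by (rule tendsto_imp_eventually_ne) simp
  let ?K = "\<lambda>\<tau>. matrix_inv (A \<tau>)"
  have K0: "?K 0 = mat 1" unfolding A0 by (rule matrix_inv_eqI) simp
  have K: "((\<lambda>\<tau>. ?K \<tau> $ i $ j) \<longlongrightarrow> kron i j) (at 0)" for i j
  proof -
    have "((\<lambda>\<tau>. det (\<chi> k l. if l = i then kron k j else A \<tau> $ k $ l) / det (A \<tau>)) \<longlongrightarrow>
        det (\<chi> k l. if l = i then kron k j else A 0 $ k $ l) / det (A 0)) (at 0)"
    proof (intro tendsto_divide tendsto_det)
      fix k l
      show "((\<lambda>\<tau>. (\<chi> k l. if l = i then kron k j else A \<tau> $ k $ l) $ k $ l) \<longlongrightarrow>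
        (\<chi> k l. if l = i then kron k j else A 0 $ k $ l) $ k $ l) (at 0)"
        using mderiv_tendsto[OF A, of k l] by (cases "l = i") auto
    qed (use mderiv_tendsto[OF A] A0 in auto)
    also have "det (\<chi> k l. if l = i then kron k j else A 0 $ k $ l) / det (A 0) = kron i j"
      using matrix_inv_cramer[of "A 0" i j] K0 by (simp add: A0 mat_1_nth)
    finally show ?thesis
    proof (rule tendsto_cong[THEN iffD1, rotated])
      show "\<forall>\<^sub>F \<tau> in at 0. det (\<chi> k l. if l = i then kron k j else A \<tau> $ k $ l) / det (A \<tau>) = ?K \<tau> $ i $ j"
        using ev by eventually_elim (simp add: matrix_inv_cramer)
    qed
  qed
  show "mderiv ?K (- A')"
    unfolding mderiv_def
  proof (intro allI)
    fix i j
    have "((\<lambda>\<tau>. - (\<Sum>k\<in>UNIV. ?K \<tau> $ i $ k * ((A \<tau> $ k $ j - A 0 $ k $ j) / \<tau>))) \<longlongrightarrow> - (\<Sum>k\<in>UNIV. kron i k * A' $ k $ j)) (at 0)"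
      using mderivD[OF A] by (intro tendsto_intros K) (simp add: DERIV_def)
    then have "((\<lambda>\<tau>. - (\<Sum>k\<in>UNIV. ?K \<tau> $ i $ k * ((A \<tau> $ k $ j - A 0 $ k $ j) / \<tau>))) \<longlongrightarrow> - A' $ i $ j) (at 0)"
      by simp
    moreover have "\<forall>\<^sub>F \<tau> in at 0. - (\<Sum>k\<in>UNIV. ?K \<tau> $ i $ k * ((A \<tau> $ k $ j - A 0 $ k $ j) / \<tau>)) = (?K \<tau> $ i $ j - ?K 0 $ i $ j) / \<tau>"
      using ev
    proof eventually_elim
      case (elim \<tau>)
      have "(?K \<tau> ** A \<tau>) $ i $ j = kron i j" using invertible_matrix_inv(2)[OF elim] by (simp add: mat_1_nth)
      then have "(\<Sum>k\<in>UNIV. ?K \<tau> $ i $ k * A \<tau> $ k $ j) = kron i j" by (simp add: matrix_mult_nth)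
      then have e: "- (\<Sum>k\<in>UNIV. ?K \<tau> $ i $ k * (A \<tau> $ k $ j - A 0 $ k $ j)) = ?K \<tau> $ i $ j - ?K 0 $ i $ j"
        unfolding K0 by (simp add: A0 right_diff_distrib sum_subtractf mat_1_nth)
      show ?case unfolding e[symmetric] by (simp add: sum_divide_distrib)
    qed
    ultimately show "((\<lambda>\<tau>. ?K \<tau> $ i $ j) has_real_derivative (- A') $ i $ j) (at 0)"
      unfolding DERIV_def using tendsto_cong[THEN iffD1] by fastforce
  qed
qed

lemma bounded_bilinear_matrix: "bounded_bilinear ((**) :: real ^ 'n ^ 'n \<Rightarrow> real ^ 'n ^ 'n \<Rightarrow> _)"
  unfolding bilinear_conv_bounded_bilinear[symmetric] bilinear_def
  by (auto intro!: linearI simp: matrix_add_ldistrib matrix_add_rdistrib matrix_scaleR_left matrix_scaleR_right)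

text \<open>The inverse function theorem for squaring at the identity, where the derivative is
  multiplication by 2. Uniqueness of roots within \<open>W\<close> is recorded for comparing a root
  with its adjoint.\<close>

lemma matrix_sqrt:
  obtains W V and g :: "real ^ 'n ^ 'n \<Rightarrow> real ^ 'n ^ 'n" and g' where
    "open W" "mat 1 \<in> W" "open V" "mat 1 \<in> V" "\<And>Y. Y \<in> V \<Longrightarrow> g Y \<in> W \<and> g Y ** g Y = Y" "g (mat 1) = mat 1"
    "\<And>Y Z. Y \<in> W \<Longrightarrow> Z \<in> W \<Longrightarrow> Y ** Y = Z ** Z \<Longrightarrow> Y = Z" "(g has_derivative g') (at (mat 1))"
proof -
  interpret M: bounded_bilinear "(**) :: real ^ 'n ^ 'n \<Rightarrow> real ^ 'n ^ 'n \<Rightarrow> _" by (rule bounded_bilinear_matrix)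
  let ?f = "\<lambda>X :: real ^ 'n ^ 'n. X ** X"
  define f' where "f' X = Blinfun (\<lambda>H :: real ^ 'n ^ 'n. X ** H + H ** X)" for X
  have f': "blinfun_apply (f' X) H = X ** H + H ** X" for X H
    unfolding f'_def by (subst bounded_linear_Blinfun_apply)
      (auto intro: bounded_linear_add M.bounded_linear_left M.bounded_linear_right)
  have 1: "(?f has_derivative blinfun_apply (f' X)) (at X)" for X
  proof -
    have "blinfun_apply (f' X) = (\<lambda>H. X ** H + H ** X)" by (rule ext) (rule f')
    then show ?thesis using M.FDERIV[OF has_derivative_ident has_derivative_ident, of X UNIV] by simp
  qed
  have 2: "continuous_on UNIV f'"
    by (rule continuous_on_blinfun_componentwise) (auto simp: f' intro!: continuous_intros M.continuous_on)
  have 3: "Blinfun (\<lambda>H. (1/2) *\<^sub>R H) o\<^sub>L f' (mat 1) = id_blinfun"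
    by (rule blinfun_eqI) (simp add: f' bounded_linear_Blinfun_apply bounded_linear_scaleR_right flip: scaleR_2)
  obtain U' V g g' where *: "open U'" "mat 1 \<in> U'" "open V" "?f (mat 1) \<in> V" "homeomorphism U' V ?f g"
    "\<And>y. y \<in> V \<Longrightarrow> (g has_derivative (g' y)) (at y)"
    by (rule inverse_function_theorem[OF open_UNIV 1 2 UNIV_I 3]) blast
  show ?thesis
  proof (rule that[of U' V g "g' (mat 1)"])
    show "g Y \<in> U' \<and> g Y ** g Y = Y" if "Y \<in> V" for Y using *(5) that unfolding homeomorphism_def by blast
    have inv: "g (X ** X) = X" if "X \<in> U'" for X using *(5) that unfolding homeomorphism_def by blast
    show "g (mat 1) = mat 1" using inv[OF *(2)] by simp
    show "Y = Z" if "Y \<in> U'" "Z \<in> U'" "Y ** Y = Z ** Z" for Y Z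
    proof -
      have "Y = g (Y ** Y)" by (rule inv[OF that(1), symmetric])
      also have "\<dots> = Z" unfolding that(3) by (rule inv[OF that(2)])
      finally show ?thesis .
    qed
  qed (use * in auto)
qed

text \<open>Let \<open>R = 1 + \<tau> N\<close> and \<open>P = R\<^sup>T G R\<close>, so \<open>P' = 0\<close> at \<open>0\<close>. The square root \<open>F\<close> of \<open>G(0)\<inverse> P\<close> near \<open>1\<close> is
  self-adjoint for \<open>G(0)\<close>, since its adjoint is another square root near \<open>1\<close>; hence \<open>F\<^sup>T G(0) F = P\<close>
  and \<open>L = F R\<inverse>\<close> works.\<close>

lemma isometry_path:
  fixes G :: "real \<Rightarrow> real ^ 'n ^ 'n"
  assumes sym: "\<forall>\<^sub>F \<tau> in at 0. transpose (G \<tau>) = G \<tau>" and sym0: "transpose (G 0) = G 0" and det: "det (G 0) \<noteq> 0"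
    and G: "mderiv G G'" and N: "transpose N ** G 0 + G 0 ** N + G' = 0"
  obtains L where "L 0 = mat 1" "\<forall>\<^sub>F \<tau> in at 0. transpose (L \<tau>) ** G 0 ** L \<tau> = G \<tau>" "mderiv L (- N)"
proof -
  define R where "R \<tau> = mat 1 + \<tau> *\<^sub>R N" for \<tau>
  have R0: "R 0 = mat 1" by (simp add: R_def)
  have R: "mderiv R N"
    unfolding mderiv_def R_def by (auto intro!: derivative_eq_intros)
  let ?I = "matrix_inv (G 0)"
  define P where "P \<tau> = transpose (R \<tau>) ** G \<tau> ** R \<tau>" for \<tau>
  define H where "H \<tau> = ?I ** P \<tau>" for \<tau>
  have "mderiv P ((transpose N ** G 0 + transpose (R 0) ** G') ** R 0 + (transpose (R 0) ** G 0) ** N)"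
    unfolding P_def using mderiv_mult[OF mderiv_mult[OF mderiv_transpose[OF R] G] R] by simp
  moreover have "(transpose N ** G 0 + transpose (R 0) ** G') ** R 0 + (transpose (R 0) ** G 0) ** N = 0"
    using N by (simp add: R0 transpose_mat algebra_simps)
  ultimately have "mderiv P 0" by simp
  then have H: "mderiv H 0"
    unfolding H_def using mderiv_mult[OF mderiv_const[of ?I], of P 0] by simp
  have inv: "G 0 ** ?I = mat 1" "?I ** G 0 = mat 1" using invertible_matrix_inv[OF det] by auto
  have Isym: "transpose ?I = ?I"
  proof -
    have "G 0 ** transpose ?I = mat 1"
      using arg_cong[OF inv(2), of transpose] by (simp add: matrix_transpose_mul sym0 transpose_mat)
    then show ?thesis using matrix_inv_eqI by metis
  qed
  have H0: "H 0 = mat 1" by (simp add: H_def P_def R0 transpose_mat inv)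
  obtain W V and g :: "real ^ 'n ^ 'n \<Rightarrow> real ^ 'n ^ 'n" and g' where g:
    "open W" "mat 1 \<in> W" "open V" "mat 1 \<in> V" "\<And>Y. Y \<in> V \<Longrightarrow> g Y \<in> W \<and> g Y ** g Y = Y" "g (mat 1) = mat 1"
    "\<And>Y Z. Y \<in> W \<Longrightarrow> Z \<in> W \<Longrightarrow> Y ** Y = Z ** Z \<Longrightarrow> Y = Z" "(g has_derivative g') (at (mat 1))"
    by (rule matrix_sqrt) (rule that)
  define F where "F \<tau> = g (H \<tau>)" for \<tau>
  have F0: "F 0 = mat 1" by (simp add: F_def H0 g)
  \<comment> \<open>As \<open>H\<close> is stationary at 0, the chain rule uses nothing about
    \<open>g'\<close> beyond linearity.\<close>
  have F: "mderiv F 0"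
  proof -
    have "(H has_derivative (\<lambda>h. h *\<^sub>R 0)) (at 0)"
      using H by (simp add: mderiv_has_vector_derivative has_vector_derivative_def)
    from has_derivative_compose[OF this, of g g'] have "(F has_derivative (\<lambda>h. g' (h *\<^sub>R 0))) (at 0)"
      using g(8) by (simp add: H0 F_def[abs_def])
    then show ?thesis
      using linear_0[OF has_derivative_linear[OF g(8)]] by (simp add: mderiv_has_vector_derivative has_vector_derivative_def)
  qed
  have cont: "(A \<longlongrightarrow> A 0) (at 0)" if "mderiv A A'" for A :: "real \<Rightarrow> real ^ 'n ^ 'n" and A'
    using that mderiv_has_vector_derivative has_vector_derivative_continuous by (metis isCont_def)
  have evV: "\<forall>\<^sub>F \<tau> in at 0. H \<tau> \<in> V"
    using cont[OF H] g(3,4) by (simp add: H0 topological_tendstoD)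
  \<comment> \<open>The adjoint of \<open>F \<tau>\<close> with respect to the bilinear form
    \<open>G 0\<close>. It tends to the identity and so enters the set \<open>W\<close> in which
    square roots are unique.\<close>
  define F' where "F' \<tau> = ?I ** transpose (F \<tau>) ** G 0" for \<tau>
  have "transpose (0 :: real ^ 'n ^ 'n) = 0" by (simp add: transpose_def vec_eq_iff)
  then have "mderiv F' 0"
    unfolding F'_def using mderiv_mult[OF mderiv_mult[OF mderiv_const[of ?I] mderiv_transpose[OF F]] mderiv_const[of "G 0"]]
    by simp
  moreover have "F' 0 = mat 1" by (simp add: F'_def F0 transpose_mat inv)
  ultimately have evW: "\<forall>\<^sub>F \<tau> in at 0. F' \<tau> \<in> W"
    using cont[of F' 0] g(1,2) by (simp add: topological_tendstoD)
  have evF: "\<forall>\<^sub>F \<tau> in at 0. transpose (F \<tau>) ** G 0 ** F \<tau> = P \<tau>"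
    using evV evW sym
  proof eventually_elim
    case (elim \<tau>)
    have FF: "F \<tau> ** F \<tau> = H \<tau>" "F \<tau> \<in> W" using g(5)[OF elim(1)] by (auto simp: F_def)
    have Psym: "transpose (P \<tau>) = P \<tau>" by (simp add: P_def matrix_transpose_mul elim(3) matrix_mul_assoc)
    have GH: "G 0 ** H \<tau> = P \<tau>" by (simp add: H_def matrix_mul_assoc inv)
    have "F' \<tau> ** F' \<tau> = ?I ** transpose (F \<tau>) ** (G 0 ** ?I) ** transpose (F \<tau>) ** G 0"
      unfolding F'_def by (simp only: matrix_mul_assoc)
    also have "\<dots> = ?I ** transpose (F \<tau> ** F \<tau>) ** G 0"
      by (simp add: inv matrix_transpose_mul matrix_mul_assoc)
    also have "\<dots> = ?I ** P \<tau> ** (?I ** G 0)"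
      by (simp add: FF H_def matrix_transpose_mul Psym Isym matrix_mul_assoc)
    also have "\<dots> = H \<tau>" by (simp add: inv H_def)
    finally have "F' \<tau> = F \<tau>" using g(7)[OF elim(2) FF(2)] FF(1) by simp
    then have "G 0 ** F \<tau> = (G 0 ** ?I) ** transpose (F \<tau>) ** G 0"
      unfolding F'_def by (simp only: matrix_mul_assoc[symmetric])
    then have "transpose (F \<tau>) ** G 0 = G 0 ** F \<tau>" by (simp add: inv)
    then have "transpose (F \<tau>) ** G 0 ** F \<tau> = G 0 ** (F \<tau> ** F \<tau>)" by (simp add: matrix_mul_assoc)
    then show ?case by (simp add: FF GH)
  qed
  define L where "L \<tau> = F \<tau> ** matrix_inv (R \<tau>)" for \<tau>
  show ?thesis
  proof (rule that[of L])
    show "L 0 = mat 1" using matrix_inv_eqI[of "mat 1" "mat 1"] by (simp add: L_def F0 R0)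
    show "\<forall>\<^sub>F \<tau> in at 0. transpose (L \<tau>) ** G 0 ** L \<tau> = G \<tau>"
      using evF mderiv_inverse(1)[OF R R0]
    proof eventually_elim
      case (elim \<tau>)
      let ?K = "matrix_inv (R \<tau>)"
      have RK: "R \<tau> ** ?K = mat 1" by (rule invertible_matrix_inv(1)[OF elim(2)])
      have "transpose (L \<tau>) ** G 0 ** L \<tau> = transpose ?K ** (transpose (F \<tau>) ** G 0 ** F \<tau>) ** ?K"
        by (simp add: L_def matrix_transpose_mul matrix_mul_assoc)
      also have "\<dots> = transpose (R \<tau> ** ?K) ** G \<tau> ** (R \<tau> ** ?K)"
        unfolding elim(1) P_def by (simp add: matrix_transpose_mul matrix_mul_assoc)
      finally show ?case by (simp add: RK transpose_mat)
    qed
    show "mderiv L (- N)"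
      unfolding L_def using mderiv_mult[OF F mderiv_inverse(2)[OF R R0]] by (simp add: F0)
  qed
qed

lemma (in chart_domain) pd_line:
  assumes f: "csm c U f" and u: "u \<in> U"
  shows "((\<lambda>\<tau>. f (chart_inv c (snd c u + \<tau> *\<^sub>R axis a 1))) has_real_derivative pd c a f u) (at 0)"
proof -
  let ?l = "\<lambda>\<tau>. snd c u + \<tau> *\<^sub>R axis a 1"
  have l: "(?l has_derivative (\<lambda>h. h *\<^sub>R axis a 1)) (at 0)" by (auto intro!: derivative_eq_intros)
  let ?D = "frechet_derivative (\<lambda>y. f (chart_inv c y)) (at (snd c u))"
  have D: "((\<lambda>y. f (chart_inv c y)) has_derivative ?D) (at (?l 0))"
    using csm_has_derivative[OF f u] by simp
  have "((\<lambda>\<tau>. f (chart_inv c (?l \<tau>))) has_derivative (\<lambda>h. ?D (h *\<^sub>R axis a 1))) (at 0)"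
    by (rule has_derivative_compose[OF l D])
  moreover have "?D (h *\<^sub>R axis a 1) = pd c a f u * h" for h
    using linear_cmul[OF has_derivative_linear[OF D]] by (simp add: pd_def mult.commute)
  ultimately show ?thesis by (simp add: has_field_derivative_def)
qed

text \<open>Elements of a fibre vanish at multi-indices of the wrong length, values of
  \<open>cd\<close> and \<open>sharp\<close> need not; \<open>restr\<close> mediates between the two
  conventions.\<close>

definition restr :: "nat \<Rightarrow> ('n list \<Rightarrow> real) \<Rightarrow> 'n list \<Rightarrow> real" where
  "restr n t is = (if length is = n then t is else 0)"

lemma tensor_act_id:
  assumes "\<And>is. length is \<noteq> length \<Phi> \<Longrightarrow> t is = 0"
  shows "tensor_act \<Phi> (mat 1) t = t"
proof
  fix js
  have "matrix_inv (mat 1 :: real ^ 'a ^ 'a) = mat 1" by (rule matrix_inv_eqI) simp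
  then show "tensor_act \<Phi> (mat 1) t js = t js"
    using tensor_act_eq_act2[of js \<Phi>] act2_id[of js \<Phi>] assms[of js] by (cases "length js = length \<Phi>") (auto simp: tensor_act_def)
qed

section \<open>Stability of an invariant bundle under covariant differentiation\<close>

locale bundle_manifold = metric_manifold B h
  for B :: "('a::{t2_space, second_countable_topology}, 'k::finite) chart set" and h :: "('a, 'k) tfield" +
  fixes \<Phi> :: "index_pos list" and V :: "'a \<Rightarrow> ('a, 'k) tensor set"
  assumes invariant: "tensor_bundle B h \<Phi> V"
begin

lemma V_tensor: "s \<in> V u \<Longrightarrow> s \<in> tensor_space B \<Phi> u"
  using invariant unfolding tensor_bundle_def by blast

lemma V_zero: "(\<lambda>_ _. 0) \<in> V u"
  using invariant unfolding tensor_bundle_def by blast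

lemma V_lin: "s \<in> V u \<Longrightarrow> t \<in> V u \<Longrightarrow> (\<lambda>c is. a * s c is + b * t c is) \<in> V u"
  using invariant unfolding tensor_bundle_def by blast

lemma V_isometry:
  "c \<in> B \<Longrightarrow> d \<in> B \<Longrightarrow> u \<in> fst c \<Longrightarrow> v \<in> fst d \<Longrightarrow> transpose L ** gmat h v d ** L = gmat h u c \<Longrightarrow>
    s \<in> V u \<Longrightarrow> t \<in> tensor_space B \<Phi> v \<Longrightarrow> t d = tensor_act \<Phi> L (s c) \<Longrightarrow> t \<in> V v"
  using invariant unfolding tensor_bundle_def by blast

text \<open>Passing to components in one chart makes the fibre a subspace of functions supported on
  finitely many multi-indices, so that limits can be taken with
  \<open>subspace_limit\<close>.\<close>

definition fibre :: "('a, 'k) chart \<Rightarrow> 'a \<Rightarrow> ('k list \<Rightarrow> real) set" where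
  "fibre c u = (\<lambda>s. s c) ` V u"

lemma fibre_zero: "(\<lambda>_. 0) \<in> fibre c u"
  unfolding fibre_def using V_zero by (rule rev_image_eqI) simp

lemma fibre_lin:
  assumes "s \<in> fibre c u" "t \<in> fibre c u"
  shows "(\<lambda>is. a * s is + b * t is) \<in> fibre c u"
proof -
  obtain s' t' where st: "s' \<in> V u" "t' \<in> V u" "s = s' c" "t = t' c" using assms by (auto simp: fibre_def)
  show ?thesis unfolding fibre_def st(3,4) by (rule rev_image_eqI[OF V_lin[OF st(1,2)]]) simp
qed

lemma fibre_support:
  assumes "s \<in> fibre c u" "length is \<noteq> length \<Phi>"
  shows "s is = 0"
proof -
  obtain s' where "s' \<in> tensor_space B \<Phi> u" "s = s' c" using assms(1) V_tensor by (auto simp: fibre_def)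
  then show ?thesis using assms(2) unfolding tensor_space_def by blast
qed

lemma fibre_sum:
  assumes "\<And>i. i \<in> I \<Longrightarrow> T i \<in> fibre c u"
  shows "(\<lambda>is. \<Sum>i\<in>I. f i * T i is) \<in> fibre c u"
  using assms
proof (induction I rule: infinite_finite_induct)
  case (insert i I)
  then have "(\<lambda>is. f i * T i is + 1 * (\<Sum>i\<in>I. f i * T i is)) \<in> fibre c u"
    by (intro fibre_lin) auto
  then show ?case using insert(1,2) by simp
qed (simp_all add: fibre_zero)

lemma jac_self:
  assumes "c \<in> B" "u \<in> fst c"
  shows "jac c c u = mat 1"
proof -
  interpret chart_pair c c "fst c \<inter> fst c" using pair assms by blast
  have u: "u \<in> fst c \<inter> fst c" using assms by simp
  show ?thesis using C.pd_coord[OF u] by (simp add: vec_eq_iff jac_pd[OF u] mat_def)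
qed

text \<open>The prescribed components are pushed to the other charts by Jacobians, consistently by
  the cocycle identity. It is needed because the invariance of \<open>V\<close> speaks about
  tensors, whereas isometries act on components.\<close>

lemma tensor_space_realize:
  assumes c: "c \<in> B" "u \<in> fst c" and \<tau>: "\<And>is. length is \<noteq> length \<Phi> \<Longrightarrow> \<tau> is = 0"
  shows "\<exists>t\<in>tensor_space B \<Phi> u. t c = \<tau>"
proof -
  define t where "t e = (if e \<in> B \<and> u \<in> fst e then tensor_act \<Phi> (jac c e u) \<tau> else (\<lambda>_. 0))" for e
  have "t c = \<tau>" using c \<tau> by (simp add: t_def jac_self tensor_act_id)
  moreover have "t \<in> tensor_space B \<Phi> u"
    unfolding tensor_space_def
  proof (intro CollectI conjI allI ballI impI)
    fix d e assume de: "d \<in> B" "e \<in> B" "u \<in> fst d \<and> u \<in> fst e"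
    have cocycle: "jac c e u = jac d e u ** jac c d u" if "c \<in> B" "d \<in> B" "e \<in> B" "u \<in> fst c" "u \<in> fst d" "u \<in> fst e" for c d e
    proof (rule jac_cocycle)
      let ?U = "fst c \<inter> fst d \<inter> fst e"
      have "open ?U" using smooth_atlas_open[OF atlas] that by blast
      then show "chart_pair c d ?U" "chart_pair c e ?U" "chart_pair d e ?U"
        using that by (auto intro!: smooth_atlas_chart_pair[OF atlas])
    qed (use that in auto)
    show "t e = tensor_act \<Phi> (jac d e u) (t d)"
    proof
      fix js
      show "t e js = tensor_act \<Phi> (jac d e u) (t d) js"
      proof (cases "length js = length \<Phi>")
        case True
        have inv: "matrix_inv (jac d e u) = jac e d u" if "d \<in> B" "e \<in> B" "u \<in> fst d" "u \<in> fst e" for d e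
          using chart_pair.jac_inv[OF pair] that by simp
        have "tensor_act \<Phi> (jac d e u) (t d) js = act2 \<Phi> (jac d e u) (jac e d u) (act2 \<Phi> (jac c d u) (jac d c u) \<tau>) js"
          unfolding tensor_act_eq_act2[OF True] inv[OF de(1,2) conjunct1[OF de(3)] conjunct2[OF de(3)]]
          by (rule act2_cong) (use de c in \<open>simp add: t_def tensor_act_eq_act2 inv\<close>)
        also have "\<dots> = act2 \<Phi> (jac c e u) (jac e c u) \<tau> js"
          using de c cocycle[of c d e] cocycle[of e d c] by (simp add: act2_mult[OF True])
        also have "\<dots> = t e js"
          using de c by (simp add: t_def tensor_act_eq_act2[OF True] inv)
        finally show ?thesis by simp
      qed (use de in \<open>simp add: t_def tensor_act_def\<close>)
    qed
  qed (auto simp: t_def tensor_act_def)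
  ultimately show ?thesis by blast
qed

text \<open>Components in one chart decide membership: invariance is applied to the identity, an
  isometry of the tangent space at \<open>u\<close>.\<close>

lemma in_V:
  assumes c: "c \<in> B" "u \<in> fst c" and t: "t \<in> tensor_space B \<Phi> u" "t c \<in> fibre c u"
  shows "t \<in> V u"
proof -
  obtain s where s: "s \<in> V u" "t c = s c" using t(2) by (auto simp: fibre_def)
  have "t c = tensor_act \<Phi> (mat 1) (s c)"
    using tensor_act_id[of \<Phi> "s c"] fibre_support[OF t(2)] s(2) by simp
  then show ?thesis
    by (intro V_isometry[OF c(1) c(1) c(2) c(2) _ s(1) t(1), of "mat 1"]) (simp_all add: transpose_mat)
qed

lemma fibre_isometry:
  assumes c: "c \<in> B" and d: "d \<in> B" and u: "u \<in> fst c" and v: "v \<in> fst d"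
    and L: "transpose L ** gmat h v d ** L = gmat h u c" and \<tau>: "\<tau> \<in> fibre c u"
  shows "tensor_act \<Phi> L \<tau> \<in> fibre d v"
proof -
  obtain s where s: "s \<in> V u" "\<tau> = s c" using \<tau> by (auto simp: fibre_def)
  obtain t where t: "t \<in> tensor_space B \<Phi> v" "t d = tensor_act \<Phi> L (s c)"
    using tensor_space_realize[OF d v, of "tensor_act \<Phi> L (s c)"] by (auto simp: tensor_act_def)
  have "t \<in> V v" by (rule V_isometry[OF c d u v L s(1) t])
  then show ?thesis unfolding fibre_def s(2) t(2)[symmetric] by (rule imageI)
qed

text \<open>Transport \<open>T \<tau>\<close> to the fixed fibre at \<open>u\<close> by the isometries of \<open>isometry_path\<close> and differentiate
  there, using that the fibre is closed.\<close>

lemma fibre_derivative: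
  assumes c: "c \<in> B" and u: "u \<in> fst c" and x0: "x 0 = u" and x: "\<forall>\<^sub>F \<tau> in at 0. x \<tau> \<in> fst c"
    and G: "mderiv (\<lambda>\<tau>. gmat h (x \<tau>) c) G'"
    and N: "transpose N ** gmat h u c + gmat h u c ** N + G' = 0"
    and T: "\<forall>\<^sub>F \<tau> in at 0. T \<tau> \<in> fibre c (x \<tau>)" and T0: "T 0 \<in> fibre c u"
    and T': "\<And>is. length is = length \<Phi> \<Longrightarrow> ((\<lambda>\<tau>. T \<tau> is) has_real_derivative T' is) (at 0)"
  shows "restr (length \<Phi>) (\<lambda>is. T' is - sharp \<Phi> N (T 0) is) \<in> fibre c u"
proof -
  have ev: "\<forall>\<^sub>F \<tau> in at 0. transpose (gmat h (x \<tau>) c) = gmat h (x \<tau>) c"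
    using x by eventually_elim (use nondegenerate[OF c] in blast)
  obtain L where L0: "L 0 = mat 1" and L: "\<forall>\<^sub>F \<tau> in at 0. transpose (L \<tau>) ** gmat h (x 0) c ** L \<tau> = gmat h (x \<tau>) c"
    and L': "mderiv L (- N)"
    by (rule isometry_path[OF ev _ _ G, of N]) (use nondegenerate[OF c u] N x0 in auto)
  let ?s = "\<lambda>\<tau>. tensor_act \<Phi> (L \<tau>) (T \<tau>)"
  let ?W = "fibre c u"
  have s0: "?s 0 = T 0" unfolding L0 by (rule tensor_act_id) (rule fibre_support[OF T0])
  have sW: "\<forall>\<^sub>F \<tau> in at 0. ?s \<tau> \<in> ?W"
    using L T x by eventually_elim (rule fibre_isometry[OF c c _ u], auto simp: x0)
  let ?q = "\<lambda>\<tau> is. (1 / \<tau>) * ?s \<tau> is + (- (1 / \<tau>)) * ?s 0 is"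
  show ?thesis
  proof (rule subspace_limit[where I="{is. length is = length \<Phi>}" and F="at (0::real)" and f="?q"])
    show "finite {is :: 'k list. length is = length \<Phi>}"
      using finite_lists_length_eq[of "UNIV :: 'k set" "length \<Phi>"] by simp
    show "\<forall>\<^sub>F \<tau> in at 0. ?q \<tau> \<in> ?W"
      using sW by eventually_elim (rule fibre_lin, assumption, simp only: s0 T0)
    fix js
    show "((\<lambda>\<tau>. ?q \<tau> js) \<longlongrightarrow> restr (length \<Phi>) (\<lambda>is. T' is - sharp \<Phi> N (T 0) is) js) (at 0)"
    proof (cases "length js = length \<Phi>")
      case True
      let ?K = "\<lambda>\<tau>. matrix_inv (L \<tau>)"
      have K0: "?K 0 = mat 1" unfolding L0 by (rule matrix_inv_eqI) simp
      have D: "((\<lambda>\<tau>. act2 \<Phi> (L \<tau>) (?K \<tau>) (T \<tau>) js) has_derivative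
        (\<lambda>h. sharp \<Phi> ((h *\<^sub>R (- N)) ** ?K 0) (act2 \<Phi> (L 0) (?K 0) (T 0)) js + act2 \<Phi> (L 0) (?K 0) (\<lambda>is. h * T' is) js)) (at 0)"
      proof (rule act2_has_derivative)
        show "((\<lambda>\<tau>. L \<tau> $ i $ j) has_derivative (\<lambda>h. (h *\<^sub>R (- N)) $ i $ j)) (at 0)" for i j
          by (rule has_derivative_eq_rhs[OF mderivD[OF L', unfolded has_field_derivative_def]]) (simp add: fun_eq_iff)
        show "((\<lambda>\<tau>. ?K \<tau> $ i $ j) has_derivative (\<lambda>h. - (?K 0 ** (h *\<^sub>R (- N)) ** ?K 0) $ i $ j)) (at 0)" for i j
          by (rule has_derivative_eq_rhs[OF mderivD[OF mderiv_inverse(2)[OF L' L0], unfolded has_field_derivative_def]])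
            (simp add: fun_eq_iff K0)
        show "((\<lambda>\<tau>. T \<tau> is) has_derivative (\<lambda>h. h * T' is)) (at 0)" if "length is = length \<Phi>" for "is"
          by (rule has_derivative_eq_rhs[OF T'[OF that, unfolded has_field_derivative_def]]) (simp add: fun_eq_iff)
      qed (use True K0 in \<open>simp_all add: L0\<close>)
      have E: "sharp \<Phi> ((h *\<^sub>R (- N)) ** ?K 0) (act2 \<Phi> (L 0) (?K 0) (T 0)) js + act2 \<Phi> (L 0) (?K 0) (\<lambda>is. h * T' is) js =
          (T' js - sharp \<Phi> N (T 0) js) * h" for h
      proof -
        have "sharp \<Phi> N (act2 \<Phi> (mat 1) (mat 1) (T 0)) js = sharp \<Phi> N (T 0) js"
          by (rule sharp_cong) (use True in \<open>simp add: act2_id\<close>)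
        then show ?thesis
          unfolding K0 unfolding L0 act2_id[OF True] matrix_mul_rid sharp_scale_left sharp_minus_left by (simp add: algebra_simps)
      qed
      have "((\<lambda>\<tau>. act2 \<Phi> (L \<tau>) (?K \<tau>) (T \<tau>) js) has_real_derivative (T' js - sharp \<Phi> N (T 0) js)) (at 0)"
        unfolding has_field_derivative_def by (rule has_derivative_eq_rhs[OF D]) (rule ext, rule E)
      then show ?thesis
        using True by (simp add: DERIV_def restr_def tensor_act_eq_act2 diff_divide_distrib)
    qed (simp add: restr_def tensor_act_def)
  qed (use fibre_zero fibre_lin fibre_support in auto)
qed

definition vfield :: "('a, 'k) chart \<Rightarrow> ('a \<Rightarrow> 'k list \<Rightarrow> real) \<Rightarrow> bool" where
  "vfield c T \<longleftrightarrow> (\<forall>x\<in>fst c. restr (length \<Phi>) (T x) \<in> fibre c x)"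

text \<open>This is \<open>fibre_derivative\<close> along the coordinate line in direction
  \<open>a\<close> with \<open>N = - conn h c a u\<close>: the required relation between
  \<open>N\<close> and the derivative of the metric is \<open>metric_compat\<close>, and subtracting
  the action of \<open>N\<close> adds the Christoffel term.\<close>

lemma vfield_cd:
  assumes c: "c \<in> B" and T: "tsm c (fst c) (length \<Phi>) T" and v: "vfield c T"
  shows "vfield c (cd h c \<Phi> a T)"
  unfolding vfield_def
proof
  fix u assume u: "u \<in> fst c"
  interpret chart_metric c "fst c" h using metric_fst c by blast
  define x where "x \<tau> = chart_inv c (snd c u + \<tau> *\<^sub>R axis a 1)" for \<tau>
  have x0: "x 0 = u" using u by (simp add: x_def)
  have "((\<lambda>\<tau>. snd c u + \<tau> *\<^sub>R axis a 1) \<longlongrightarrow> snd c u + 0 *\<^sub>R axis a 1) (at (0::real))"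
    by (intro tendsto_intros)
  then have "\<forall>\<^sub>F \<tau> in at 0. snd c u + \<tau> *\<^sub>R axis a 1 \<in> snd c ` fst c"
    using open_image u by (intro topological_tendstoD) auto
  then have xc: "\<forall>\<^sub>F \<tau> in at 0. x \<tau> \<in> fst c"
    by eventually_elim (auto simp: x_def)
  have "restr (length \<Phi>) (\<lambda>is. pd c a (\<lambda>x. T x is) u - sharp \<Phi> (- conn h c a u) (restr (length \<Phi>) (T (x 0))) is) \<in> fibre c u"
  proof (rule fibre_derivative[where x=x and T="\<lambda>\<tau>. restr (length \<Phi>) (T (x \<tau>))"])
    show "mderiv (\<lambda>\<tau>. gmat h (x \<tau>) c) (\<chi> i j. pd c a (\<lambda>x. h x c [i, j]) u)"
      unfolding mderiv_def x_def using pd_line[OF h_csm u] by (simp add: gmat_def)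
    show "transpose (- conn h c a u) ** gmat h u c + gmat h u c ** (- conn h c a u) + (\<chi> i j. pd c a (\<lambda>x. h x c [i, j]) u) = 0"
      by (simp add: vec_eq_iff matrix_mult_nth transpose_def gmat_def metric_compat[OF u] sum_negf mult.commute)
    show "\<forall>\<^sub>F \<tau> in at 0. restr (length \<Phi>) (T (x \<tau>)) \<in> fibre c (x \<tau>)"
      using xc by eventually_elim (use v in \<open>auto simp: vfield_def\<close>)
    show "restr (length \<Phi>) (T (x 0)) \<in> fibre c u" using v u by (simp add: x0 vfield_def)
    show "((\<lambda>\<tau>. restr (length \<Phi>) (T (x \<tau>)) is) has_real_derivative pd c a (\<lambda>x. T x is) u) (at 0)" if "length is = length \<Phi>" for "is"
      using pd_line[OF tsmD[OF T that] u, of a] that by (simp add: restr_def x_def)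
  qed (use c u x0 xc in auto)
  moreover have "restr (length \<Phi>) (\<lambda>is. pd c a (\<lambda>x. T x is) u - sharp \<Phi> (- conn h c a u) (restr (length \<Phi>) (T (x 0))) is) = restr (length \<Phi>) (cd h c \<Phi> a T u)"
  proof
    fix "is"
    have "length is = length \<Phi> \<Longrightarrow> sharp \<Phi> (conn h c a u) (restr (length \<Phi>) (T u)) is = sharp \<Phi> (conn h c a u) (T u) is"
      by (rule sharp_cong) (simp add: restr_def)
    then show "restr (length \<Phi>) (\<lambda>is. pd c a (\<lambda>x. T x is) u - sharp \<Phi> (- conn h c a u) (restr (length \<Phi>) (T (x 0))) is) is = restr (length \<Phi>) (cd h c \<Phi> a T u) is"
      by (auto simp: restr_def x0 cd_def sharp_minus_left)
  qed
  ultimately show "restr (length \<Phi>) (cd h c \<Phi> a T u) \<in> fibre c u" by simp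
qed

text \<open>A skew endomorphism is an infinitesimal isometry. Formally this is
  \<open>fibre_derivative\<close> for the constant path with constant \<open>t\<close>, where the
  metric has derivative 0.\<close>

lemma fibre_sharp_skew:
  assumes c: "c \<in> B" and u: "u \<in> fst c" and N: "transpose N ** gmat h u c + gmat h u c ** N = 0"
    and t: "restr (length \<Phi>) t \<in> fibre c u"
  shows "restr (length \<Phi>) (sharp \<Phi> N t) \<in> fibre c u"
proof -
  have "restr (length \<Phi>) (\<lambda>is. 0 - sharp \<Phi> N (restr (length \<Phi>) t) is) \<in> fibre c u"
    by (rule fibre_derivative[OF c u, where x="\<lambda>_. u" and G'=0]) (use u N t mderiv_const in auto)
  then have "(\<lambda>is. (- 1) * restr (length \<Phi>) (\<lambda>is. 0 - sharp \<Phi> N (restr (length \<Phi>) t) is) is + 0 * 0) \<in> fibre c u"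
    by (rule fibre_lin[OF _ fibre_zero])
  moreover have "sharp \<Phi> N (restr (length \<Phi>) t) is = sharp \<Phi> N t is" if "length is = length \<Phi>" for "is"
    by (rule sharp_cong) (simp add: restr_def that)
  then have "(\<lambda>is. (- 1) * restr (length \<Phi>) (\<lambda>is. 0 - sharp \<Phi> N (restr (length \<Phi>) t) is) is + 0 * 0) = restr (length \<Phi>) (sharp \<Phi> N t)"
    by (auto simp: restr_def)
  ultimately show ?thesis by simp
qed

text \<open>In terms of \<open>cd\<close>, where the direction is a label, the Laplacian is a linear
  combination of first and second derivatives of \<open>T\<close>, and each of these stays in the
  fibre.\<close>

lemma vfield_lapc:
  assumes c: "c \<in> B" and T: "tsm c (fst c) (length \<Phi>) T" and v: "vfield c T"
  shows "vfield c (lapc h c \<Phi> T)"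
  unfolding vfield_def
proof
  fix u assume u: "u \<in> fst c"
  interpret chart_metric c "fst c" h using metric_fst c by blast
  let ?r = "restr (length \<Phi>)"
  let ?H = "\<lambda>a b is. 1 * ?r (cd h c \<Phi> a (cd h c \<Phi> b T) u) is + (- 1) * (\<Sum>e\<in>UNIV. \<Gamma> u e a b * ?r (cd h c \<Phi> e T u) is)"
  have v1: "vfield c (cd h c \<Phi> b T)" for b by (rule vfield_cd[OF c T v])
  have v2: "vfield c (cd h c \<Phi> a (cd h c \<Phi> b T))" for a b by (rule vfield_cd[OF c tsm_cd[OF T] v1])
  have "?H a b \<in> fibre c u" for a b
    using v1 v2 u unfolding vfield_def by (intro fibre_lin fibre_sum) auto
  then have "(\<lambda>is. \<Sum>a\<in>UNIV. 1 * (\<Sum>b\<in>UNIV. gi u a b * ?H a b is)) \<in> fibre c u"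
    by (intro fibre_sum[where T="\<lambda>a is. \<Sum>b\<in>UNIV. gi u a b * ?H a b is"] fibre_sum)
  moreover have "(\<lambda>is. \<Sum>a\<in>UNIV. 1 * (\<Sum>b\<in>UNIV. gi u a b * ?H a b is)) = ?r (lapc h c \<Phi> T u)"
    by (rule ext) (simp add: restr_def lapc_def covd_Cons cd_covd)
  ultimately show "?r (lapc h c \<Phi> T u) \<in> fibre c u" by simp
qed

text \<open>Only the part of \<open>h\<^sup>i\<^sup>f \<delta>\<^sub>j\<^sup>b\<close> that is skew in \<open>f, b\<close> contributes, and it is a skew endomorphism.\<close>

lemma vfield_curvc:
  assumes c: "c \<in> B" and v: "vfield c T"
  shows "vfield c (curvc h c \<Phi> T)"
  unfolding vfield_def
proof
  fix u assume u: "u \<in> fst c"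
  interpret chart_metric c "fst c" h using metric_fst c by blast
  let ?r = "restr (length \<Phi>)"
  let ?E = "\<lambda>f b. (\<chi> i j. gi u i f * kron j b) :: real ^ 'k ^ 'k"
  let ?T = "\<lambda>f b. sharp \<Phi> (curv h c f b u) (T u)"
  have A: "?r (?T f b) \<in> fibre c u" for f b
  proof (rule fibre_sharp_skew[OF c u])
    show "transpose (curv h c f b u) ** gmat h u c + gmat h u c ** curv h c f b u = 0"
      using riemann_skew[OF u, of f b]
      by (simp add: vec_eq_iff matrix_mult_nth transpose_def gmat_def mult.commute)
  qed (use v u in \<open>auto simp: vfield_def\<close>)
  have E: "transpose (?E f b - ?E b f) ** gmat h u c + gmat h u c ** (?E f b - ?E b f) = 0" for f b
  proof -
    have 1: "(\<Sum>i\<in>UNIV. gi u i f * kron e b * g u i d) = kron e b * kron f d" for e d f b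
    proof -
      have "(\<Sum>i\<in>UNIV. gi u i f * kron e b * g u i d) = kron e b * (\<Sum>i\<in>UNIV. gi u f i * g u i d)"
        unfolding sum_distrib_left by (intro sum.cong refl) (simp add: gi_sym[OF u, of f])
      then show ?thesis by (simp add: gi_g[OF u])
    qed
    have 2: "(\<Sum>i\<in>UNIV. g u e i * (gi u i f * kron d b)) = kron e f * kron d b" for e d f b
      by (simp add: g_gi[OF u] mult.assoc[symmetric] sum_distrib_right[symmetric])
    show ?thesis
      by (simp add: vec_eq_iff matrix_mult_nth transpose_def gmat_def left_diff_distrib right_diff_distrib sum_subtractf 1 2 kron_sym)
  qed
  have skew: "?r (sharp \<Phi> (?E f b - ?E b f) (?T f b)) \<in> fibre c u" for f b
    by (rule fibre_sharp_skew[OF c u E A])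
  have "(\<lambda>is. \<Sum>f\<in>UNIV. 1 * (\<Sum>b\<in>UNIV. (1/2) * ?r (sharp \<Phi> (?E f b - ?E b f) (?T f b)) is)) \<in> fibre c u"
    using skew by (intro fibre_sum[where T="\<lambda>f is. \<Sum>b\<in>UNIV. (1/2) * ?r (sharp \<Phi> (?E f b - ?E b f) (?T f b)) is"] fibre_sum)
  moreover have "(\<Sum>f\<in>UNIV. 1 * (\<Sum>b\<in>UNIV. (1/2) * ?r (sharp \<Phi> (?E f b - ?E b f) (?T f b)) is)) = ?r (curvc h c \<Phi> T u) is" for "is"
  proof (cases "length is = length \<Phi>")
    case True
    \<comment> \<open>Antisymmetry of the curvature turns the transposed part into a second copy of
      \<open>curvc\<close>, which accounts for the factor 1/2.\<close>
    have "sharp \<Phi> (?E b f) (?T f b) is = - sharp \<Phi> (?E b f) (?T b f) is" for f b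
    proof -
      have "curv h c f b u = - curv h c b f u" by (simp add: vec_eq_iff riemann_antisym[of u f b])
      then have "?T f b = (\<lambda>ks. (- 1) * ?T b f ks)" by (simp add: fun_eq_iff sharp_minus_left)
      then show ?thesis using sharp_scale_right[of \<Phi> "?E b f" "-1" "?T b f" "is"] by simp
    qed
    then have "(\<Sum>f\<in>UNIV. \<Sum>b\<in>UNIV. sharp \<Phi> (?E b f) (?T f b) is) = - curvc h c \<Phi> T u is"
      unfolding curvc_def by (subst sum.swap) (simp add: sum_negf)
    then show ?thesis
      using True by (simp add: restr_def sharp_diff_left sum_divide_distrib[symmetric] sum_subtractf) (simp add: curvc_def)
  qed (simp add: restr_def)
  ultimately show "?r (curvc h c \<Phi> T u) \<in> fibre c u" by simp
qed

lemma laplacian_alpha_sections: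
  assumes S: "S \<in> sections B \<Phi> V"
  shows "laplacian_alpha B h \<Phi> \<alpha> S \<in> sections B \<Phi> V"
proof -
  have Sf: "S \<in> tensor_field B \<Phi>" and SV: "\<And>u. S u \<in> V u" using S by (auto simp: sections_def)
  have Lf: "laplacian_alpha B h \<Phi> \<alpha> S \<in> tensor_field B \<Phi>" by (rule laplacian_alpha_field[OF Sf])
  have "laplacian_alpha B h \<Phi> \<alpha> S u \<in> V u" for u
  proof -
    obtain c where c: "c \<in> B" "u \<in> fst c" using smooth_atlas_cover[OF atlas] by blast
    let ?r = "restr (length \<Phi>)" and ?S = "\<lambda>x. S x c"
    have "?r (S x c) = S x c" for x
      using field_zero[OF Sf] by (auto simp: restr_def fun_eq_iff)
    then have v: "vfield c ?S" using SV by (auto simp: vfield_def fibre_def)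
    have "(\<lambda>is. 1 * ?r (lapc h c \<Phi> ?S u) is + \<alpha> * ?r (curvc h c \<Phi> ?S u) is) \<in> fibre c u"
      using vfield_lapc[OF c(1) field_tsm[OF Sf c(1)] v] vfield_curvc[OF c(1) v] c(2)
      by (intro fibre_lin) (auto simp: vfield_def)
    moreover have "(\<lambda>is. 1 * ?r (lapc h c \<Phi> ?S u) is + \<alpha> * ?r (curvc h c \<Phi> ?S u) is) = laplacian_alpha B h \<Phi> \<alpha> S u c"
      using laplacian_alpha_eq[OF c] by (auto simp: restr_def fun_eq_iff laplacian_alpha_zero)
    ultimately have "laplacian_alpha B h \<Phi> \<alpha> S u c \<in> fibre c u" by simp
    then show ?thesis using in_V[OF c] Lf by (auto simp: tensor_field_def)
  qed
  then show ?thesis using Lf by (simp add: sections_def)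
qed

lemma laplacian_alpha_power_sections: "S \<in> sections B \<Phi> V \<Longrightarrow> (laplacian_alpha B h \<Phi> \<alpha> ^^ m) S \<in> sections B \<Phi> V"
  by (induction m) (auto intro: laplacian_alpha_sections)

lemma sections_lincomb:
  assumes "S \<in> sections B \<Phi> V" "T \<in> sections B \<Phi> V"
  shows "lincomb a S b T \<in> sections B \<Phi> V"
  using assms lincomb_field[of S \<Phi> T a b] V_lin unfolding sections_def lincomb_def by auto

end

section \<open>Division by a defining function\<close>

text \<open>A weighted average of \<open>f\<close> over the segment from the projection of
  \<open>z\<close> to the hyperplane of vanishing coordinate \<open>a\<close> up to \<open>z\<close>
  itself: that coordinate is multiplied by \<open>s\<close>. For \<open>j = 0\<close> this is the
  integral in Hadamard's lemma.\<close>

definition proj_int :: "'n::finite \<Rightarrow> nat \<Rightarrow> (real ^ 'n \<Rightarrow> real) \<Rightarrow> real ^ 'n \<Rightarrow> real" where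
  "proj_int a j f z = integral {0..1} (\<lambda>s. s ^ j * f (z - ((1 - s) * z $ a) *\<^sub>R axis a 1))"

text \<open>The centre lies in the hyperplane, so shrinking the coordinate \<open>a\<close> does not
  increase the distance to the centre.\<close>

lemma proj_in_ball:
  fixes z :: "real ^ 'n"
  assumes "z \<in> ball z0 r" "z0 $ a = 0" "0 \<le> s" "s \<le> 1"
  shows "z - ((1 - s) * z $ a) *\<^sub>R axis a 1 \<in> ball z0 r"
proof -
  let ?w = "z - ((1 - s) * z $ a) *\<^sub>R axis a 1 - z0"
  have "norm ?w \<le> norm (z - z0)"
  proof (rule norm_le_componentwise_cart)
    fix i
    show "norm (?w $ i) \<le> norm ((z - z0) $ i)"
    proof (cases "i = a")
      case True
      then have "?w $ i = s * z $ a" using assms(2) by (simp add: axis_def algebra_simps)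
      then show ?thesis using True assms by (simp add: abs_mult mult_left_le_one_le)
    qed (simp add: axis_def)
  qed
  then show ?thesis using assms(1) by (simp add: dist_norm norm_minus_commute)
qed

lemma linear_proj:
  fixes D :: "real ^ 'n \<Rightarrow> real"
  assumes l: "linear D"
  shows "linear (\<lambda>v. k * D (v - ((1 - s) * v $ a) *\<^sub>R axis a 1))"
    and "D (v - ((1 - s) * v $ a) *\<^sub>R axis a 1) = D (v - (v $ a) *\<^sub>R axis a 1) + s * v $ a * D (axis a 1)"
proof -
  show "D (v - ((1 - s) * v $ a) *\<^sub>R axis a 1) = D (v - (v $ a) *\<^sub>R axis a 1) + s * v $ a * D (axis a 1)" for v
    by (simp add: linear_diff[OF l] linear_add[OF l] linear_cmul[OF l] algebra_simps)
  then show "linear (\<lambda>v. k * D (v - ((1 - s) * v $ a) *\<^sub>R axis a 1))"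
    by (intro linearI) (simp_all add: linear_diff[OF l] linear_add[OF l] linear_cmul[OF l] algebra_simps)
qed

text \<open>The functions \<open>proj_int a j f\<close> form a class closed under differentiation, which is why the power
  \<open>s ^ j\<close> is carried along.\<close>

lemma proj_int_has_derivative:
  fixes f :: "real ^ 'n \<Rightarrow> real"
  assumes f: "smooth_on (ball z0 r) f" and z0: "z0 $ a = 0" and z: "z \<in> ball z0 r"
  shows "(proj_int a j f has_derivative (\<lambda>v. proj_int a j (\<lambda>y. frechet_derivative f (at y) (v - (v $ a) *\<^sub>R axis a 1)) z +
    v $ a * proj_int a (Suc j) (\<lambda>y. frechet_derivative f (at y) (axis a 1)) z)) (at z)"
proof -
  let ?B = "ball z0 r" and ?e = "axis a 1 :: real ^ 'n"
  let ?P = "\<lambda>s z. z - ((1 - s) * z $ a) *\<^sub>R ?e"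
  let ?D = "\<lambda>y v. frechet_derivative f (at y) v"
  have PB: "?P s y \<in> ?B" if "y \<in> ?B" "s \<in> {0..1}" for s y using proj_in_ball[OF that(1) z0] that(2) by auto
  have Dlin: "linear (?D y)" if "y \<in> ?B" for y
    using has_derivative_linear[OF smooth_on_has_derivative[OF f that]] .
  have cP: "continuous_on (?B \<times> {0..1}) (\<lambda>(y, s). ?P s y)"
    unfolding case_prod_unfold by (intro continuous_intros)
  have cD: "continuous_on (?B \<times> {0..1}) (\<lambda>(y, s). ?D (?P s y) v)" for v
  proof -
    have "continuous_on ?B (\<lambda>y. ?D y v)" using f by (intro smooth_on_continuous smooth_on_deriv)
    from continuous_on_compose2[OF this cP] show ?thesis using PB by (fastforce simp: case_prod_unfold)
  qed
  have cint: "(\<lambda>s. s ^ i * ?D (?P s z) v) integrable_on {0..1}" for i v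
  proof (rule integrable_continuous_interval, rule continuous_on_mult)
    have "continuous_on {0..1} (\<lambda>s. (z, s :: real))" by (intro continuous_intros)
    moreover have "(\<lambda>s. (z, s)) ` {0..1} \<subseteq> ?B \<times> {0..1 :: real}" using z by auto
    ultimately show "continuous_on {0..1} (\<lambda>s. ?D (?P s z) v)"
      using continuous_on_compose2[OF cD[of v]] by fastforce
  qed (intro continuous_intros)
  \<comment> \<open>The derivative of the integrand with respect to the point, at parameter
    \<open>s\<close>, as a bounded linear map; this is the form in which \<open>leibniz_rule\<close>
    takes it.\<close>
  define fx where "fx y s = Blinfun (\<lambda>v. s ^ j * ?D (?P s y) (v - ((1 - s) * v $ a) *\<^sub>R ?e))" for y s
  have fx: "blinfun_apply (fx y s) v = s ^ j * (?D (?P s y) (v - (v $ a) *\<^sub>R ?e) + s * v $ a * ?D (?P s y) ?e)"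
    and fx2: "blinfun_apply (fx y s) v = s ^ j * ?D (?P s y) (v - ((1 - s) * v $ a) *\<^sub>R ?e)"
    if "y \<in> ?B" "s \<in> {0..1}" for y s v
  proof -
    have l: "linear (?D (?P s y))" using Dlin PB that by blast
    from linear_proj(1)[OF l] show 1: "blinfun_apply (fx y s) v = s ^ j * ?D (?P s y) (v - ((1 - s) * v $ a) *\<^sub>R ?e)" for v
      unfolding fx_def by (simp add: bounded_linear_Blinfun_apply linear_conv_bounded_linear)
    show "blinfun_apply (fx y s) v = s ^ j * (?D (?P s y) (v - (v $ a) *\<^sub>R ?e) + s * v $ a * ?D (?P s y) ?e)"
      unfolding 1 linear_proj(2)[OF l] ..
  qed
  have cfx: "continuous_on (?B \<times> cbox 0 1) (\<lambda>(y, s). fx y s)"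
  proof (rule continuous_on_blinfun_componentwise)
    fix v :: "real ^ 'n"
    have "continuous_on (?B \<times> cbox 0 1) (\<lambda>x. snd x ^ j * ((case x of (y, s) \<Rightarrow> ?D (?P s y) (v - (v $ a) *\<^sub>R ?e)) + snd x * v $ a * (case x of (y, s) \<Rightarrow> ?D (?P s y) ?e)))"
      using cD by (intro continuous_intros) simp_all
    then show "continuous_on (?B \<times> cbox 0 1) (\<lambda>x. blinfun_apply (case x of (y, s) \<Rightarrow> fx y s) v)"
      by (rule continuous_on_eq) (auto simp: fx)
  qed
  have "((\<lambda>y. integral (cbox 0 1) (\<lambda>s. s ^ j * f (?P s y))) has_derivative integral (cbox 0 1) (fx z)) (at z within ?B)"
  proof (rule leibniz_rule[OF _ _ cfx z convex_ball])
    fix y s assume y: "y \<in> ?B" and s: "s \<in> cbox (0::real) 1"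
    have P: "(?P s has_derivative (\<lambda>v. v - ((1 - s) * v $ a) *\<^sub>R ?e)) (at y)"
      by (auto intro!: derivative_eq_intros bounded_linear_imp_has_derivative[OF bounded_linear_vec_nth])
    have "(f has_derivative ?D (?P s y)) (at (?P s y))"
      using smooth_on_has_derivative[OF f PB[OF y]] s by simp
    note * = has_derivative_mult_right[OF has_derivative_compose[OF P this], of "s ^ j"]
    have "((\<lambda>y. s ^ j * f (?P s y)) has_derivative blinfun_apply (fx y s)) (at y)"
    proof -
      have "blinfun_apply (fx y s) = (\<lambda>v. s ^ j * ?D (?P s y) (v - ((1 - s) * v $ a) *\<^sub>R ?e))"
        by (rule ext, rule fx2[OF y]) (use s in simp)
      then show ?thesis using * by simp
    qed
    then show "((\<lambda>y. s ^ j * f (?P s y)) has_derivative blinfun_apply (fx y s)) (at y within ?B)"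
      by (rule has_derivative_at_withinI)
  next
    fix y assume y: "y \<in> ?B"
    have "continuous_on {0..1} (\<lambda>s. ?P s y)" by (intro continuous_intros)
    moreover have "(\<lambda>s. ?P s y) ` {0..1} \<subseteq> ?B" using PB[OF y] by blast
    ultimately have "continuous_on {0..1} (\<lambda>s. f (?P s y))"
      by (rule continuous_on_compose2[OF smooth_on_continuous[OF f]])
    then show "(\<lambda>s. s ^ j * f (?P s y)) integrable_on cbox 0 1"
      by (intro integrable_continuous continuous_on_mult continuous_intros) simp_all
  qed
  then have 1: "(proj_int a j f has_derivative integral (cbox 0 1) (fx z)) (at z)"
    using z by (simp add: proj_int_def[abs_def] at_within_open[OF z open_ball])
  have "continuous_on (cbox 0 1) (fx z)"
  proof -
    have "continuous_on (cbox 0 1) (\<lambda>s. (z, s :: real))" by (intro continuous_intros)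
    moreover have "(\<lambda>s. (z, s)) ` cbox 0 1 \<subseteq> ?B \<times> cbox 0 (1 :: real)" using z by auto
    ultimately have "continuous_on (cbox 0 1) (\<lambda>s. case (z, s) of (y, s) \<Rightarrow> fx y s)"
      by (rule continuous_on_compose2[OF cfx])
    then show ?thesis by simp
  qed
  then have ifx: "fx z integrable_on cbox 0 1" by (rule integrable_continuous)
  have 2: "blinfun_apply (integral (cbox 0 1) (fx z)) v = proj_int a j (\<lambda>y. ?D y (v - (v $ a) *\<^sub>R ?e)) z + v $ a * proj_int a (Suc j) (\<lambda>y. ?D y ?e) z" for v
  proof -
    have "blinfun_apply (integral (cbox 0 1) (fx z)) v = integral (cbox 0 1) (\<lambda>s. blinfun_apply (fx z s) v)"
      using integral_linear[OF ifx, of "\<lambda>F. blinfun_apply F v"] by (simp add: o_def blinfun.bounded_linear_left)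
    also have "\<dots> = integral {0..1} (\<lambda>s. s ^ j * ?D (?P s z) (v - (v $ a) *\<^sub>R ?e) + v $ a * (s ^ Suc j * ?D (?P s z) ?e))"
      unfolding cbox_interval by (rule integral_cong) (simp add: fx[OF z] algebra_simps)
    also have "\<dots> = integral {0..1} (\<lambda>s. s ^ j * ?D (?P s z) (v - (v $ a) *\<^sub>R ?e)) + integral {0..1} (\<lambda>s. v $ a * (s ^ Suc j * ?D (?P s z) ?e))"
      by (rule integral_add) (intro integrable_on_mult_right cint)+
    finally show ?thesis by (simp add: proj_int_def)
  qed
  show ?thesis by (rule has_derivative_eq_rhs[OF 1]) (rule ext, rule 2)
qed

lemma proj_int_smooth:
  fixes f :: "real ^ 'n \<Rightarrow> real"
  assumes f: "smooth_on (ball z0 r) f" and z0: "z0 $ a = 0"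
  shows "smooth_on (ball z0 r) (proj_int a j f)"
  unfolding smooth_on_def
proof
  fix k show "Ck_on k (ball z0 r) (proj_int a j f)"
    using f
  proof (induction k arbitrary: f j)
    case 0
    have "isCont (proj_int a j f) z" if "z \<in> ball z0 r" for z
      using proj_int_has_derivative[OF 0 z0 that] has_derivative_continuous by blast
    then show ?case by (auto intro: continuous_at_imp_continuous_on)
  next
    case (Suc k)
    show ?case
    proof (rule Ck_on_SucI[OF open_ball proj_int_has_derivative[OF Suc.prems z0]])
      show "Ck_on k (ball z0 r) (\<lambda>z. proj_int a j (\<lambda>y. frechet_derivative f (at y) (v - (v $ a) *\<^sub>R axis a 1)) z +
        v $ a * proj_int a (Suc j) (\<lambda>y. frechet_derivative f (at y) (axis a 1)) z)" for v
        by (intro Ck_on_add Ck_on_mult open_ball Ck_on_const Suc.IH smooth_on_deriv Suc.prems)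
    qed
  qed
qed

text \<open>The fundamental theorem of calculus along the segment, at whose lower end
  \<open>f\<close> vanishes; the chain rule produces the factor \<open>z $ a\<close>.\<close>

lemma proj_int_factor:
  fixes f :: "real ^ 'n \<Rightarrow> real"
  assumes f: "smooth_on (ball z0 r) f" and z0: "z0 $ a = 0" and z: "z \<in> ball z0 r"
    and v: "\<And>y. y \<in> ball z0 r \<Longrightarrow> y $ a = 0 \<Longrightarrow> f y = 0"
  shows "f z = z $ a * proj_int a 0 (\<lambda>y. frechet_derivative f (at y) (axis a 1)) z"
proof -
  let ?P = "\<lambda>s. z - ((1 - s) * z $ a) *\<^sub>R axis a 1 :: real ^ 'n"
  let ?D = "\<lambda>y. frechet_derivative f (at y)"
  have PB: "?P s \<in> ball z0 r" if "s \<in> {0..1}" for s using proj_in_ball[OF z z0] that by auto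
  have H: "((\<lambda>s. z $ a * ?D (?P s) (axis a 1)) has_integral (f (?P 1) - f (?P 0))) {0..1}"
  proof (rule fundamental_theorem_of_calculus)
    fix s :: real assume s: "s \<in> {0..1}"
    have P: "(?P has_derivative (\<lambda>h. h *\<^sub>R (z $ a *\<^sub>R axis a 1))) (at s)"
      by (auto intro!: derivative_eq_intros simp: algebra_simps)
    have D: "(f has_derivative ?D (?P s)) (at (?P s))" by (rule smooth_on_has_derivative[OF f PB[OF s]])
    have "((\<lambda>s. f (?P s)) has_derivative (\<lambda>h. ?D (?P s) (h *\<^sub>R (z $ a *\<^sub>R axis a 1)))) (at s)"
      by (rule has_derivative_compose[OF P D])
    then have "((\<lambda>s. f (?P s)) has_vector_derivative z $ a * ?D (?P s) (axis a 1)) (at s)"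
      unfolding has_vector_derivative_def by (simp add: linear_cmul[OF has_derivative_linear[OF D]] mult.assoc)
    then show "((\<lambda>s. f (?P s)) has_vector_derivative z $ a * ?D (?P s) (axis a 1)) (at s within {0..1})"
      by (rule has_vector_derivative_at_within)
  qed simp
  have Z: "f (?P 0) = 0" by (rule v[OF PB]) (simp_all add: axis_def)
  have "integral {0..1} (\<lambda>s. z $ a * ?D (?P s) (axis a 1)) = f z"
    by (rule trans[OF integral_unique[OF H]]) (use Z in simp)
  then show ?thesis by (simp add: proj_int_def)
qed

text \<open>The map \<open>\<phi>\<close> replaces the coordinate \<open>y $ a\<close> by \<open>F y\<close>, which reduces the claim to division by a coordinate.\<close>

lemma hadamard_division:
  fixes F f :: "real ^ 'n \<Rightarrow> real"
  assumes \<Omega>: "open \<Omega>" and F: "smooth_on \<Omega> F" and f: "smooth_on \<Omega> f"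
    and v: "\<And>y. y \<in> \<Omega> \<Longrightarrow> F y = 0 \<Longrightarrow> f y = 0"
    and y0: "y0 \<in> \<Omega>" "F y0 = 0" "frechet_derivative F (at y0) (axis a 1) \<noteq> 0"
  obtains N u where "open N" "y0 \<in> N" "N \<subseteq> \<Omega>" "smooth_on N u" "\<And>y. y \<in> N \<Longrightarrow> f y = F y * u y"
proof -
  let ?e = "axis a 1 :: real ^ 'n" and ?D = "\<lambda>y. frechet_derivative F (at y)"
  define \<Omega>' where "\<Omega>' = {y \<in> \<Omega>. ?D y ?e \<noteq> 0}"
  have FD: "(F has_derivative ?D y) (at y)" if "y \<in> \<Omega>" for y by (rule smooth_on_has_derivative[OF F that])
  have Dsm: "smooth_on \<Omega> (\<lambda>y. ?D y v)" for v by (rule smooth_on_deriv[OF F])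
  have "open ((\<lambda>y. ?D y ?e) -` (- {0}) \<inter> \<Omega>)"
    using continuous_on_open_vimage[OF \<Omega>] smooth_on_continuous[OF Dsm] by blast
  moreover have "(\<lambda>y. ?D y ?e) -` (- {0}) \<inter> \<Omega> = \<Omega>'" by (auto simp: \<Omega>'_def)
  ultimately have o: "open \<Omega>'" by simp
  have y0': "y0 \<in> \<Omega>'" using y0 by (simp add: \<Omega>'_def)
  have sub: "\<Omega>' \<subseteq> \<Omega>" by (auto simp: \<Omega>'_def)
  define \<phi> where "\<phi> y = y + (F y - y $ a) *\<^sub>R ?e" for y
  define \<phi>' where "\<phi>' y = Blinfun (\<lambda>v. v + (?D y v - v $ a) *\<^sub>R ?e)" for y
  have \<phi>': "blinfun_apply (\<phi>' y) v = v + (?D y v - v $ a) *\<^sub>R ?e" if "y \<in> \<Omega>" for y v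
  proof -
    note l = has_derivative_linear[OF FD[OF that]]
    have "linear (\<lambda>v. v + (?D y v - v $ a) *\<^sub>R ?e)"
      by (rule linearI) (simp_all add: linear_add[OF l] linear_cmul[OF l] algebra_simps)
    then show ?thesis unfolding \<phi>'_def by (simp add: bounded_linear_Blinfun_apply linear_conv_bounded_linear)
  qed
  have \<phi>_der: "(\<phi> has_derivative blinfun_apply (\<phi>' y)) (at y)" if "y \<in> \<Omega>'" for y
  proof -
    have y: "y \<in> \<Omega>" using that sub by blast
    have "(\<phi> has_derivative (\<lambda>v. v + (?D y v - v $ a) *\<^sub>R ?e)) (at y)"
      unfolding \<phi>_def[abs_def]
      by (auto intro!: derivative_eq_intros FD[OF y] bounded_linear_imp_has_derivative[OF bounded_linear_vec_nth])
    then show ?thesis by (rule has_derivative_eq_rhs) (rule ext, simp add: \<phi>'[OF y])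
  qed
  have \<phi>_cont: "continuous_on \<Omega>' \<phi>'"
  proof (rule continuous_on_blinfun_componentwise)
    fix v
    have "continuous_on \<Omega>' (\<lambda>y. v + (?D y v - v $ a) *\<^sub>R ?e)"
      by (intro continuous_intros continuous_on_subset[OF smooth_on_continuous[OF Dsm] sub])
    then show "continuous_on \<Omega>' (\<lambda>y. blinfun_apply (\<phi>' y) v)"
      by (rule continuous_on_eq) (use sub in \<open>auto simp: \<phi>'\<close>)
  qed
  have "inj (blinfun_apply (\<phi>' y0))"
  proof (subst linear_injective_0[OF bounded_linear.linear[OF blinfun.bounded_linear_right]], intro allI impI)
    fix v assume "blinfun_apply (\<phi>' y0) v = 0"
    then have e: "v + (?D y0 v - v $ a) *\<^sub>R ?e = 0" using \<phi>' y0 by simp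
    then have "(v + (?D y0 v - v $ a) *\<^sub>R ?e) $ a = 0" by simp
    then have D: "?D y0 v = 0" by (simp add: axis_def)
    then have "v = (v $ a) *\<^sub>R ?e" using e by (simp add: algebra_simps)
    then have "?D y0 v = v $ a * ?D y0 ?e"
      using linear_cmul[OF has_derivative_linear[OF FD[OF y0(1)]], of "v $ a" ?e] by simp
    then show "v = 0" using D y0(3) \<open>v = (v $ a) *\<^sub>R ?e\<close> by simp
  qed
  then obtain I where I: "linear I" "I \<circ> blinfun_apply (\<phi>' y0) = id"
    using linear_injective_left_inverse[OF bounded_linear.linear[OF blinfun.bounded_linear_right]] by blast
  have I': "Blinfun I o\<^sub>L \<phi>' y0 = id_blinfun"
    using I by (intro blinfun_eqI) (simp add: bounded_linear_Blinfun_apply linear_conv_bounded_linear fun_eq_iff)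
  obtain U' W g g' where g: "open U'" "U' \<subseteq> \<Omega>'" "y0 \<in> U'" "open W" "\<phi> y0 \<in> W" "homeomorphism U' W \<phi> g"
    "\<And>z. z \<in> W \<Longrightarrow> (g has_derivative (g' z)) (at z)" "\<And>z. z \<in> W \<Longrightarrow> g' z = inv (blinfun_apply (\<phi>' (g z)))"
    "\<And>z. z \<in> W \<Longrightarrow> bij (blinfun_apply (\<phi>' (g z)))"
    by (rule inverse_function_theorem[OF o \<phi>_der \<phi>_cont y0' I']) (blast+)?
  have gU: "g z \<in> U'" "\<phi> (g z) = z" if "z \<in> W" for z using g(6) that unfolding homeomorphism_def by blast+
  have g\<phi>: "g (\<phi> y) = y" "\<phi> y \<in> W" if "y \<in> U'" for y using g(6) that unfolding homeomorphism_def by blast+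
  have \<phi>a: "\<phi> y $ a = F y" for y by (simp add: \<phi>_def axis_def)
  \<comment> \<open>The preimage of \<open>w\<close> under the derivative of \<open>\<phi>\<close>
    differs from \<open>w\<close> by a multiple of \<open>?e\<close>, and the multiple is fixed by
    the condition that the derivative of \<open>F\<close> equals \<open>w $ a\<close>.\<close>
  have g'_eq: "g' z w = w + ((w $ a - ?D (g z) w) / ?D (g z) ?e) *\<^sub>R ?e" if z: "z \<in> W" for z w
  proof -
    let ?y = "g z"
    have y: "?y \<in> \<Omega>" "?D ?y ?e \<noteq> 0" using gU[OF z] g(2) by (auto simp: \<Omega>'_def)
    note l = has_derivative_linear[OF FD[OF y(1)]]
    have "blinfun_apply (\<phi>' ?y) (w + ((w $ a - ?D ?y w) / ?D ?y ?e) *\<^sub>R ?e) = w"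
      unfolding \<phi>'[OF y(1)] using y(2) by (simp add: linear_add[OF l] linear_cmul[OF l] vec_eq_iff axis_def)
    then show ?thesis unfolding g(8)[OF z] using g(9)[OF z] by (metis bij_inv_eq_iff)
  qed
  \<comment> \<open>Bootstrapping: \<open>g'\<close> is a smooth expression in \<open>g\<close>, so
    each degree of differentiability of \<open>g\<close> gives the next one.\<close>
  have "Ck_on k W g" for k
  proof (induction k)
    case 0
    then show ?case using g(7) by (auto intro!: continuous_at_imp_continuous_on has_derivative_continuous)
  next
    case (Suc k)
    show ?case
    proof (rule Ck_on_SucI[OF g(4) g(7)])
      fix w
      have im: "g ` W \<subseteq> \<Omega>'" using gU(1) g(2) by blast
      have D: "Ck_on k W (\<lambda>z. ?D (g z) v)" for v
        using smooth_on_subset[OF Dsm sub] im unfolding smooth_on_def by (intro Ck_on_compose[OF g(4) _ Suc.IH]) auto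
      have "Ck_on k W (\<lambda>z. w + ((w $ a + (- 1) * ?D (g z) w) * inverse (?D (g z) ?e)) *\<^sub>R ?e)"
        by (intro Ck_on_add g(4) Ck_on_const Ck_on_bounded_linear[OF g(4) bounded_linear_scaleR_left] Ck_on_mult Ck_on_inverse D)
          (use im in \<open>auto simp: \<Omega>'_def\<close>)
      then show "Ck_on k W (\<lambda>z. g' z w)"
        by (subst Ck_on_cong[OF g(4) g'_eq]) (simp_all add: divide_inverse)
    qed
  qed
  then have gs: "smooth_on W g" by (simp add: smooth_on_def)
  \<comment> \<open>In a ball the segments used by \<open>proj_int\<close> stay inside, provided its
    centre is in the hyperplane, which is \<open>F y0 = 0\<close>.\<close>
  obtain r where r: "0 < r" "ball (\<phi> y0) r \<subseteq> W" using g(4,5) openE by blast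
  let ?B = "ball (\<phi> y0) r"
  have z0: "\<phi> y0 $ a = 0" by (simp add: \<phi>a y0(2))
  let ?h = "\<lambda>z. f (g z)"
  have hs: "smooth_on ?B ?h"
    by (rule smooth_on_compose[OF open_ball f smooth_on_subset[OF gs r(2)]]) (use gU g(2) sub r in blast)
  have hv: "?h z = 0" if "z \<in> ?B" "z $ a = 0" for z
  proof (rule v)
    have z: "z \<in> W" using that r by blast
    show "g z \<in> \<Omega>" using gU[OF z] g(2) sub by blast
    show "F (g z) = 0" using \<phi>a[of "g z"] gU(2)[OF z] that by simp
  qed
  let ?u = "proj_int a 0 (\<lambda>y. frechet_derivative ?h (at y) ?e)"
  have us: "smooth_on ?B ?u" by (rule proj_int_smooth[OF smooth_on_deriv[OF hs] z0])
  define N where "N = \<phi> -` ?B \<inter> U'"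
  have "continuous_on U' \<phi>" using g(6) by (simp add: homeomorphism_def)
  then have No: "open N" unfolding N_def using continuous_on_open_vimage[OF g(1)] open_ball by blast
  show ?thesis
  proof (rule that[of N "\<lambda>y. ?u (\<phi> y)"])
    show "y0 \<in> N" using g(3) r by (simp add: N_def)
    show "N \<subseteq> \<Omega>" using g(2) sub by (auto simp: N_def)
    have NO: "N \<subseteq> \<Omega>" by fact
    have "smooth_on N \<phi>"
      unfolding smooth_on_def
    proof
      fix k
      show "Ck_on k N \<phi>"
        unfolding \<phi>_def[abs_def]
      proof (intro Ck_on_add No Ck_on_ident Ck_on_bounded_linear[OF No bounded_linear_scaleR_left])
        have "Ck_on k N (\<lambda>y. F y + (- 1) * y $ a)"
          using smooth_on_subset[OF F NO] unfolding smooth_on_def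
          by (intro Ck_on_add Ck_on_mult No Ck_on_const Ck_on_nth Ck_on_ident) blast
        then show "Ck_on k N (\<lambda>y. F y - y $ a)" by simp
      qed
    qed
    then show "smooth_on N (\<lambda>y. ?u (\<phi> y))"
      by (rule smooth_on_compose[OF No us]) (auto simp: N_def)
    fix y assume y: "y \<in> N"
    then have "?h (\<phi> y) = \<phi> y $ a * ?u (\<phi> y)"
      by (intro proj_int_factor[OF hs z0 _ hv]) (auto simp: N_def)
    then show "f y = F y * ?u (\<phi> y)" using y g\<phi>(1)[of y] by (simp add: \<phi>a N_def)
  qed (rule No)
qed

lemma (in chart_domain) csm_act2:
  assumes "\<And>i j. csm c U (\<lambda>x. A x $ i $ j)" "\<And>i j. csm c U (\<lambda>x. K x $ i $ j)"
    "\<And>is. length is = length \<Phi> \<Longrightarrow> csm c U (\<lambda>x. t x is)" "length js = length \<Phi>"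
  shows "csm c U (\<lambda>x. act2 \<Phi> (A x) (K x) (t x) js)"
  using assms(3,4)
proof (induction \<Phi> arbitrary: t js)
  case (Cons \<phi> \<Phi>)
  have "csm c U (\<lambda>x. act_coeff \<phi> (A x) (K x) j i)" for i j
    using assms(1,2) by (cases \<phi>) (simp_all add: act_coeff_def)
  moreover have "csm c U (\<lambda>x. act2 \<Phi> (A x) (K x) (\<lambda>is. t x (i # is)) (tl js))" for i
    using Cons.prems by (intro Cons.IH) auto
  ultimately show ?case by (simp add: csm_sum csm_mult)
qed simp

section \<open>Division of tensor fields by Q and descent to its zero set\<close>

context euler_manifold
begin

lemma local_quotient:
  assumes c: "c \<in> B" and f: "csm c (fst c) f" and v: "\<And>x. x \<in> fst c \<Longrightarrow> Q x = 0 \<Longrightarrow> f x = 0"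
    and p: "p \<in> fst c"
  obtains N u where "open N" "p \<in> N" "N \<subseteq> fst c" "csm c N u" "\<And>x. x \<in> N \<Longrightarrow> f x = Q x * u x"
proof -
  interpret chart_domain c "fst c" by (rule domain[OF c])
  show ?thesis
  proof (cases "Q p = 0")
    case False
    have "open (Q -` (- {0}) \<inter> fst c)"
      using continuous_on_open_vimage[OF open_U] csm_continuous[OF Q_chart[OF c]] by blast
    then interpret N: chart_domain c "Q -` (- {0}) \<inter> fst c"
      by (rule chart_domain_subset[OF chart_domain_axioms]) auto
    show ?thesis
    proof (rule that[of "Q -` (- {0}) \<inter> fst c" "\<lambda>x. f x / Q x"])
      show "csm c (Q -` (- {0}) \<inter> fst c) (\<lambda>x. f x / Q x)"
        by (intro N.csm_divide csm_subset[OF f] csm_subset[OF Q_chart[OF c]]) auto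
    qed (use N.open_U p False in auto)
  next
    case True
    obtain a where "pd c a Q p \<noteq> 0" using Q_regular[OF c p True] by blast
    then have d: "frechet_derivative (\<lambda>y. Q (chart_inv c y)) (at (snd c p)) (axis a 1) \<noteq> 0" by (simp add: pd_def)
    obtain M u where M: "open M" "snd c p \<in> M" "M \<subseteq> snd c ` fst c" "smooth_on M u"
      "\<And>y. y \<in> M \<Longrightarrow> f (chart_inv c y) = Q (chart_inv c y) * u y"
      by (rule hadamard_division[OF open_image _ _ _ _ _ d, of "\<lambda>y. f (chart_inv c y)"])
        (use f Q_chart[OF c] v p True in \<open>auto simp: csm_def\<close>)
    let ?N = "snd c -` M \<inter> fst c"
    have "continuous_on (fst c) (snd c)" using homeo by (simp add: homeomorphism_def)
    then have No: "open ?N" using continuous_on_open_vimage[OF open_U] M(1) by blast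
    then interpret N: chart_domain c ?N
      by (rule chart_domain_subset[OF chart_domain_axioms]) auto
    have im: "snd c ` ?N \<subseteq> M" by auto
    show ?thesis
    proof (rule that[OF No _ _ , of "\<lambda>x. u (snd c x)"])
      have "smooth_on (snd c ` ?N) (\<lambda>y. u (snd c (chart_inv c y))) \<longleftrightarrow> smooth_on (snd c ` ?N) u"
        by (rule smooth_on_cong[OF N.open_image]) auto
      then show "csm c ?N (\<lambda>x. u (snd c x))"
        unfolding csm_def using smooth_on_subset[OF M(4) im] by blast
      show "f x = Q x * u (snd c x)" if "x \<in> ?N" for x using M(5)[of "snd c x"] that by simp
    qed (use p M in auto)
  qed
qed

text \<open>An explicit pointwise quotient avoids gluing the local ones: it is smooth because near
  each point it agrees with the quotient from \<open>local_quotient\<close>, and it transforms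
  correctly off the zeros of \<open>Q\<close>, hence everywhere by
  \<open>zero_off_zeros\<close>.\<close>

lemma division:
  assumes S: "S \<in> tensor_field B \<Phi>" and v: "\<And>x. Q x = 0 \<Longrightarrow> S x = (\<lambda>_ _. 0)"
  obtains T where "T \<in> tensor_field B \<Phi>" "S = fmult Q T"
proof -
  \<comment> \<open>On the zero set the value of the quotient is forced by \<open>\<partial>\<^sub>a(Q T) = (\<partial>\<^sub>a Q) T\<close>.\<close>
  define b where "b c p = (SOME a. pd c a Q p \<noteq> 0)" for c :: "('a, 'k) chart" and p
  define T where "T p c is = (if c \<in> B \<and> p \<in> fst c then
    (if Q p \<noteq> 0 then S p c is / Q p else pd c (b c p) (\<lambda>x. S x c is) p / pd c (b c p) Q p) else 0)" for p c "is"
  have sm: "csm c (fst c) (\<lambda>x. S x c is)" if "c \<in> B" for c "is"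
    using S that by (simp add: tensor_field_def csm_def)
  have Tsm: "csm c (fst c) (\<lambda>x. T x c is)" if c: "c \<in> B" for c "is"
  proof (rule csm_local[OF domain[OF c]])
    fix p assume p: "p \<in> fst c"
    interpret chart_domain c "fst c" by (rule domain[OF c])
    obtain N u where N: "open N" "p \<in> N" "N \<subseteq> fst c" "csm c N u" "\<And>x. x \<in> N \<Longrightarrow> S x c is = Q x * u x"
      by (rule local_quotient[OF c sm[OF c, of "is"] _ p]) (use v in auto)
    interpret N: chart_domain c N by (rule smooth_atlas_chart_domain[OF atlas c N(1,3)])
    have "T x c is = u x" if x: "x \<in> N" for x
    proof (cases "Q x = 0")
      case True
      have xc: "x \<in> fst c" using x N by blast
      have nz: "pd c (b c x) Q x \<noteq> 0" unfolding b_def using Q_regular[OF c xc True] by (rule someI_ex)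
      have "pd c a (\<lambda>x. S x c is) x = pd c a (\<lambda>x. Q x * u x) x" for a
        by (rule N.pd_cong[OF x N(5)])
      also have "\<dots> a = pd c a Q x * u x" for a
        using N.pd_mult[OF csm_subset[OF Q_chart[OF c] N(3)] N(4) x] True by simp
      finally show ?thesis using nz True c xc by (simp add: T_def)
    qed (use N c x in \<open>auto simp: T_def\<close>)
    then have "csm c N (\<lambda>x. T x c is)" using N(4) by (subst N.csm_cong[of _ u]) auto
    then show "\<exists>V. open V \<and> p \<in> V \<and> V \<subseteq> fst c \<and> csm c V (\<lambda>x. T x c is)" using N by blast
  qed
  have QT: "S p c is = Q p * T p c is" if "c \<in> B" "p \<in> fst c" for p c "is"
    using that v[of p] by (cases "Q p = 0") (auto simp: T_def)
  have z: "T p c is = 0" if "\<not> (c \<in> B \<and> p \<in> fst c \<and> length is = length \<Phi>)" for p c "is"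
  proof (cases "c \<in> B \<and> p \<in> fst c")
    case True
    then have "(\<lambda>x. S x c is) = (\<lambda>x. 0)" using that field_zero[OF S] by auto
    then show ?thesis
      using chart_domain.pd_const[OF domain, of c] True field_zero[OF S that] by (simp add: T_def)
  qed (auto simp: T_def)
  have "T \<in> tensor_field B \<Phi>"
  proof (rule fieldI)
    fix c d x and js :: "'k list" assume cd: "c \<in> B" "d \<in> B" and x: "x \<in> fst c" "x \<in> fst d" and l: "length js = length \<Phi>"
    interpret chart_pair d c "fst d \<inter> fst c" using pair cd by blast
    interpret cd: chart_pair c d "fst d \<inter> fst c" using chart_pair_axioms chart_pair_sym by blast
    let ?f = "\<lambda>x. T x d js - act2 \<Phi> (jac c d x) (jac d c x) (T x c) js"
    have "?f x = 0"
    proof (rule zero_off_zeros[OF cd(1)])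
      show "open (fst d \<inter> fst c)" by (rule C.open_U)
      show "csm c (fst d \<inter> fst c) ?f"
        by (intro D.csm_diff csm_change D.csm_act2 csm_subset[OF Tsm[OF cd(2)]] csm_subset[OF Tsm[OF cd(1)]] csm_jac cd.csm_jac l) auto
      fix y assume y: "y \<in> fst d \<inter> fst c" "Q y \<noteq> 0"
      have "Q y * T y d js = act2 \<Phi> (jac c d y) (jac d c y) (\<lambda>is. Q y * T y c is) js"
      proof -
        have "S y c = (\<lambda>is. Q y * T y c is)" by (rule ext, rule QT[OF cd(1)]) (use y in simp)
        then show ?thesis using field_law[OF S cd _ _ l, of y] y QT[OF cd(2), of y js] by simp
      qed
      then show "?f y = 0" using y(2) by (simp add: act2_scale)
    qed (use x in auto)
    then show "T x d js = act2 \<Phi> (jac c d x) (jac d c x) (T x c) js" by simp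
  qed (use Tsm z in \<open>auto simp: tsm_def\<close>)
  moreover from this have "S = fmult Q T"
    by (intro field_eqI[OF S fmult_field[OF Q_smooth]]) (simp_all add: QT fmult_def tscale_def)
  ultimately show ?thesis by (rule that)
qed

text \<open>The hypothesis \<open>wm\<close> is \<open>w = m - n/2\<close> with \<open>n + 2\<close> the dimension; it makes the last coefficient in
  \<open>laplacian_power_fmult\<close> vanish.\<close>

lemma tangential_power:
  assumes S: "S \<in> tensor_field B \<Phi>" and w: "weight \<Phi> w (fmult Q S)" and m: "1 \<le> m"
    and wm: "2 * w = 2 * real m + 2 - real CARD('k)"
  shows "(laplacian_alpha B h \<Phi> \<alpha> ^^ m) (fmult Q S) = fmult Q ((laplacian_alpha B h \<Phi> \<alpha> ^^ m) S)"
proof -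
  obtain n where n: "m = Suc n" using m by (cases m) auto
  have "4 * (w - 2) + 2 * real CARD('k) - 4 * real n = 0" using wm n by simp
  then show ?thesis
    using laplacian_power_fmult[OF S weight_quotient[OF S w], where m=n and \<alpha>=\<alpha>] unfolding n by (simp add: lincomb_def)
qed

lemma weight_lincomb:
  assumes S: "S \<in> tensor_field B \<Phi>" "weight \<Phi> w S" and T: "T \<in> tensor_field B \<Phi>" "weight \<Phi> w T"
  shows "weight \<Phi> w (lincomb a S b T)"
  unfolding weight_def
proof (intro ballI allI impI)
  fix c p and "is" :: "'k list" assume c: "c \<in> B" and p: "p \<in> fst c" and l: "length is = length \<Phi>"
  interpret chart_ambient c "fst c" h "XX c" Q using ambient c by blast
  note tS = field_tsm[OF S(1) c] and tT = field_tsm[OF T(1) c]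
  have "cX h c (XX c) \<Phi> (\<lambda>x. lincomb a S b T x c) p is = a * cX h c (XX c) \<Phi> (\<lambda>x. S x c) p is + b * cX h c (XX c) \<Phi> (\<lambda>x. T x c) p is"
    unfolding lincomb_def cX_add[OF tsm_mult[OF csm_const tS] tsm_mult[OF csm_const tT] p l]
    by (simp add: cX_def cd_mult[OF csm_const tS p l] cd_mult[OF csm_const tT p l] sum_distrib_left mult_ac)
  then show "cX h c (XX c) \<Phi> (\<lambda>x. lincomb a S b T x c) p is = w * lincomb a S b T p c is"
    using S(2) T(2) c p l by (simp add: weight_def lincomb_def algebra_simps)
qed

text \<open>By \<open>division\<close> the field is \<open>Q\<close> times a tensor field, and the
  operator commutes with this factor \<open>Q\<close>, so the result again vanishes on the zero set.
  This is what makes the operator depend only on restrictions.\<close>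

lemma power_vanishes:
  assumes S: "S \<in> tensor_field B \<Phi>" and w: "weight \<Phi> w S" and m: "1 \<le> m"
    and wm: "2 * w = 2 * real m + 2 - real CARD('k)"
    and v: "\<And>x. Q x = 0 \<Longrightarrow> S x = (\<lambda>_ _. 0)" and x: "Q x = 0"
  shows "(laplacian_alpha B h \<Phi> \<alpha> ^^ m) S x = (\<lambda>_ _. 0)"
proof -
  obtain T where T: "T \<in> tensor_field B \<Phi>" "S = fmult Q T" by (rule division[OF S v])
  show ?thesis
    unfolding T(2) tangential_power[OF T(1) w[unfolded T(2)] m wm] using x by (simp add: fmult_def tscale_def)
qed

end

lemma to_tractor_lincomb: "to_tractor C i (lincomb a S b T) = tractor_lincomb a (to_tractor C i S) b (to_tractor C i T)"
  by (simp add: to_tractor_def tractor_lincomb_def lincomb_def fun_eq_iff)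

theorem proposition4p8:
  fixes A :: "('m::{t2_space, second_countable_topology}, 'n::finite) chart set"
    and C :: "('m, 'n) tfield set"
    and p q :: nat
    and B :: "('a::{t2_space, second_countable_topology}, 'k::finite) chart set"
    and \<rho> :: "real \<Rightarrow> 'a \<Rightarrow> 'a"
    and i :: "'m \<times> ('m, 'n) tensor \<Rightarrow> 'a"
    and h :: "('a, 'k) tfield"
    and \<Phi> :: "index_pos list"
    and V :: "'a \<Rightarrow> ('a, 'k) tensor set"
    and \<alpha> w w' :: real
    and m :: nat
  assumes "3 \<le> CARD('n)"
    and "ambient_metric A C p q B \<rho> i h"
    and "tensor_bundle B h \<Phi> V"
    and "1 \<le> m"
    and "w = real m - real CARD('n) / 2"
    and "w' = - real m - real CARD('n) / 2"
  shows "laplacian_alpha B h \<Phi> \<alpha> ^^ m \<in> hom_sections B h \<rho> \<Phi> V w \<rightarrow> hom_sections B h \<rho> \<Phi> V w' \<and>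
         tangential (norm_sq B h (generator B \<rho>)) (sections B \<Phi> V) (hom_sections B h \<rho> \<Phi> V w)
           (laplacian_alpha B h \<Phi> \<alpha> ^^ m) \<and>
         (\<exists>!Box. Box \<in> tractor_sections C i B h \<rho> \<Phi> V w \<rightarrow>\<^sub>E tractor_sections C i B h \<rho> \<Phi> V w' \<and>
            linear_operator tractor_lincomb (tractor_sections C i B h \<rho> \<Phi> V w) Box \<and>
            (\<forall>S\<in>hom_sections B h \<rho> \<Phi> V w.
               Box (to_tractor C i S) = to_tractor C i ((laplacian_alpha B h \<Phi> \<alpha> ^^ m) S)))"
proof -
  interpret ambient_metric A C p q B \<rho> i h by fact
  let ?X = "generator B \<rho>"
  let ?Q = "norm_sq B h ?X"
  have sig: "h \<in> tensor_field B [Dn, Dn]" "\<And>c x. c \<in> B \<Longrightarrow> x \<in> fst c \<Longrightarrow> has_signature (gmat h x c) (p + 1) (q + 1)"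
    using signature by (auto simp: pseudo_metric_def)
  interpret bundle_manifold B h \<Phi> V
    by unfold_locales (use atlas sig has_signature_nondegenerate assms(3) in blast)+
  have regular: "\<exists>a. pd c a ?Q u \<noteq> 0" if "c \<in> B" "u \<in> fst c" "?Q u = 0" for c u
    using defining that unfolding defining_function_def by blast
  interpret euler_manifold B h ?X ?Q
    by unfold_locales (use homogeneous euler regular defining in \<open>auto simp: defining_function_def\<close>)
  let ?L = "laplacian_alpha B h \<Phi> \<alpha> ^^ m"
  let ?H = "hom_sections B h \<rho> \<Phi> V w" and ?H' = "hom_sections B h \<rho> \<Phi> V w'"
  have zeros: "?Q u = 0 \<longleftrightarrow> u \<in> i ` ray_bundle C" for u
    using defining by (auto simp: defining_function_def)
  have hom: "S \<in> hom_sections B h \<rho> \<Phi> V v \<longleftrightarrow> S \<in> sections B \<Phi> V \<and> weight \<Phi> v S" for S v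
    using cov_along_weight[of S \<Phi> v] by (auto simp: hom_sections_def sections_def)
  have field: "S \<in> tensor_field B \<Phi>" if "S \<in> sections B \<Phi> V" for S using that by (simp add: sections_def)
  \<comment> \<open>The ambient dimension is n + 2, so \<open>w\<close> takes the form expected by
    \<open>tangential_power\<close>.\<close>
  have wm: "2 * w = 2 * real m + 2 - real CARD('k)" using dimension assms(5) by simp
  have w': "w' = w - 2 * real m" using assms(5,6) by simp
  have LH: "?L S \<in> ?H'" if "S \<in> ?H" for S
    using that laplacian_alpha_power_sections weight_laplacian_power[OF field] unfolding hom w' by blast
  have "tangential ?Q (sections B \<Phi> V) ?H ?L"
    unfolding tangential_def
  proof (intro exI[of _ ?L] conjI ballI impI)
    show "linear_operator lincomb {S \<in> sections B \<Phi> V. fmult ?Q S \<in> ?H} ?L"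
      unfolding linear_operator_def using laplacian_alpha_power_lincomb field by blast
    fix S assume S: "S \<in> sections B \<Phi> V" "fmult ?Q S \<in> ?H"
    show "?L S \<in> sections B \<Phi> V" by (rule laplacian_alpha_power_sections[OF S(1)])
    show "?L (fmult ?Q S) = fmult ?Q (?L S)"
      using tangential_power[OF field[OF S(1)] _ assms(4) wm] S(2) by (simp add: hom)
  qed
  moreover have Hlin: "lincomb a S b T \<in> ?H" if "S \<in> ?H" "T \<in> ?H" for a b S T
    using that sections_lincomb weight_lincomb field unfolding hom by blast
  \<comment> \<open>Two homogeneous extensions of one tractor field differ by a section vanishing on
    the image of the ray bundle, which is the zero set of \<open>?Q\<close>;
    \<open>power_vanishes\<close> applies to the difference.\<close>
  have welldef: "to_tractor C i (?L S) = to_tractor C i (?L T)" if S: "S \<in> ?H" and T: "T \<in> ?H" and e: "to_tractor C i S = to_tractor C i T" for S T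
  proof -
    let ?D = "lincomb 1 S (- 1) T"
    have D: "?D \<in> ?H" by (rule Hlin[OF S T])
    have ST: "S (i z) = T (i z)" if "z \<in> ray_bundle C" for z
      using fun_cong[OF fun_cong[OF e], of "fst z" "snd z"] that by (simp add: to_tractor_def)
    have "?D x = (\<lambda>_ _. 0)" if "?Q x = 0" for x
      using ST that unfolding zeros by (auto simp: lincomb_def)
    then have "?L ?D x = (\<lambda>_ _. 0)" if "?Q x = 0" for x
      using power_vanishes[OF _ _ assms(4) wm] D field that unfolding hom by blast
    moreover have "?L ?D = lincomb 1 (?L S) (- 1) (?L T)"
      using laplacian_alpha_power_lincomb S T field unfolding hom by blast
    ultimately have "?L S x = ?L T x" if "?Q x = 0" for x
      using that by (simp add: lincomb_def fun_eq_iff)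
    then show ?thesis by (auto simp: to_tractor_def fun_eq_iff zeros)
  qed
  let ?D = "tractor_sections C i B h \<rho> \<Phi> V w" and ?D' = "tractor_sections C i B h \<rho> \<Phi> V w'"
  \<comment> \<open>Any homogeneous extension serves, by \<open>welldef\<close>. Outside
    \<open>?D\<close> the value is \<open>undefined\<close>, as the extensional function space
    demands.\<close>
  define Box where "Box = restrict (\<lambda>s. to_tractor C i (?L (SOME S. S \<in> ?H \<and> to_tractor C i S = s))) ?D"
  have Box: "Box (to_tractor C i S) = to_tractor C i (?L S)" if S: "S \<in> ?H" for S
  proof -
    let ?S = "SOME T. T \<in> ?H \<and> to_tractor C i T = to_tractor C i S"
    have "?S \<in> ?H \<and> to_tractor C i ?S = to_tractor C i S" by (rule someI[of _ S]) (simp add: S)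
    then have "to_tractor C i (?L ?S) = to_tractor C i (?L S)" using welldef S by blast
    then show ?thesis using S by (simp add: Box_def tractor_sections_def)
  qed
  have "\<exists>!Box. Box \<in> ?D \<rightarrow>\<^sub>E ?D' \<and> linear_operator tractor_lincomb ?D Box \<and>
    (\<forall>S\<in>?H. Box (to_tractor C i S) = to_tractor C i (?L S))"
  proof (rule ex1I[of _ Box], intro conjI ballI Box)
    show "Box \<in> ?D \<rightarrow>\<^sub>E ?D'"
    proof (rule PiE_I)
      fix s assume "s \<in> ?D"
      then obtain S where "S \<in> ?H" "s = to_tractor C i S" by (auto simp: tractor_sections_def)
      then show "Box s \<in> ?D'" using Box LH by (simp add: tractor_sections_def)
    qed (simp add: Box_def)
    show "linear_operator tractor_lincomb ?D Box"
      unfolding linear_operator_def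
    proof (intro ballI allI)
      fix s t a b assume "s \<in> ?D" "t \<in> ?D"
      then obtain S T where S: "S \<in> ?H" "s = to_tractor C i S" and T: "T \<in> ?H" "t = to_tractor C i T"
        by (auto simp: tractor_sections_def)
      have "?L (lincomb a S b T) = lincomb a (?L S) b (?L T)"
        using laplacian_alpha_power_lincomb S T field unfolding hom by blast
      then show "Box (tractor_lincomb a s b t) = tractor_lincomb a (Box s) b (Box t)"
        using Box[OF Hlin[OF S(1) T(1), of a b]] Box[OF S(1)] Box[OF T(1)] by (simp add: S T to_tractor_lincomb)
    qed
    \<comment> \<open>Every element of \<open>?D\<close> is the restriction of a homogeneous
      section, so the last condition determines \<open>Box'\<close> on \<open>?D\<close>;
      extensionality determines it elsewhere.\<close>
    fix Box' assume B': "Box' \<in> ?D \<rightarrow>\<^sub>E ?D' \<and> linear_operator tractor_lincomb ?D Box' \<and>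
      (\<forall>S\<in>?H. Box' (to_tractor C i S) = to_tractor C i (?L S))"
    show "Box' = Box"
    proof
      fix s show "Box' s = Box s"
      proof (cases "s \<in> ?D")
        case True
        then show ?thesis using B' Box by (auto simp: tractor_sections_def)
      next
        case False
        then show ?thesis using B' PiE_arb by (fastforce simp: Box_def)
      qed
    qed
  qed
  ultimately show ?thesis using LH by blast
qed

end
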